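(* Let $G$ be a Lie groupoid over $M$, let $L_G$ be a multiplicative Dirac structure on $G$, and let $B_G$ be a closed multiplicative $2$-form on $G$. Then the Dirac structure $L^B_G:=\tau_{B_G}(L_G)$ is also multiplicative.
   Context: For a manifold $P$ put $\mathbb{T}P=TP\oplus T^*P$, with pairing $\langle (X,\alpha),(Y,\beta)\rangle=\alpha(Y)+\beta(X)$ and Courant bracket $[\![(X,\alpha),(Y,\beta)]\!]=([X,Y],\mathcal{L}_X\beta-i_Y d\alpha)$. A Dirac structure on $P$ is a subbundle $L\subseteq\mathbb{T}P$ with $L^\perp=L$ and $[\![\Gamma(L),\Gamma(L)]\!]\subseteq\Gamma(L)$. For a $2$-form $B$ on $P$, $\tau_B:\mathbb{T}P\to\mathbb{T}P$ is $\tau_B(X,\alpha)=(X,\alpha+i_XB)$; if $B$ is closed, $\tau_B$ maps Dirac structures to Dirac structures. $G$ has source and target $\mathsf{s},\mathsf{t}:G\to M$, composable pairs $G_{(2)}=\{(g,h):\mathsf{t}(h)=\mathsf{s}(g)\}$ and multiplication $m_G$; $AG=\ker(T\mathsf{s})|_M$ is its Lie algebroid. A $2$-form $\omega$ on $G$ is multiplicative if $m_G^*\omega=\mathrm{pr}_1^*\omega+\mathrm{pr}_2^*\omega$ on $G_{(2)}$. The tangent groupoid $TG$ over $TM$ is obtained by applying the tangent functor to all structure maps; write $X_g\bullet Y_h=Tm_G(X_g,Y_h)$. The cotangent groupoid $T^*G$ over $A^*G$ has source $\tilde{\mathsf{s}}(\xi_g)(a)=\xi_g(Tl_g(a-T\mathsf{t}(a)))$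 for $a\in A_{\mathsf{s}(g)}G$, target $\tilde{\mathsf{t}}(\xi_g)(b)=\xi_g(Tr_g(b))$ for $b\in A_{\mathsf{t}(g)}G$, and multiplication $(\xi_g\circ\eta_h)(X_g\bullet Y_h)=\xi_g(X_g)+\eta_h(Y_h)$. $\mathbb{T}G=TG\oplus T^*G$ is a Lie groupoid over $TM\oplus A^*G$ with the direct sum structure. A Dirac structure $L_G$ on $G$ is multiplicative if it is a Lie subgroupoid of $\mathbb{T}G$. *)

theory Defs
  imports "HOL-Analysis.Analysis"
begin

section \<open>Smooth maps between finite-dimensional normed spaces\<close>

text \<open>
  Model spaces are finite-dimensional normed spaces rather than members of class
  \<open>euclidean_space\<close>, because that class excludes dimension 0 (needed, e.g., for Lie groups,
  which are groupoids over a point) and because it is not closed under taking duals.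
  A finite-dimensional type of class \<open>real_inner\<close> plays the role of \<open>\<real>\<^sup>n\<close>, \<open>n \<ge> 0\<close>.
\<close>

definition finite_dimensional :: "'e::real_vector itself \<Rightarrow> bool" where
  "finite_dimensional _ \<longleftrightarrow> (\<exists>B::'e set. finite B \<and> span B = UNIV)"

text \<open>Only used for open \<open>S\<close> in a finite-dimensional space, where it is the usual \<open>C\<^sup>k\<close>.\<close>

primrec Ck_on :: "nat \<Rightarrow> 'a::real_normed_vector set \<Rightarrow> ('a \<Rightarrow> 'b::real_normed_vector) \<Rightarrow> bool" where
  "Ck_on 0 S f \<longleftrightarrow> continuous_on S f"
| "Ck_on (Suc k) S f \<longleftrightarrow>
     (\<forall>x\<in>S. f differentiable (at x)) \<and> (\<forall>v. Ck_on k S (\<lambda>x. frechet_derivative f (at x) v))"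

definition smooth_on :: "'a::real_normed_vector set \<Rightarrow> ('a \<Rightarrow> 'b::real_normed_vector) \<Rightarrow> bool" where
  "smooth_on S f \<longleftrightarrow> (\<forall>k. Ck_on k S f)"

section \<open>Manifolds\<close>

type_synonym ('a, 'e) chart = "'a set \<times> ('a \<Rightarrow> 'e)"

text \<open>
  An atlas together with a preferred chart at each point. The latter carries no information
  up to diffeomorphism; it serves to represent the tangent space at \<open>p\<close> by the model space \<open>'e\<close>:
  \<open>v :: 'e\<close> stands for the tangent vector at \<open>p\<close> whose coordinates in \<open>chart_at M p\<close> are \<open>v\<close>.
\<close>

record ('a, 'e) manifold =
  atlas :: "('a, 'e) chart set"
  chart_at :: "'a \<Rightarrow> ('a, 'e) chart"

definition cinv :: "('a, 'e) chart \<Rightarrow> 'e \<Rightarrow> 'a" where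
  "cinv c = inv_into (fst c) (snd c)"

definition points :: "('a, 'e) manifold \<Rightarrow> 'a set" where
  "points M = (\<Union>c\<in>atlas M. fst c)"

definition is_chart :: "('a, 'e::real_normed_vector) chart \<Rightarrow> bool" where
  "is_chart c \<longleftrightarrow> inj_on (snd c) (fst c) \<and> open (snd c ` fst c)"

definition compatible :: "('a, 'e::real_normed_vector) chart \<Rightarrow> ('a, 'e) chart \<Rightarrow> bool" where
  "compatible c d \<longleftrightarrow>
     open (snd c ` (fst c \<inter> fst d)) \<and> smooth_on (snd c ` (fst c \<inter> fst d)) (snd d \<circ> cinv c) \<and>
     open (snd d ` (fst c \<inter> fst d)) \<and> smooth_on (snd d ` (fst c \<inter> fst d)) (snd c \<circ> cinv d)"

definition mtop :: "('a, 'e::real_normed_vector) manifold \<Rightarrow> 'a topology" where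
  "mtop M = topology (\<lambda>U. U \<subseteq> points M \<and> (\<forall>c\<in>atlas M. open (snd c ` (U \<inter> fst c))))"

definition is_manifold :: "('a, 'e::real_normed_vector) manifold \<Rightarrow> bool" where
  "is_manifold M \<longleftrightarrow>
     finite_dimensional TYPE('e) \<and>
     (\<forall>c\<in>atlas M. is_chart c) \<and> (\<forall>c\<in>atlas M. \<forall>d\<in>atlas M. compatible c d) \<and>
     (\<forall>p\<in>points M. chart_at M p \<in> atlas M \<and> p \<in> fst (chart_at M p)) \<and>
     Hausdorff_space (mtop M) \<and> second_countable (mtop M)"

definition prod_manifold ::
    "('a, 'e) manifold \<Rightarrow> ('b, 'f) manifold \<Rightarrow> ('a \<times> 'b, 'e \<times> 'f) manifold" where
  "prod_manifold M N =
     \<lparr>atlas = {(fst c \<times> fst d, map_prod (snd c) (snd d)) | c d. c \<in> atlas M \<and> d \<in> atlas N},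
      chart_at = (\<lambda>(p, q). (fst (chart_at M p) \<times> fst (chart_at N q),
                            map_prod (snd (chart_at M p)) (snd (chart_at N q))))\<rparr>"

subsection \<open>Smooth maps\<close>

definition smooth_open ::
    "('a, 'e::real_normed_vector) manifold \<Rightarrow> 'a set \<Rightarrow> ('b, 'f::real_normed_vector) manifold
     \<Rightarrow> ('a \<Rightarrow> 'b) \<Rightarrow> bool" where
  "smooth_open M U N f \<longleftrightarrow>
     f ` U \<subseteq> points N \<and>
     (\<forall>c\<in>atlas M. \<forall>d\<in>atlas N. let V = U \<inter> fst c \<inter> f -` fst d in
        open (snd c ` V) \<and> smooth_on (snd c ` V) (snd d \<circ> f \<circ> cinv c))"

text \<open>Smoothness on an arbitrary (in practice: embedded) subset, by local smooth extension.\<close>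

definition smooth_map_on ::
    "('a, 'e::real_normed_vector) manifold \<Rightarrow> 'a set \<Rightarrow> ('b, 'f::real_normed_vector) manifold
     \<Rightarrow> ('a \<Rightarrow> 'b) \<Rightarrow> bool" where
  "smooth_map_on M S N f \<longleftrightarrow>
     f ` S \<subseteq> points N \<and>
     (\<forall>p\<in>S. \<exists>U f'. openin (mtop M) U \<and> p \<in> U \<and> smooth_open M U N f' \<and> (\<forall>q\<in>S \<inter> U. f' q = f q))"

subsection \<open>Tangent maps\<close>

text \<open>\<open>dchart M c p\<close> sends a tangent vector at \<open>p\<close> to its coordinates in the chart \<open>c\<close>.\<close>

definition dchart ::
    "('a, 'e::real_normed_vector) manifold \<Rightarrow> ('a, 'e) chart \<Rightarrow> 'a \<Rightarrow> 'e \<Rightarrow> 'e" where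
  "dchart M c p =
     frechet_derivative (snd c \<circ> cinv (chart_at M p)) (at (snd (chart_at M p) p))"

definition dchart_inv ::
    "('a, 'e::real_normed_vector) manifold \<Rightarrow> ('a, 'e) chart \<Rightarrow> 'a \<Rightarrow> 'e \<Rightarrow> 'e" where
  "dchart_inv M c p = frechet_derivative (snd (chart_at M p) \<circ> cinv c) (at (snd c p))"

text \<open>
  Tangent map of \<open>f\<close>, defined on the submanifold \<open>S\<close> of \<open>M\<close>. The derivative within the
  coordinate image of \<open>S\<close> is determined on vectors tangent to \<open>S\<close> only, and it is only
  to be applied to those.
\<close>

definition tmap_on ::
    "('a, 'e::real_normed_vector) manifold \<Rightarrow> 'a set \<Rightarrow> ('b, 'f::real_normed_vector) manifold
     \<Rightarrow> ('a \<Rightarrow> 'b) \<Rightarrow> 'a \<times> 'e \<Rightarrow> 'b \<times> 'f" where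
  "tmap_on M S N f = (\<lambda>(p, v).
     let c = chart_at M p; d = chart_at N (f p) in
     (f p, frechet_derivative (snd d \<circ> f \<circ> cinv c) (at (snd c p) within snd c ` (S \<inter> fst c)) v))"

abbreviation tmap ::
    "('a, 'e::real_normed_vector) manifold \<Rightarrow> ('b, 'f::real_normed_vector) manifold
     \<Rightarrow> ('a \<Rightarrow> 'b) \<Rightarrow> 'a \<times> 'e \<Rightarrow> 'b \<times> 'f" where
  "tmap M N f \<equiv> tmap_on M (points M) N f"

subsection \<open>Embedded submanifolds\<close>

definition slice_chart ::
    "('a, 'e::real_normed_vector) manifold \<Rightarrow> 'a set \<Rightarrow> 'a \<Rightarrow> ('a, 'e) chart \<Rightarrow> 'e set \<Rightarrow> bool" where
  "slice_chart M S p c W \<longleftrightarrow>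
     is_chart c \<and> fst c \<subseteq> points M \<and> (\<forall>d\<in>atlas M. compatible c d) \<and> p \<in> fst c \<and>
     subspace W \<and> snd c ` (fst c \<inter> S) = snd c ` fst c \<inter> W"

text \<open>Submanifolds have the same dimension \<open>k\<close> at all of their points.\<close>

definition embedded_submanifold :: "('a, 'e::real_normed_vector) manifold \<Rightarrow> 'a set \<Rightarrow> bool" where
  "embedded_submanifold M S \<longleftrightarrow>
     S \<subseteq> points M \<and> (\<exists>k. \<forall>p\<in>S. \<exists>c W. slice_chart M S p c W \<and> dim W = k)"

definition subtangent :: "('a, 'e::real_normed_vector) manifold \<Rightarrow> 'a set \<Rightarrow> 'a \<Rightarrow> 'e set" where
  "subtangent M S p = {v. \<exists>c W. slice_chart M S p c W \<and> dchart M c p v \<in> W}"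

text \<open>\<open>f\<close> restricts to a submersion from the submanifold \<open>S\<close> of \<open>M\<close> to the submanifold \<open>R\<close> of \<open>N\<close>.\<close>

definition submersion_on ::
    "('a, 'e::real_normed_vector) manifold \<Rightarrow> 'a set \<Rightarrow> ('b, 'f::real_normed_vector) manifold
     \<Rightarrow> 'b set \<Rightarrow> ('a \<Rightarrow> 'b) \<Rightarrow> bool" where
  "submersion_on M S N R f \<longleftrightarrow>
     smooth_map_on M S N f \<and> f ` S \<subseteq> R \<and>
     (\<forall>p\<in>S. \<forall>w\<in>subtangent N R (f p). \<exists>v\<in>subtangent M S p. tmap_on M S N f (p, v) = (f p, w))"

section \<open>Tangent bundle and generalized tangent bundle\<close>

definition tangent ::
    "('a, 'e::real_normed_vector) manifold \<Rightarrow> ('a \<times> 'e, 'e \<times> 'e) manifold" where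
  "tangent M = (let T = (\<lambda>c. ({(p, v). p \<in> fst c}, \<lambda>(p, v). (snd c p, dchart M c p v))) in
     \<lparr>atlas = T ` atlas M, chart_at = (\<lambda>(p, v). T (chart_at M p))\<rparr>)"

text \<open>
  The bundle \<open>TM \<oplus> T*M\<close>, whose elements are \<open>(p, v, \<alpha>)\<close>. Covectors at \<open>p\<close> are (bounded) linear
  functionals on the tangent space, i.e. elements of the dual of \<open>'e\<close>.
\<close>

type_synonym 'e gvec = "'e \<times> ('e \<Rightarrow>\<^sub>L real)"

definition gtangent ::
    "('a, 'e::real_normed_vector) manifold \<Rightarrow> ('a \<times> 'e gvec, 'e \<times> 'e gvec) manifold" where
  "gtangent M = (let T = (\<lambda>c. ({(p, e). p \<in> fst c},
       \<lambda>(p, v, \<alpha>). (snd c p, dchart M c p v, Blinfun (\<lambda>w. blinfun_apply \<alpha> (dchart_inv M c p w))))) in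
     \<lparr>atlas = T ` atlas M, chart_at = (\<lambda>(p, e). T (chart_at M p))\<rparr>)"

subsection \<open>Local representatives, Courant bracket\<close>

definition vf_rep ::
    "('a, 'e::real_normed_vector) manifold \<Rightarrow> ('a, 'e) chart \<Rightarrow> ('a \<Rightarrow> 'e) \<Rightarrow> 'e \<Rightarrow> 'e" where
  "vf_rep M c X x = dchart M c (cinv c x) (X (cinv c x))"

definition cov_rep ::
    "('a, 'e::real_normed_vector) manifold \<Rightarrow> ('a, 'e) chart \<Rightarrow> ('a \<Rightarrow> 'e \<Rightarrow>\<^sub>L real)
     \<Rightarrow> 'e \<Rightarrow> 'e \<Rightarrow>\<^sub>L real" where
  "cov_rep M c \<alpha> x = Blinfun (\<lambda>w. blinfun_apply (\<alpha> (cinv c x)) (dchart_inv M c (cinv c x) w))"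

definition form2_rep ::
    "('a, 'e::real_normed_vector) manifold \<Rightarrow> ('a, 'e) chart \<Rightarrow> ('a \<Rightarrow> 'e \<Rightarrow>\<^sub>L 'e \<Rightarrow>\<^sub>L real)
     \<Rightarrow> 'e \<Rightarrow> 'e \<Rightarrow> 'e \<Rightarrow> real" where
  "form2_rep M c B x u w =
     blinfun_apply (blinfun_apply (B (cinv c x)) (dchart_inv M c (cinv c x) u))
       (dchart_inv M c (cinv c x) w)"

text \<open>
  The operations of Cartan calculus at \<open>p\<close> are given by their coordinate formulas, which are
  chart-independent, in the preferred chart at \<open>p\<close>. This is the chart that identifies the
  tangent space at \<open>p\<close> with \<open>'e\<close>, so the results need no conversion.
\<close>

definition lie_bracket ::
    "('a, 'e::real_normed_vector) manifold \<Rightarrow> ('a \<Rightarrow> 'e) \<Rightarrow> ('a \<Rightarrow> 'e) \<Rightarrow> 'a \<Rightarrow> 'e" where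
  "lie_bracket M X Y p = (let c = chart_at M p; x = snd c p in
     frechet_derivative (vf_rep M c Y) (at x) (X p) - frechet_derivative (vf_rep M c X) (at x) (Y p))"

definition lie_deriv1 ::
    "('a, 'e::real_normed_vector) manifold \<Rightarrow> ('a \<Rightarrow> 'e) \<Rightarrow> ('a \<Rightarrow> 'e \<Rightarrow>\<^sub>L real)
     \<Rightarrow> 'a \<Rightarrow> 'e \<Rightarrow> real" where
  "lie_deriv1 M X \<beta> p v = (let c = chart_at M p; x = snd c p in
     blinfun_apply (frechet_derivative (cov_rep M c \<beta>) (at x) (X p)) v +
     blinfun_apply (\<beta> p) (frechet_derivative (vf_rep M c X) (at x) v))"

definition ext_deriv1 ::
    "('a, 'e::real_normed_vector) manifold \<Rightarrow> ('a \<Rightarrow> 'e \<Rightarrow>\<^sub>L real) \<Rightarrow> 'a \<Rightarrow> 'e \<Rightarrow> 'e \<Rightarrow> real" where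
  "ext_deriv1 M \<alpha> p u v = (let c = chart_at M p; x = snd c p in
     blinfun_apply (frechet_derivative (cov_rep M c \<alpha>) (at x) u) v -
     blinfun_apply (frechet_derivative (cov_rep M c \<alpha>) (at x) v) u)"

definition ext_deriv2 ::
    "('a, 'e::real_normed_vector) manifold \<Rightarrow> ('a \<Rightarrow> 'e \<Rightarrow>\<^sub>L 'e \<Rightarrow>\<^sub>L real)
     \<Rightarrow> 'a \<Rightarrow> 'e \<Rightarrow> 'e \<Rightarrow> 'e \<Rightarrow> real" where
  "ext_deriv2 M B p u v w = (let c = chart_at M p; x = snd c p in
     frechet_derivative (\<lambda>y. form2_rep M c B y v w) (at x) u -
     frechet_derivative (\<lambda>y. form2_rep M c B y u w) (at x) v +
     frechet_derivative (\<lambda>y. form2_rep M c B y u v) (at x) w)"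

definition courant_bracket ::
    "('a, 'e::real_normed_vector) manifold \<Rightarrow> ('a \<Rightarrow> 'e gvec) \<Rightarrow> ('a \<Rightarrow> 'e gvec)
     \<Rightarrow> 'a \<Rightarrow> 'e gvec" where
  "courant_bracket M e1 e2 p =
     (let X = fst \<circ> e1; \<alpha> = snd \<circ> e1; Y = fst \<circ> e2; \<beta> = snd \<circ> e2 in
      (lie_bracket M X Y p, Blinfun (\<lambda>v. lie_deriv1 M X \<beta> p v - ext_deriv1 M \<alpha> p (Y p) v)))"

subsection \<open>2-forms\<close>

definition two_form ::
    "('a, 'e::real_normed_vector) manifold \<Rightarrow> ('a \<Rightarrow> 'e \<Rightarrow>\<^sub>L 'e \<Rightarrow>\<^sub>L real) \<Rightarrow> bool" where
  "two_form M B \<longleftrightarrow>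
     (\<forall>p\<in>points M. \<forall>v. blinfun_apply (blinfun_apply (B p) v) v = 0) \<and>
     (\<forall>c\<in>atlas M. \<forall>u w. smooth_on (snd c ` fst c) (\<lambda>x. form2_rep M c B x u w))"

definition closed_form ::
    "('a, 'e::real_normed_vector) manifold \<Rightarrow> ('a \<Rightarrow> 'e \<Rightarrow>\<^sub>L 'e \<Rightarrow>\<^sub>L real) \<Rightarrow> bool" where
  "closed_form M B \<longleftrightarrow> (\<forall>p\<in>points M. \<forall>u v w. ext_deriv2 M B p u v w = 0)"

definition tau ::
    "('a \<Rightarrow> 'e \<Rightarrow>\<^sub>L 'e \<Rightarrow>\<^sub>L real) \<Rightarrow> 'a \<times> 'e gvec \<Rightarrow> 'a \<times> ('e::real_normed_vector) gvec" where
  "tau B = (\<lambda>(p, v, \<alpha>). (p, v, \<alpha> + blinfun_apply (B p) v))"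

section \<open>Dirac structures\<close>

definition gpair :: "('e::real_normed_vector) gvec \<Rightarrow> 'e gvec \<Rightarrow> real" where
  "gpair = (\<lambda>(X, \<alpha>) (Y, \<beta>). blinfun_apply \<alpha> Y + blinfun_apply \<beta> X)"

definition fibre :: "('a \<times> 'v) set \<Rightarrow> 'a \<Rightarrow> 'v set" where
  "fibre L p = {e. (p, e) \<in> L}"

definition subbundle ::
    "('a, 'e::real_normed_vector) manifold \<Rightarrow> ('a \<times> 'e gvec) set \<Rightarrow> bool" where
  "subbundle M L \<longleftrightarrow>
     L \<subseteq> points (gtangent M) \<and>
     (\<exists>k. \<forall>p\<in>points M. \<exists>U (\<sigma> :: nat \<Rightarrow> 'a \<Rightarrow> 'e gvec).
        openin (mtop M) U \<and> p \<in> U \<and>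
        (\<forall>i<k. smooth_open M U (gtangent M) (\<lambda>q. (q, \<sigma> i q))) \<and>
        (\<forall>q\<in>U. inj_on (\<lambda>i. \<sigma> i q) {..<k} \<and> independent ((\<lambda>i. \<sigma> i q) ` {..<k}) \<and>
                span ((\<lambda>i. \<sigma> i q) ` {..<k}) = fibre L q))"

definition sections ::
    "('a, 'e::real_normed_vector) manifold \<Rightarrow> ('a \<times> 'e gvec) set \<Rightarrow> ('a \<Rightarrow> 'e gvec) set" where
  "sections M L =
     {e. smooth_open M (points M) (gtangent M) (\<lambda>p. (p, e p)) \<and> (\<forall>p\<in>points M. (p, e p) \<in> L)}"

definition dirac_structure ::
    "('a, 'e::real_normed_vector) manifold \<Rightarrow> ('a \<times> 'e gvec) set \<Rightarrow> bool" where
  "dirac_structure M L \<longleftrightarrow>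
     subbundle M L \<and>
     (\<forall>p\<in>points M. {e. \<forall>e'\<in>fibre L p. gpair e e' = 0} = fibre L p) \<and>
     (\<forall>e1\<in>sections M L. \<forall>e2\<in>sections M L. courant_bracket M e1 e2 \<in> sections M L)"

section \<open>Lie groupoids\<close>

record ('g, 'e, 'm, 'f) groupoid =
  arrows :: "('g, 'e) manifold"
  objects :: "('m, 'f) manifold"
  gsrc :: "'g \<Rightarrow> 'm"
  gtgt :: "'g \<Rightarrow> 'm"
  gmul :: "'g \<Rightarrow> 'g \<Rightarrow> 'g"
  gunit :: "'m \<Rightarrow> 'g"
  ginv :: "'g \<Rightarrow> 'g"

definition composable :: "('g, 'e, 'm, 'f) groupoid \<Rightarrow> 'g set \<Rightarrow> ('g \<times> 'g) set" where
  "composable G H = {(g, h). g \<in> H \<and> h \<in> H \<and> gtgt G h = gsrc G g}"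

text \<open>
  The structure maps of \<open>G\<close> restrict to a Lie groupoid with arrows \<open>H\<close> and objects \<open>N\<close>, both
  carrying the structure of embedded submanifolds. When \<open>H\<close> is a subbundle of \<open>TG \<oplus> T*G\<close>,
  hence embedded, embeddedness of \<open>N\<close> is no restriction: \<open>N\<close> is embedded in \<open>H\<close> by the units.
\<close>

definition lie_groupoid_on ::
    "('g, 'e::real_normed_vector, 'm, 'f::real_normed_vector) groupoid \<Rightarrow> 'g set \<Rightarrow> 'm set \<Rightarrow> bool" where
  "lie_groupoid_on G H N \<longleftrightarrow>
     embedded_submanifold (arrows G) H \<and> embedded_submanifold (objects G) N \<and>
     submersion_on (arrows G) H (objects G) N (gsrc G) \<and>
     submersion_on (arrows G) H (objects G) N (gtgt G) \<and>
     smooth_map_on (prod_manifold (arrows G) (arrows G)) (composable G H) (arrows G)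
       (\<lambda>(g, h). gmul G g h) \<and>
     smooth_map_on (objects G) N (arrows G) (gunit G) \<and> gunit G ` N \<subseteq> H \<and>
     smooth_map_on (arrows G) H (arrows G) (ginv G) \<and> ginv G ` H \<subseteq> H \<and>
     (\<forall>(g, h)\<in>composable G H.
        gmul G g h \<in> H \<and> gsrc G (gmul G g h) = gsrc G h \<and> gtgt G (gmul G g h) = gtgt G g) \<and>
     (\<forall>(g, h)\<in>composable G H. \<forall>k\<in>H. gtgt G k = gsrc G h \<longrightarrow>
        gmul G (gmul G g h) k = gmul G g (gmul G h k)) \<and>
     (\<forall>x\<in>N. gsrc G (gunit G x) = x \<and> gtgt G (gunit G x) = x) \<and>
     (\<forall>g\<in>H. gmul G (gunit G (gtgt G g)) g = g \<and> gmul G g (gunit G (gsrc G g)) = g \<and>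
        gsrc G (ginv G g) = gtgt G g \<and> gtgt G (ginv G g) = gsrc G g \<and>
        gmul G g (ginv G g) = gunit G (gtgt G g) \<and> gmul G (ginv G g) g = gunit G (gsrc G g))"

definition lie_groupoid ::
    "('g, 'e::real_normed_vector, 'm, 'f::real_normed_vector) groupoid \<Rightarrow> bool" where
  "lie_groupoid G \<longleftrightarrow> is_manifold (arrows G) \<and> is_manifold (objects G) \<and>
     lie_groupoid_on G (points (arrows G)) (points (objects G))"

definition lie_subgroupoid ::
    "('g, 'e::real_normed_vector, 'm, 'f::real_normed_vector) groupoid \<Rightarrow> 'g set \<Rightarrow> bool" where
  "lie_subgroupoid G H \<longleftrightarrow> (\<exists>N. lie_groupoid_on G H N)"

subsection \<open>Tangent groupoid and Lie algebroid\<close>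

definition tsrc :: "('g, 'e::real_normed_vector, 'm, 'f::real_normed_vector) groupoid
    \<Rightarrow> 'g \<times> 'e \<Rightarrow> 'm \<times> 'f" where
  "tsrc G = tmap (arrows G) (objects G) (gsrc G)"

definition ttgt :: "('g, 'e::real_normed_vector, 'm, 'f::real_normed_vector) groupoid
    \<Rightarrow> 'g \<times> 'e \<Rightarrow> 'm \<times> 'f" where
  "ttgt G = tmap (arrows G) (objects G) (gtgt G)"

definition tunit :: "('g, 'e::real_normed_vector, 'm, 'f::real_normed_vector) groupoid
    \<Rightarrow> 'm \<times> 'f \<Rightarrow> 'g \<times> 'e" where
  "tunit G = tmap (objects G) (arrows G) (gunit G)"

definition tinv :: "('g, 'e::real_normed_vector, 'm, 'f::real_normed_vector) groupoid
    \<Rightarrow> 'g \<times> 'e \<Rightarrow> 'g \<times> 'e" where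
  "tinv G = tmap (arrows G) (arrows G) (ginv G)"

definition tmul :: "('g, 'e::real_normed_vector, 'm, 'f::real_normed_vector) groupoid
    \<Rightarrow> 'g \<times> 'e \<Rightarrow> 'g \<times> 'e \<Rightarrow> 'g \<times> 'e" where
  "tmul G = (\<lambda>(g, v) (h, w).
     tmap_on (prod_manifold (arrows G) (arrows G)) (composable G (points (arrows G))) (arrows G)
       (\<lambda>(g, h). gmul G g h) ((g, h), (v, w)))"

text \<open>The fibre of \<open>AG\<close> at \<open>x\<close>, as a subspace of the tangent space of \<open>G\<close> at the unit of \<open>x\<close>.\<close>

definition algebroid_fibre ::
    "('g, 'e::real_normed_vector, 'm, 'f::real_normed_vector) groupoid \<Rightarrow> 'm \<Rightarrow> 'e set" where
  "algebroid_fibre G x = {a. snd (tsrc G (gunit G x, a)) = 0}"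

text \<open>Linear functionals on the subspace \<open>V\<close>, extended by the dummy value 0 outside \<open>V\<close>.\<close>

definition dual_of :: "'e::real_vector set \<Rightarrow> ('e \<Rightarrow> real) set" where
  "dual_of V = {\<xi>. (\<forall>u\<in>V. \<forall>w\<in>V. \<xi> (u + w) = \<xi> u + \<xi> w) \<and>
                   (\<forall>r. \<forall>u\<in>V. \<xi> (r *\<^sub>R u) = r * \<xi> u) \<and> (\<forall>u. u \<notin> V \<longrightarrow> \<xi> u = 0)}"

text \<open>
  A smooth local frame of \<open>AG\<close> over the open set \<open>V\<close>. The type \<open>'k\<close> is the typical fibre of
  \<open>AG\<close>: an auxiliary vector space of dimension \<open>rank AG = dim G - dim M\<close>.
\<close>

definition algebroid_frame ::
    "('g, 'e::real_normed_vector, 'm, 'f::real_normed_vector) groupoid \<Rightarrow> 'm set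
     \<Rightarrow> ('m \<Rightarrow> 'k::real_normed_vector \<Rightarrow> 'e) \<Rightarrow> bool" where
  "algebroid_frame G V \<Phi> \<longleftrightarrow>
     (\<forall>x\<in>V. linear (\<Phi> x) \<and> bij_betw (\<Phi> x) UNIV (algebroid_fibre G x)) \<and>
     (\<forall>k. smooth_open (objects G) V (tangent (arrows G)) (\<lambda>x. (gunit G x, \<Phi> x k)))"

text \<open>
  The vector bundle \<open>TM \<oplus> A*G\<close> over \<open>M\<close>, with elements \<open>(x, X, \<xi>)\<close>, and with the charts induced
  by a chart of \<open>M\<close> and a local frame of \<open>AG\<close> over an open part of its domain.
\<close>

definition tm_dual_algebroid ::
    "('g, 'e::real_normed_vector, 'm, 'f::real_normed_vector) groupoid
     \<Rightarrow> ('m \<times> 'f \<times> ('e \<Rightarrow> real), 'f \<times> 'f \<times> ('k::real_normed_vector \<Rightarrow>\<^sub>L real)) manifold" where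
  "tm_dual_algebroid G =
     (let M = objects G;
          A = {({(x, X, \<xi>). x \<in> V \<and> \<xi> \<in> dual_of (algebroid_fibre G x)},
                \<lambda>(x, X, \<xi>). (snd c x, dchart M c x X, Blinfun (\<lambda>k. \<xi> (\<Phi> x k))))
               | c V \<Phi>. c \<in> atlas M \<and> openin (mtop M) V \<and> V \<subseteq> fst c \<and> algebroid_frame G V \<Phi>}
      in \<lparr>atlas = A, chart_at = (\<lambda>p. SOME c. c \<in> A \<and> p \<in> fst c)\<rparr>)"

subsection \<open>Cotangent groupoid and the direct sum groupoid\<close>

text \<open>\<open>a - Tt(a)\<close> for \<open>a\<close> in \<open>A\<^sub>xG\<close>, with \<open>TM\<close> embedded in \<open>TG\<close> along the units.\<close>

definition minus_anchor :: "('g, 'e::real_normed_vector, 'm, 'f::real_normed_vector) groupoid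
    \<Rightarrow> 'm \<Rightarrow> 'e \<Rightarrow> 'e" where
  "minus_anchor G x a = a - snd (tunit G (ttgt G (gunit G x, a)))"

definition tleft :: "('g, 'e::real_normed_vector, 'm, 'f::real_normed_vector) groupoid
    \<Rightarrow> 'g \<Rightarrow> 'e \<Rightarrow> 'e" where
  "tleft G g a = snd (tmap_on (arrows G) {h \<in> points (arrows G). gtgt G h = gsrc G g} (arrows G)
     (\<lambda>h. gmul G g h) (gunit G (gsrc G g), a))"

definition tright :: "('g, 'e::real_normed_vector, 'm, 'f::real_normed_vector) groupoid
    \<Rightarrow> 'g \<Rightarrow> 'e \<Rightarrow> 'e" where
  "tright G g b = snd (tmap_on (arrows G) {h \<in> points (arrows G). gsrc G h = gtgt G g} (arrows G)
     (\<lambda>h. gmul G h g) (gunit G (gtgt G g), b))"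

definition cosrc :: "('g, 'e::real_normed_vector, 'm, 'f::real_normed_vector) groupoid
    \<Rightarrow> 'g \<Rightarrow> ('e \<Rightarrow>\<^sub>L real) \<Rightarrow> 'e \<Rightarrow> real" where
  "cosrc G g \<xi> a = (if a \<in> algebroid_fibre G (gsrc G g)
     then blinfun_apply \<xi> (tleft G g (minus_anchor G (gsrc G g) a)) else 0)"

definition cotgt :: "('g, 'e::real_normed_vector, 'm, 'f::real_normed_vector) groupoid
    \<Rightarrow> 'g \<Rightarrow> ('e \<Rightarrow>\<^sub>L real) \<Rightarrow> 'e \<Rightarrow> real" where
  "cotgt G g \<xi> b = (if b \<in> algebroid_fibre G (gtgt G g)
     then blinfun_apply \<xi> (tright G g b) else 0)"

definition comul :: "('g, 'e::real_normed_vector, 'm, 'f::real_normed_vector) groupoid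
    \<Rightarrow> 'g \<times> ('e \<Rightarrow>\<^sub>L real) \<Rightarrow> 'g \<times> ('e \<Rightarrow>\<^sub>L real) \<Rightarrow> 'e \<Rightarrow>\<^sub>L real" where
  "comul G = (\<lambda>(g, \<xi>) (h, \<eta>). THE \<zeta>. \<forall>v w. ttgt G (h, w) = tsrc G (g, v) \<longrightarrow>
     blinfun_apply \<zeta> (snd (tmul G (g, v) (h, w))) = blinfun_apply \<xi> v + blinfun_apply \<eta> w)"

text \<open>
  The units and inverses of the cotangent groupoid are determined by the other structure maps:
  the unit of \<open>\<xi>\<close> in \<open>A*\<^sub>xG\<close> vanishes on vectors tangent to \<open>M\<close> and agrees with \<open>\<xi>\<close> on \<open>A\<^sub>xG\<close>,
  and \<open>\<xi>\<^sup>-\<^sup>1 (X\<^sup>-\<^sup>1) = - \<xi> X\<close>.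
\<close>

definition counit :: "('g, 'e::real_normed_vector, 'm, 'f::real_normed_vector) groupoid
    \<Rightarrow> 'm \<Rightarrow> ('e \<Rightarrow> real) \<Rightarrow> 'e \<Rightarrow>\<^sub>L real" where
  "counit G x \<xi> = Blinfun (\<lambda>v. \<xi> (v - snd (tunit G (tsrc G (gunit G x, v)))))"

definition coinv :: "('g, 'e::real_normed_vector, 'm, 'f::real_normed_vector) groupoid
    \<Rightarrow> 'g \<Rightarrow> ('e \<Rightarrow>\<^sub>L real) \<Rightarrow> 'e \<Rightarrow>\<^sub>L real" where
  "coinv G g \<xi> = Blinfun (\<lambda>w. - blinfun_apply \<xi> (snd (tinv G (ginv G g, w))))"

definition courant_groupoid ::
    "('g, 'e::real_normed_vector, 'm, 'f::real_normed_vector) groupoid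
     \<Rightarrow> ('g \<times> 'e gvec, 'e \<times> 'e gvec, 'm \<times> 'f \<times> ('e \<Rightarrow> real),
         'f \<times> 'f \<times> ('k::real_normed_vector \<Rightarrow>\<^sub>L real)) groupoid" where
  "courant_groupoid G =
     \<lparr>arrows = gtangent (arrows G),
      objects = tm_dual_algebroid G,
      gsrc = (\<lambda>(g, v, \<xi>). (gsrc G g, snd (tsrc G (g, v)), cosrc G g \<xi>)),
      gtgt = (\<lambda>(g, v, \<xi>). (gtgt G g, snd (ttgt G (g, v)), cotgt G g \<xi>)),
      gmul = (\<lambda>(g, v, \<xi>) (h, w, \<eta>).
                (gmul G g h, snd (tmul G (g, v) (h, w)), comul G (g, \<xi>) (h, \<eta>))),
      gunit = (\<lambda>(x, X, \<xi>). (gunit G x, snd (tunit G (x, X)), counit G x \<xi>)),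
      ginv = (\<lambda>(g, v, \<xi>). (ginv G g, snd (tinv G (g, v)), coinv G g \<xi>))\<rparr>"

section \<open>Multiplicative structures\<close>

text \<open>
  \<open>m*B = pr\<^sub>1*B + pr\<^sub>2*B\<close> on \<open>G\<^sub>(\<^sub>2\<^sub>)\<close>, whose tangent vectors are the pairs of vectors that are
  composable in the tangent groupoid.
\<close>

definition multiplicative_form ::
    "('g, 'e::real_normed_vector, 'm, 'f::real_normed_vector) groupoid
     \<Rightarrow> ('g \<Rightarrow> 'e \<Rightarrow>\<^sub>L 'e \<Rightarrow>\<^sub>L real) \<Rightarrow> bool" where
  "multiplicative_form G B \<longleftrightarrow>
     (\<forall>(g, h)\<in>composable G (points (arrows G)). \<forall>v w v' w'.
        ttgt G (h, w) = tsrc G (g, v) \<longrightarrow> ttgt G (h, w') = tsrc G (g, v') \<longrightarrow>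
        blinfun_apply (blinfun_apply (B (gmul G g h)) (snd (tmul G (g, v) (h, w))))
          (snd (tmul G (g, v') (h, w'))) =
        blinfun_apply (blinfun_apply (B g) v) v' + blinfun_apply (blinfun_apply (B h) w) w')"

text \<open>The type argument is the typical fibre of \<open>AG\<close>, which occurs in the charts of \<open>TM \<oplus> A*G\<close>.\<close>

definition multiplicative_dirac ::
    "'k::real_normed_vector itself
     \<Rightarrow> ('g, 'e::real_normed_vector, 'm, 'f::real_normed_vector) groupoid
     \<Rightarrow> ('g \<times> 'e gvec) set \<Rightarrow> bool" where
  "multiplicative_dirac _ G L \<longleftrightarrow>
     dirac_structure (arrows G) L \<and>
     lie_subgroupoid
       (courant_groupoid G ::
          ('g \<times> 'e gvec, 'e \<times> 'e gvec, 'm \<times> 'f \<times> ('e \<Rightarrow> real), 'f \<times> 'f \<times> ('k \<Rightarrow>\<^sub>L real)) groupoid) L"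

end

theory Submission
  imports Defs
begin

text \<open>
  The gauge transformation \<open>\<tau>\<^sub>B\<close> is an automorphism of the groupoid \<open>TG \<oplus> T*G\<close> covering the
  transformation \<open>(x, X, \<xi>) \<mapsto> (x, X, \<xi> + B(T1 X, \<cdot>))\<close> of \<open>TM \<oplus> A*G\<close>: multiplicativity of \<open>B\<close>,
  applied to \<open>v = v \<bullet> T1(Ts v)\<close> and \<open>Tl\<^sub>g b = 0\<^sub>g \<bullet> b\<close>, gives \<open>B(v, Tl\<^sub>g b) = B(T1(Ts v), b)\<close>, and
  similarly for the other structure maps. Both transformations preserve every chart domain and are
  smooth in every chart, so they carry the Lie subgroupoid \<open>L\<close> to a Lie subgroupoid. The
  identities in \<open>TG\<close> come from differentiating curves of composable arrows, which exist by
  lifting curves through the submersions \<open>s\<close> and \<open>t\<close>.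
\<close>

text \<open>Closedness serves the bracket: the bracket of two gauged sections and the gauged bracket
  differ by dB contracted with both fields. Multiplicativity serves the structure maps, and there
  two definitions shape the work. \<open>tmul\<close> is a derivative within the coordinate image of
  the composable pairs, hence determined only on vectors tangent to that set, and no charts of the
  set are constructed. So a pair with Tt w = Ts v must be realised by a composable curve before
  anything can be said about its product, and identities are obtained by comparing velocities rather
  than formulas for derivatives. \<open>comul\<close> is a definite description; it denotes the
  intended covector only if the sum of \<open>\<xi>\<close> and \<open>\<eta>\<close> vanishes on
  the kernel of the product. \<open>Tm_kernel\<close> describes that kernel by translated algebroid
  elements, on which equality of cotangent source and target is exactly the required
  cancellation.\<close>

section \<open>Bounded coordinates\<close>

text \<open>
  Coordinates with respect to a finite spanning list, bounded by assumption. Unlike orthonormal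
  bases they are available on the dual \<open>'e \<Rightarrow>\<^sub>L real\<close>, which is not an inner product space here.
\<close>

definition bounded_coords :: "'a::real_normed_vector itself \<Rightarrow> (('a \<Rightarrow> real) \<times> 'a) list \<Rightarrow> bool" where
  "bounded_coords _ l \<longleftrightarrow> (\<forall>(c, b)\<in>set l. bounded_linear c) \<and> (\<forall>x. x = (\<Sum>(c, b)\<leftarrow>l. c x *\<^sub>R b))"

definition fin_dim :: "'a::real_normed_vector itself \<Rightarrow> bool" where
  "fin_dim T \<longleftrightarrow> (\<exists>l. bounded_coords T l)"

lemma fin_dimE:
  assumes "fin_dim TYPE('a::real_normed_vector)"
  obtains l :: "(('a::real_normed_vector \<Rightarrow> real) \<times> 'a) list"
  where "\<And>c b. (c, b) \<in> set l \<Longrightarrow> bounded_linear c" "\<And>x. (\<Sum>(c, b)\<leftarrow>l. c x *\<^sub>R b) = x"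
  using assms unfolding fin_dim_def bounded_coords_def by (metis case_prodD)

lemma fin_dimI:
  fixes l :: "(('a::real_normed_vector \<Rightarrow> real) \<times> 'a) list"
  assumes "\<And>c b. (c, b) \<in> set l \<Longrightarrow> bounded_linear c" "\<And>x. (\<Sum>(c, b)\<leftarrow>l. c x *\<^sub>R b) = x"
  shows "fin_dim TYPE('a)"
  unfolding fin_dim_def bounded_coords_def by (rule exI[of _ l]) (use assms in auto)

lemma fin_dim_real_inner:
  assumes "finite_dimensional TYPE('a::real_inner)"
  shows "fin_dim TYPE('a)"
proof -
  obtain B :: "'a set" where B: "finite B" "span B = UNIV"
    using assms unfolding finite_dimensional_def by blast
  obtain C :: "'a set" where C: "finite C" "span C = UNIV" "pairwise orthogonal C"
    using basis_orthogonal[OF B(1)] B(2) by metis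
  \<comment> \<open>The orthogonal spanning set may contain 0; division by zero gives that vector
    the coordinate 0, so the expansion below still holds.\<close>
  define cf where "cf b x = (x \<bullet> b) / (b \<bullet> b)" for b x :: 'a
  have cf: "bounded_linear (cf b)" for b
    unfolding cf_def by (rule bounded_linear_compose[OF bounded_linear_divide bounded_linear_inner_left])
  have exp: "(\<Sum>b\<in>C. cf b x *\<^sub>R b) = x" for x
  proof -
    have "x \<in> span C" using C by simp
    then show ?thesis
    proof (induct rule: span_induct)
      case base
      show ?case
      proof (rule subspaceI)
        have lin: "linear (cf b)" for b by (rule bounded_linear.linear[OF cf])
        show "0 \<in> {x. (\<Sum>b\<in>C. cf b x *\<^sub>R b) = x}"
          by (simp add: linear_0[OF lin])
        show "x + y \<in> {x. (\<Sum>b\<in>C. cf b x *\<^sub>R b) = x}"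
          if "x \<in> {x. (\<Sum>b\<in>C. cf b x *\<^sub>R b) = x}" "y \<in> {x. (\<Sum>b\<in>C. cf b x *\<^sub>R b) = x}" for x y
          using that by (simp add: linear_add[OF lin] scaleR_add_left sum.distrib)
        have "(\<Sum>b\<in>C. cf b (r *\<^sub>R x) *\<^sub>R b) = r *\<^sub>R (\<Sum>b\<in>C. cf b x *\<^sub>R b)" for r x
          by (simp add: linear_scale[OF lin] scaleR_right.sum)
        then show "r *\<^sub>R x \<in> {x. (\<Sum>b\<in>C. cf b x *\<^sub>R b) = x}"
          if "x \<in> {x. (\<Sum>b\<in>C. cf b x *\<^sub>R b) = x}" for r x
          using that by simp
      qed
    next
      case (step x)
      have "cf b x *\<^sub>R b = (if b = x then x else 0)" if "b \<in> C" for b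
        using C(3) that step by (auto simp: cf_def pairwise_def orthogonal_def inner_commute)
      then have "(\<Sum>b\<in>C. cf b x *\<^sub>R b) = (\<Sum>b\<in>C. if b = x then x else 0)"
        by (intro sum.cong) auto
      then show ?case using C(1) step by simp
    qed
  qed
  obtain xs where xs: "set xs = C" "distinct xs"
    using finite_distinct_list[OF C(1)] by blast
  show ?thesis
  proof (rule fin_dimI[of "map (\<lambda>b. (cf b, b)) xs"])
    fix x
    show "(\<Sum>(c, b)\<leftarrow>map (\<lambda>b. (cf b, b)) xs. c x *\<^sub>R b) = x"
      using exp[of x] xs by (simp add: o_def sum_list_distinct_conv_sum_set)
  qed (use cf in auto)
qed

lemma fin_dim_prod:
  assumes "fin_dim TYPE('a::real_normed_vector)" "fin_dim TYPE('b::real_normed_vector)"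
  shows "fin_dim TYPE('a \<times> 'b)"
proof -
  obtain l :: "(('a \<Rightarrow> real) \<times> 'a) list" where l:
    "\<And>c b. (c, b) \<in> set l \<Longrightarrow> bounded_linear c" "\<And>x. (\<Sum>(c, b)\<leftarrow>l. c x *\<^sub>R b) = x"
    by (rule fin_dimE[OF assms(1)]) blast
  obtain m :: "(('b \<Rightarrow> real) \<times> 'b) list" where m:
    "\<And>c b. (c, b) \<in> set m \<Longrightarrow> bounded_linear c" "\<And>x. (\<Sum>(c, b)\<leftarrow>m. c x *\<^sub>R b) = x"
    by (rule fin_dimE[OF assms(2)]) blast
  have 1: "(\<Sum>(c, b)\<leftarrow>l. c x *\<^sub>R (b, 0::'b)) = ((\<Sum>(c, b)\<leftarrow>l. c x *\<^sub>R b), 0)" for x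
    by (induct l) (auto simp: zero_prod_def)
  have 2: "(\<Sum>(c, b)\<leftarrow>m. c x *\<^sub>R (0::'a, b)) = (0, (\<Sum>(c, b)\<leftarrow>m. c x *\<^sub>R b))" for x
    by (induct m) (auto simp: zero_prod_def)
  show ?thesis
  proof (rule fin_dimI[of "map (\<lambda>(c, b). (c \<circ> fst, (b, 0))) l @ map (\<lambda>(c, b). (c \<circ> snd, (0, b))) m"])
    fix x :: "'a \<times> 'b"
    show "(\<Sum>(c, b)\<leftarrow>map (\<lambda>(c, b). (c \<circ> fst, (b, 0))) l @ map (\<lambda>(c, b). (c \<circ> snd, (0, b))) m. c x *\<^sub>R b) = x"
      using 1[of "fst x"] 2[of "snd x"] l(2)[of "fst x"] m(2)[of "snd x"]
      by (simp add: o_def split_def)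
  next
    fix c :: "'a \<times> 'b \<Rightarrow> real" and b
    assume "(c, b) \<in> set (map (\<lambda>(c, b). (c \<circ> fst, (b, 0))) l @ map (\<lambda>(c, b). (c \<circ> snd, (0, b))) m)"
    then show "bounded_linear c"
      by (auto simp: o_def dest!: l(1) m(1) intro: bounded_linear_compose bounded_linear_fst bounded_linear_snd)
  qed
qed

lemma linear_sum_list_coords:
  assumes "linear f"
  shows "f (\<Sum>(c, b)\<leftarrow>l. c x *\<^sub>R b) = (\<Sum>(c, b)\<leftarrow>l. c x *\<^sub>R f b)"
  by (induct l) (auto simp: linear_0[OF assms] linear_add[OF assms] linear_scale[OF assms])

lemma bounded_linear_sum_list:
  assumes "\<And>c b. (c, b) \<in> set l \<Longrightarrow> bounded_linear c"
  shows "bounded_linear (\<lambda>x. \<Sum>(c, b)\<leftarrow>l. c x *\<^sub>R g b)"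
  using assms
proof (induct l)
  case (Cons p l)
  obtain c b where p: "p = (c, b)" by (cases p)
  have "bounded_linear (\<lambda>x. c x *\<^sub>R g b + (\<Sum>(c, b)\<leftarrow>l. c x *\<^sub>R g b))"
    by (intro bounded_linear_add bounded_linear_scaleR_left[THEN bounded_linear_compose] Cons)
      (use Cons(2)[of c b] Cons(2) p in \<open>auto\<close>)
  then show ?case by (simp add: p)
qed simp

text \<open>The covectors built later are checked to be linear; this supplies the boundedness
  without which \<open>Blinfun\<close> is unspecified.\<close>

lemma linear_bounded_fin_dim:
  fixes f :: "'a::real_normed_vector \<Rightarrow> 'b::real_normed_vector"
  assumes "fin_dim TYPE('a)" "linear f"
  shows "bounded_linear f"
proof -
  obtain l :: "(('a \<Rightarrow> real) \<times> 'a) list" where l: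
    "\<And>c b. (c, b) \<in> set l \<Longrightarrow> bounded_linear c" "\<And>x. (\<Sum>(c, b)\<leftarrow>l. c x *\<^sub>R b) = x"
    by (rule fin_dimE[OF assms(1)]) blast
  have "f x = (\<Sum>(c, b)\<leftarrow>l. c x *\<^sub>R f b)" for x
    using linear_sum_list_coords[OF assms(2), where x = x and l = l] by (simp only: l(2))
  then have "f = (\<lambda>x. \<Sum>(c, b)\<leftarrow>l. c x *\<^sub>R f b)" ..
  then show ?thesis using bounded_linear_sum_list[of l f] l(1) by (metis (no_types))
qed

text \<open>Coordinates and vectors trade places: applying \<open>\<alpha>\<close> to the expansion
  of a vector shows that \<open>\<alpha>\<close> is the combination of the functionals
  \<open>c\<close> with coefficients \<open>\<alpha> b\<close>.\<close>

lemma fin_dim_dual: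
  assumes "fin_dim TYPE('a::real_normed_vector)"
  shows "fin_dim TYPE('a \<Rightarrow>\<^sub>L real)"
proof -
  obtain l :: "(('a \<Rightarrow> real) \<times> 'a) list" where l:
    "\<And>c b. (c, b) \<in> set l \<Longrightarrow> bounded_linear c" "\<And>x. (\<Sum>(c, b)\<leftarrow>l. c x *\<^sub>R b) = x"
    by (rule fin_dimE[OF assms(1)]) blast
  show ?thesis
  proof (rule fin_dimI[of "map (\<lambda>(c, b). (\<lambda>\<alpha>. blinfun_apply \<alpha> b, Blinfun c)) l"])
    fix \<alpha> :: "'a \<Rightarrow>\<^sub>L real"
    have "blinfun_apply (\<Sum>(c, b)\<leftarrow>l'. blinfun_apply \<alpha> b *\<^sub>R Blinfun c) x
        = (\<Sum>(c, b)\<leftarrow>l'. c x *\<^sub>R blinfun_apply \<alpha> b)" if "set l' \<subseteq> set l" for l' x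
      using that by (induct l') (auto simp: blinfun.add_left blinfun.scaleR_left bounded_linear_Blinfun_apply l(1))
    then have "blinfun_apply (\<Sum>(c, b)\<leftarrow>l. blinfun_apply \<alpha> b *\<^sub>R Blinfun c) x
        = blinfun_apply \<alpha> (\<Sum>(c, b)\<leftarrow>l. c x *\<^sub>R b)" for x
      by (simp add: linear_sum_list_coords[OF bounded_linear.linear[OF blinfun.bounded_linear_right]])
    then show "(\<Sum>(c, b)\<leftarrow>map (\<lambda>(c, b). (\<lambda>\<alpha>. blinfun_apply \<alpha> b, Blinfun c)) l. c \<alpha> *\<^sub>R b) = \<alpha>"
      by (auto intro!: blinfun_eqI simp: o_def split_def l(2)[unfolded split_def])
  qed (auto intro: blinfun.bounded_linear_left)
qed

text \<open>Each coordinate of a Cauchy sequence is a Cauchy sequence of reals. Completeness is what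
  the contraction argument in \<open>lift_curve\<close> rests on.\<close>

lemma complete_fin_dim:
  assumes "fin_dim TYPE('a::real_normed_vector)"
  shows "complete (UNIV :: 'a set)"
proof -
  obtain l :: "(('a \<Rightarrow> real) \<times> 'a) list" where l:
    "\<And>c b. (c, b) \<in> set l \<Longrightarrow> bounded_linear c" "\<And>x. (\<Sum>(c, b)\<leftarrow>l. c x *\<^sub>R b) = x"
    by (rule fin_dimE[OF assms(1)]) blast
  have "\<exists>y. X \<longlonglongrightarrow> y" if X: "Cauchy X" for X :: "nat \<Rightarrow> 'a"
  proof -
    have "\<exists>y. (\<lambda>n. \<Sum>(c, b)\<leftarrow>l'. c (X n) *\<^sub>R b) \<longlonglongrightarrow> y" if "set l' \<subseteq> set l" for l'
      using that
    proof (induct l')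
      case (Cons p l')
      obtain c b where p: "p = (c, b)" by (cases p)
      have "Cauchy (\<lambda>n. c (X n))"
        using bounded_linear.Cauchy[OF l(1) X] Cons(2) p by auto
      then obtain z where "(\<lambda>n. c (X n)) \<longlonglongrightarrow> z"
        by (meson Cauchy_convergent convergent_def)
      moreover obtain y where "(\<lambda>n. \<Sum>(c, b)\<leftarrow>l'. c (X n) *\<^sub>R b) \<longlonglongrightarrow> y"
        using Cons by auto
      ultimately have "(\<lambda>n. c (X n) *\<^sub>R b + (\<Sum>(c, b)\<leftarrow>l'. c (X n) *\<^sub>R b)) \<longlonglongrightarrow> z *\<^sub>R b + y"
        by (intro tendsto_add tendsto_scaleR tendsto_const)
      then show ?case using p by auto
    qed auto
    from this[of l] show ?thesis by (simp add: l(2))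
  qed
  then show ?thesis by (auto simp: complete_def)
qed

section \<open>Calculus of smooth maps\<close>

lemma Ck_on_subset: "Ck_on k S f \<Longrightarrow> T \<subseteq> S \<Longrightarrow> Ck_on k T f"
  by (induct k arbitrary: f) (auto intro: continuous_on_subset)

lemma Ck_on_cong:
  assumes "open S" "\<And>x. x \<in> S \<Longrightarrow> f x = g x" "Ck_on k S f"
  shows "Ck_on k S g"
  using assms(2,3)
proof (induct k arbitrary: f g)
  case 0
  then show ?case by (auto cong: continuous_on_cong)
next
  case (Suc k)
  have "g differentiable (at x)" if "x \<in> S" for x
    using Suc(2,3) that assms(1) unfolding differentiable_def Ck_on.simps
    by (metis has_derivative_transform_within_open)
  moreover have "frechet_derivative f (at x) = frechet_derivative g (at x)" if "x \<in> S" for x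
    using Suc(2,3) that assms(1) by (auto intro: frechet_derivative_transform_within_open)
  ultimately show ?case using Suc(3)
    by simp (metis (no_types, lifting) Suc.hyps)
qed

lemma Ck_on_SucI:
  assumes "open S" "\<And>x. x \<in> S \<Longrightarrow> (f has_derivative f' x) (at x)" "\<And>v. Ck_on k S (\<lambda>x. f' x v)"
  shows "Ck_on (Suc k) S f"
proof -
  have "frechet_derivative f (at x) = f' x" if "x \<in> S" for x
    using frechet_derivative_at[OF assms(2)[OF that]] by simp
  then have "Ck_on k S (\<lambda>x. frechet_derivative f (at x) v)" for v
    by (intro Ck_on_cong[OF assms(1) _ assms(3)[of v]]) simp
  then show ?thesis using assms(2) by (auto simp: differentiable_def)
qed

lemma Ck_on_SucD:
  assumes "Ck_on (Suc k) S f"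
  shows "Ck_on k S f"
  using assms
proof (induct k arbitrary: f)
  case 0
  then show ?case
    by (auto intro!: continuous_at_imp_continuous_on differentiable_imp_continuous_within)
next
  case (Suc k)
  then show ?case by (metis Ck_on.simps(2))
qed

lemma Ck_on_has_derivative:
  "Ck_on (Suc k) S f \<Longrightarrow> x \<in> S \<Longrightarrow> (f has_derivative frechet_derivative f (at x)) (at x)"
  by (simp add: frechet_derivative_works)

lemma Ck_on_local:
  assumes "\<And>x. x \<in> S \<Longrightarrow> \<exists>T. open T \<and> x \<in> T \<and> Ck_on k T f"
  shows "Ck_on k S f"
  using assms
proof (induct k arbitrary: f)
  case 0
  show ?case unfolding Ck_on.simps
    by (intro continuous_at_imp_continuous_on ballI) (metis 0 Ck_on.simps(1) continuous_on_eq_continuous_at)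
next
  case (Suc k)
  show ?case
  proof (simp only: Ck_on.simps, intro conjI ballI allI)
    show "f differentiable at x" if "x \<in> S" for x
      using Suc(2)[OF that] by auto
    show "Ck_on k S (\<lambda>x. frechet_derivative f (at x) v)" for v
      by (rule Suc(1)) (use Suc(2) in fastforce)
  qed
qed

lemma Ck_on_const: "open S \<Longrightarrow> Ck_on k S (\<lambda>x. c)"
proof (induct k arbitrary: c)
  case (Suc k)
  show ?case by (rule Ck_on_SucI[where f' = "\<lambda>x v. 0"]) (use Suc in auto)
qed simp

lemma Ck_on_bounded_linear_compose:
  assumes "open S" "bounded_linear h" "Ck_on k S f"
  shows "Ck_on k S (\<lambda>x. h (f x))"
  using assms(3)
proof (induct k arbitrary: f)
  case 0
  then show ?case using bounded_linear.continuous_on[OF assms(2)] by simp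
next
  case (Suc k)
  show ?case
    by (rule Ck_on_SucI[OF assms(1), where f' = "\<lambda>x v. h (frechet_derivative f (at x) v)"])
      (use Suc Ck_on_has_derivative[OF Suc(2)] assms(2) in \<open>auto intro: bounded_linear.has_derivative\<close>)
qed

lemma Ck_on_add:
  assumes "open S" "Ck_on k S f" "Ck_on k S g"
  shows "Ck_on k S (\<lambda>x. f x + g x)"
  using assms(2,3)
proof (induct k arbitrary: f g)
  case 0
  then show ?case by (auto intro: continuous_intros)
next
  case (Suc k)
  show ?case
    by (rule Ck_on_SucI[OF assms(1), where f' = "\<lambda>x v. frechet_derivative f (at x) v + frechet_derivative g (at x) v"])
      (use Suc Ck_on_has_derivative[OF Suc(2)] Ck_on_has_derivative[OF Suc(3)] in \<open>auto intro!: has_derivative_add\<close>)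
qed

lemma Ck_on_bilinear:
  assumes "bounded_bilinear h" "open S" "Ck_on k S f" "Ck_on k S g"
  shows "Ck_on k S (\<lambda>x. h (f x) (g x))"
  using assms(3,4)
proof (induct k arbitrary: f g)
  case 0
  then show ?case using bounded_bilinear.continuous_on[OF assms(1)] by auto
next
  case (Suc k)
  show ?case
  proof (rule Ck_on_SucI[OF assms(2)])
    show "((\<lambda>x. h (f x) (g x)) has_derivative
      (\<lambda>v. h (f x) (frechet_derivative g (at x) v) + h (frechet_derivative f (at x) v) (g x))) (at x)"
      if "x \<in> S" for x
      by (rule bounded_bilinear.FDERIV[OF assms(1)]) (use Suc Ck_on_has_derivative that in blast)+
    show "Ck_on k S (\<lambda>x. h (f x) (frechet_derivative g (at x) v) + h (frechet_derivative f (at x) v) (g x))" for v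
      using Suc(2,3) by (intro Ck_on_add[OF assms(2)] Suc(1)) (auto dest: Ck_on_SucD simp del: Ck_on.simps, auto)
  qed
qed

text \<open>\<open>Ck_on\<close> controls derivatives one fixed direction at a time, but the chain
  rule evaluates the derivative of \<open>g\<close> at the moving vector \<open>f' x v\<close>.
  Expanding this vector in coordinates leaves products of real functions with derivatives of
  \<open>g\<close> in fixed directions, to which induction applies.\<close>

lemma Ck_on_compose:
  fixes f :: "'a::real_normed_vector \<Rightarrow> 'b::real_normed_vector"
  assumes "fin_dim TYPE('b)" "open S" "Ck_on k S f" "Ck_on k T g" "f ` S \<subseteq> T"
  shows "Ck_on k S (\<lambda>x. g (f x))"
  using assms(3,4)
proof (induct k arbitrary: g)
  case 0
  then show ?case using assms(5) by (auto intro: continuous_on_compose2)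
next
  case (Suc k)
  obtain l :: "(('b \<Rightarrow> real) \<times> 'b) list" where l:
    "\<And>c b. (c, b) \<in> set l \<Longrightarrow> bounded_linear c" "\<And>x. (\<Sum>(c, b)\<leftarrow>l. c x *\<^sub>R b) = x"
    by (rule fin_dimE[OF assms(1)]) blast
  define g' where "g' y = frechet_derivative g (at y)" for y
  define f' where "f' y = frechet_derivative f (at y)" for y
  have g': "(g has_derivative g' (f x)) (at (f x))" if "x \<in> S" for x
    unfolding g'_def by (rule Ck_on_has_derivative[OF Suc(3)]) (use assms(5) that in auto)
  have f': "(f has_derivative f' x) (at x)" if "x \<in> S" for x
    unfolding f'_def by (rule Ck_on_has_derivative[OF Suc(2)]) (use that in auto)
  have smooth: "Ck_on k S (\<lambda>x. \<Sum>(c, b)\<leftarrow>l'. c (f' x v) *\<^sub>R g' (f x) b)" if "set l' \<subseteq> set l" for l' v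
    using that
  proof (induct l')
    case Nil
    then show ?case by (simp add: Ck_on_const assms(2))
  next
    case (Cons p l')
    obtain c b where p: "p = (c, b)" by (cases p)
    have "Ck_on k S (\<lambda>x. c (f' x v))"
    proof (rule Ck_on_bounded_linear_compose[OF assms(2), where h = c and f = "\<lambda>x. f' x v"])
      show "bounded_linear c" using Cons(2) p by (intro l(1)[of c b]) auto
      show "Ck_on k S (\<lambda>x. f' x v)" using Suc(2) by (simp add: f'_def)
    qed
    moreover have "Ck_on k S (\<lambda>x. g' (f x) b)"
      by (rule Suc(1)[of "\<lambda>y. g' y b", OF Ck_on_SucD[OF Suc(2)]]) (use Suc(3) in \<open>simp add: g'_def\<close>)
    ultimately show ?case
      using Cons p by (simp add: Ck_on_add[OF assms(2)] Ck_on_bilinear[OF bounded_bilinear_scaleR assms(2)])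
  qed
  show ?case
  proof (rule Ck_on_SucI[OF assms(2)])
    show "((\<lambda>x. g (f x)) has_derivative (\<lambda>v. g' (f x) (f' x v))) (at x)" if "x \<in> S" for x
      by (rule has_derivative_compose[OF f' g']) (use that in auto)
    show "Ck_on k S (\<lambda>x. g' (f x) (f' x v))" for v
    proof (rule Ck_on_cong[OF assms(2) _ smooth[OF order_refl]])
      fix x assume "x \<in> S"
      have "linear (g' (f x))" using g'[OF \<open>x \<in> S\<close>] by (simp add: bounded_linear.linear has_derivative_bounded_linear)
      from linear_sum_list_coords[OF this, of "f' x v" l]
      show "(\<Sum>(c, b)\<leftarrow>l. c (f' x v) *\<^sub>R g' (f x) b) = g' (f x) (f' x v)" by (simp add: l(2))
    qed
  qed
qed

section \<open>Closure properties of smooth maps\<close>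

lemma smooth_on_subset: "smooth_on S f \<Longrightarrow> T \<subseteq> S \<Longrightarrow> smooth_on T f"
  by (auto simp: smooth_on_def intro: Ck_on_subset)

lemma smooth_on_cong:
  "open S \<Longrightarrow> (\<And>x. x \<in> S \<Longrightarrow> f x = g x) \<Longrightarrow> smooth_on S f \<Longrightarrow> smooth_on S g"
  by (auto simp: smooth_on_def intro: Ck_on_cong)

lemma smooth_on_local:
  "(\<And>x. x \<in> S \<Longrightarrow> \<exists>T. open T \<and> x \<in> T \<and> smooth_on T f) \<Longrightarrow> smooth_on S f"
  unfolding smooth_on_def by (intro allI Ck_on_local) meson

lemma smooth_on_const: "open S \<Longrightarrow> smooth_on S (\<lambda>x. c)"
  by (simp add: smooth_on_def Ck_on_const)

lemma smooth_on_bounded_linear_compose: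
  "open S \<Longrightarrow> bounded_linear h \<Longrightarrow> smooth_on S f \<Longrightarrow> smooth_on S (\<lambda>x. h (f x))"
  by (simp add: smooth_on_def Ck_on_bounded_linear_compose)

lemma smooth_on_add:
  "open S \<Longrightarrow> smooth_on S f \<Longrightarrow> smooth_on S g \<Longrightarrow> smooth_on S (\<lambda>x. f x + g x)"
  by (simp add: smooth_on_def Ck_on_add)

lemma smooth_on_bilinear:
  "bounded_bilinear h \<Longrightarrow> open S \<Longrightarrow> smooth_on S f \<Longrightarrow> smooth_on S g \<Longrightarrow> smooth_on S (\<lambda>x. h (f x) (g x))"
  by (simp add: smooth_on_def Ck_on_bilinear)

lemma smooth_on_compose:
  fixes f :: "'a::real_normed_vector \<Rightarrow> 'b::real_normed_vector"
  shows "fin_dim TYPE('b) \<Longrightarrow> open S \<Longrightarrow> smooth_on S f \<Longrightarrow> smooth_on T g \<Longrightarrow> f ` S \<subseteq> T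
    \<Longrightarrow> smooth_on S (\<lambda>x. g (f x))"
  unfolding smooth_on_def by (blast intro: Ck_on_compose)

lemma smooth_on_derivative:
  "smooth_on S f \<Longrightarrow> smooth_on S (\<lambda>x. frechet_derivative f (at x) v)"
  unfolding smooth_on_def by (metis Ck_on.simps(2))

lemma smooth_on_has_derivative:
  "smooth_on S f \<Longrightarrow> x \<in> S \<Longrightarrow> (f has_derivative frechet_derivative f (at x)) (at x)"
  unfolding smooth_on_def by (metis Ck_on_has_derivative)

lemma smooth_on_continuous_on: "smooth_on S f \<Longrightarrow> continuous_on S f"
  unfolding smooth_on_def by (metis Ck_on.simps(1))

lemma smooth_on_ident: "open S \<Longrightarrow> smooth_on S (\<lambda>x. x)"
proof -
  assume S: "open S"
  have "Ck_on k S (\<lambda>x. x)" for k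
  proof (cases k)
    case (Suc j)
    show ?thesis unfolding Suc by (rule Ck_on_SucI[OF S, where f' = "\<lambda>x v. v"]) (auto simp: Ck_on_const S)
  qed (simp add: continuous_on_id)
  then show ?thesis by (simp add: smooth_on_def)
qed

lemma smooth_on_bounded_linear: "open S \<Longrightarrow> bounded_linear h \<Longrightarrow> smooth_on S h"
  using smooth_on_bounded_linear_compose[OF _ _ smooth_on_ident] by blast

lemma smooth_on_Pair:
  assumes "open S" "smooth_on S f" "smooth_on S g"
  shows "smooth_on S (\<lambda>x. (f x, g x))"
proof -
  have "smooth_on S (\<lambda>x. (f x, 0) + (0, g x))"
    by (intro smooth_on_add smooth_on_bounded_linear_compose[of S "\<lambda>y. (y, 0)"]
        smooth_on_bounded_linear_compose[of S "\<lambda>y. (0, y)"] assms bounded_linear_Pair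
        bounded_linear_ident bounded_linear_zero)
  then show ?thesis by simp
qed

lemma smooth_on_fst: "open S \<Longrightarrow> smooth_on S f \<Longrightarrow> smooth_on S (\<lambda>x. fst (f x))"
  by (rule smooth_on_bounded_linear_compose[OF _ bounded_linear_fst])

lemma smooth_on_snd: "open S \<Longrightarrow> smooth_on S f \<Longrightarrow> smooth_on S (\<lambda>x. snd (f x))"
  by (rule smooth_on_bounded_linear_compose[OF _ bounded_linear_snd])

lemma smooth_on_sum_list:
  assumes "open S" "\<And>c b. (c, b) \<in> set l \<Longrightarrow> smooth_on S (\<lambda>x. F c b x)"
  shows "smooth_on S (\<lambda>x. \<Sum>(c, b)\<leftarrow>l. F c b x)"
  using assms(2)
  by (induct l) (auto intro!: smooth_on_add smooth_on_const assms(1))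

lemma smooth_on_scaleR:
  "open S \<Longrightarrow> smooth_on S f \<Longrightarrow> smooth_on S g \<Longrightarrow> smooth_on S (\<lambda>x. f x *\<^sub>R g x)"
  by (rule smooth_on_bilinear[OF bounded_bilinear_scaleR])

text \<open>As in the chain rule, expanding the moving argument \<open>u x\<close> in coordinates
  reduces everything to fixed arguments of \<open>A x\<close>.\<close>

lemma smooth_on_linear_apply:
  fixes u :: "'x::real_normed_vector \<Rightarrow> 'a::real_normed_vector"
    and A :: "'x \<Rightarrow> 'a \<Rightarrow> 'b::real_normed_vector"
  assumes "fin_dim TYPE('a)" "open S" "\<And>x. x \<in> S \<Longrightarrow> linear (A x)" "\<And>v. smooth_on S (\<lambda>x. A x v)" "smooth_on S u"
  shows "smooth_on S (\<lambda>x. A x (u x))"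
proof -
  obtain l :: "(('a \<Rightarrow> real) \<times> 'a) list" where l:
    "\<And>c b. (c, b) \<in> set l \<Longrightarrow> bounded_linear c" "\<And>x. (\<Sum>(c, b)\<leftarrow>l. c x *\<^sub>R b) = x"
    by (rule fin_dimE[OF assms(1)]) blast
  have "smooth_on S (\<lambda>x. \<Sum>(c, b)\<leftarrow>l. c (u x) *\<^sub>R A x b)"
    by (intro smooth_on_sum_list smooth_on_scaleR assms(2,4) smooth_on_bounded_linear_compose[OF assms(2) l(1) assms(5)])
  then show ?thesis
    by (rule smooth_on_cong[OF assms(2), rotated])
      (use linear_sum_list_coords[OF assms(3), of _ "u _" l] in \<open>simp add: l(2)\<close>)
qed

text \<open>\<open>A x\<close> is the combination of the constant functionals \<open>c\<close> with
  the smooth coefficients \<open>A x b\<close>; this passes from smoothness of all values to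
  smoothness as a map into the dual.\<close>

lemma smooth_on_Blinfun:
  fixes A :: "'x::real_normed_vector \<Rightarrow> 'a::real_normed_vector \<Rightarrow> real"
  assumes "fin_dim TYPE('a)" "open S" "\<And>x. x \<in> S \<Longrightarrow> linear (A x)" "\<And>v. smooth_on S (\<lambda>x. A x v)"
  shows "smooth_on S (\<lambda>x. Blinfun (A x))"
proof -
  obtain l :: "(('a \<Rightarrow> real) \<times> 'a) list" where l:
    "\<And>c b. (c, b) \<in> set l \<Longrightarrow> bounded_linear c" "\<And>x. (\<Sum>(c, b)\<leftarrow>l. c x *\<^sub>R b) = x"
    by (rule fin_dimE[OF assms(1)]) blast
  have "smooth_on S (\<lambda>x. \<Sum>(c, b)\<leftarrow>l. A x b *\<^sub>R Blinfun c)"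
    by (intro smooth_on_sum_list smooth_on_scaleR assms(2,4) smooth_on_const)
  then show ?thesis
  proof (rule smooth_on_cong[OF assms(2), rotated])
    fix x assume x: "x \<in> S"
    have bl: "bounded_linear (A x)" by (rule linear_bounded_fin_dim[OF assms(1) assms(3)[OF x]])
    have "blinfun_apply (\<Sum>(c, b)\<leftarrow>l'. A x b *\<^sub>R Blinfun c) v = (\<Sum>(c, b)\<leftarrow>l'. c v *\<^sub>R A x b)"
      if "set l' \<subseteq> set l" for l' v
      using that by (induct l') (auto simp: blinfun.add_left blinfun.scaleR_left bounded_linear_Blinfun_apply l(1))
    from this[of l] have "blinfun_apply (\<Sum>(c, b)\<leftarrow>l. A x b *\<^sub>R Blinfun c) v = A x v" for v
      using linear_sum_list_coords[OF assms(3)[OF x], of v l] by (simp add: l(2))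
    then show "(\<Sum>(c, b)\<leftarrow>l. A x b *\<^sub>R Blinfun c) = Blinfun (A x)"
      by (intro blinfun_eqI) (simp add: bounded_linear_Blinfun_apply bl)
  qed
qed

section \<open>Lifting curves through submersions\<close>

text \<open>An operator norm is bounded by finitely many values, so continuity of each directional
  derivative becomes continuity of the derivative in operator norm.\<close>

lemma norm_le_coords:
  fixes l :: "(('a::real_normed_vector \<Rightarrow> real) \<times> 'a) list" and L :: "'a \<Rightarrow> 'b::real_normed_vector"
  assumes "\<And>c b. (c, b) \<in> set l \<Longrightarrow> bounded_linear c" "\<And>x. (\<Sum>(c, b)\<leftarrow>l. c x *\<^sub>R b) = x" "linear L"
  shows "norm (L v) \<le> (\<Sum>(c, b)\<leftarrow>l. onorm c * norm (L b)) * norm v"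
proof -
  have "norm (\<Sum>(c, b)\<leftarrow>l'. c v *\<^sub>R L b) \<le> (\<Sum>(c, b)\<leftarrow>l'. onorm c * norm (L b)) * norm v"
    if "set l' \<subseteq> set l" for l'
    using that
  proof (induct l')
    case (Cons p l')
    obtain c b where p: "p = (c, b)" by (cases p)
    have "bounded_linear c" using Cons(2) p by (intro assms(1)[of c b]) auto
    from onorm[OF this, of v] have "norm (c v *\<^sub>R L b) \<le> onorm c * norm v * norm (L b)"
      by (simp add: mult_right_mono)
    moreover have "norm (\<Sum>(c, b)\<leftarrow>l'. c v *\<^sub>R L b) \<le> (\<Sum>(c, b)\<leftarrow>l'. onorm c * norm (L b)) * norm v"
      using Cons by simp
    ultimately show ?case
      using norm_triangle_ineq[of "c v *\<^sub>R L b" "\<Sum>(c, b)\<leftarrow>l'. c v *\<^sub>R L b"]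
      by (simp add: p algebra_simps)
  qed simp
  from this[of l] show ?thesis
    using linear_sum_list_coords[OF assms(3), where l = l and x = v] by (simp add: assms(2))
qed

text \<open>Subtracting the derivative at \<open>x0\<close> leaves a map whose derivative has norm
  at most \<open>\<epsilon>\<close> on a small ball; the mean value inequality on this convex set
  gives the Lipschitz bound.\<close>

lemma smooth_on_strict_derivative:
  fixes F :: "'a::real_normed_vector \<Rightarrow> 'b::real_normed_vector"
  assumes fd: "fin_dim TYPE('a)" and T: "open T" "x0 \<in> T" and F: "smooth_on T F" and "\<epsilon> > 0"
  shows "\<exists>\<delta>>0. ball x0 \<delta> \<subseteq> T \<and> (\<forall>x\<in>ball x0 \<delta>. \<forall>y\<in>ball x0 \<delta>.
    norm ((F x - frechet_derivative F (at x0) x) - (F y - frechet_derivative F (at x0) y)) \<le> \<epsilon> * norm (x - y))"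
proof -
  obtain l :: "(('a \<Rightarrow> real) \<times> 'a) list" where l:
    "\<And>c b. (c, b) \<in> set l \<Longrightarrow> bounded_linear c" "\<And>x. (\<Sum>(c, b)\<leftarrow>l. c x *\<^sub>R b) = x"
    by (rule fin_dimE[OF fd]) blast
  define D where "D x = frechet_derivative F (at x)" for x
  have D: "(F has_derivative D x) (at x)" if "x \<in> T" for x
    unfolding D_def by (rule smooth_on_has_derivative[OF F that])
  have blD: "bounded_linear (D x)" if "x \<in> T" for x
    using D[OF that] by (rule has_derivative_bounded_linear)
  have lin: "linear (\<lambda>v. D x v - D x0 v)" if "x \<in> T" for x
    by (intro bounded_linear.linear bounded_linear_sub blD that T)
  define m where "m l' x = (\<Sum>(c, b)\<leftarrow>l'. onorm c * norm (D x b - D x0 b))" for l' :: "(('a \<Rightarrow> real) \<times> 'a) list" and x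
  have "(m l' \<longlongrightarrow> 0) (nhds x0)" for l'
  proof (induct l')
    case (Cons p l')
    obtain c b where p: "p = (c, b)" by (cases p)
    have "continuous_on T (\<lambda>x. D x b)"
      unfolding D_def by (intro smooth_on_continuous_on smooth_on_derivative F)
    then have "((\<lambda>x. D x b) \<longlongrightarrow> D x0 b) (nhds x0)"
      using T by (simp add: continuous_on_eq_continuous_at continuous_at tendsto_nhds_iff)
    then have "((\<lambda>x. onorm c * norm (D x b - D x0 b) + m l' x) \<longlongrightarrow> onorm c * norm (D x0 b - D x0 b) + 0) (nhds x0)"
      by (intro tendsto_intros Cons)
    then show ?case by (simp add: m_def p)
  qed (simp add: m_def)
  from order_tendstoD(2)[OF this \<open>\<epsilon> > 0\<close>]
  have "\<forall>\<^sub>F x in nhds x0. m l x < \<epsilon>" .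
  moreover have "\<forall>\<^sub>F x in nhds x0. x \<in> T" using T by (rule eventually_nhds_in_open)
  ultimately have "\<forall>\<^sub>F x in nhds x0. m l x < \<epsilon> \<and> x \<in> T" by (rule eventually_conj)
  then obtain \<delta> where \<delta>: "\<delta> > 0" "\<And>x. dist x x0 < \<delta> \<Longrightarrow> m l x < \<epsilon> \<and> x \<in> T"
    unfolding eventually_nhds_metric by blast
  have "norm ((F x - D x0 x) - (F y - D x0 y)) \<le> \<epsilon> * norm (x - y)"
    if "x \<in> ball x0 \<delta>" "y \<in> ball x0 \<delta>" for x y
  proof (rule differentiable_bound[OF convex_ball _ _ that, where f' = "\<lambda>x v. D x v - D x0 v"])
    fix z assume "z \<in> ball x0 \<delta>"
    then have z: "m l z < \<epsilon>" "z \<in> T" using \<delta>(2)[of z] by (auto simp: dist_commute)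
    show "((\<lambda>x. F x - D x0 x) has_derivative (\<lambda>v. D z v - D x0 v)) (at z within ball x0 \<delta>)"
      by (intro has_derivative_diff has_derivative_at_withinI[OF D] z bounded_linear_imp_has_derivative blD T)
    show "onorm (\<lambda>v. D z v - D x0 v) \<le> \<epsilon>"
    proof (rule onorm_bound)
      show "0 \<le> \<epsilon>" using \<open>\<epsilon> > 0\<close> by simp
    next
      fix v
      have "norm (D z v - D x0 v) \<le> m l z * norm v"
        using norm_le_coords[OF l lin[OF z(2)]] by (simp add: m_def)
      also have "\<dots> \<le> \<epsilon> * norm v" using z(1) by (intro mult_right_mono) auto
      finally show "norm (D z v - D x0 v) \<le> \<epsilon> * norm v" .
    qed
  qed
  moreover have "ball x0 \<delta> \<subseteq> T" using \<delta>(2) by (auto simp: dist_commute)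
  ultimately show ?thesis using \<delta>(1) unfolding D_def by blast
qed

text \<open>
  Perturb the straight line \<open>x0 + t v\<close> by \<open>R \<rho>\<close> with \<open>R\<close> a right inverse of the derivative:
  the correction \<open>\<rho>\<close> is the fixed point of a contraction on a ball of radius \<open>o(t)\<close>.
\<close>

lemma lift_curve:
  fixes F :: "'a::real_normed_vector \<Rightarrow> 'b::real_normed_vector"
  assumes fd: "fin_dim TYPE('a)" "fin_dim TYPE('b)" and T: "open T" "x0 \<in> T" and F: "smooth_on T F"
    and A: "A = frechet_derivative F (at x0)" "surj A"
    and y: "(y has_vector_derivative A v) (at 0)" "y 0 = F x0"
  shows "\<exists>\<gamma>. \<gamma> 0 = x0 \<and> (\<gamma> has_vector_derivative v) (at 0) \<and> (\<forall>\<^sub>F t in nhds 0. F (\<gamma> t) = y t)"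
proof -
  have DF: "(F has_derivative A) (at x0)" unfolding A(1) by (rule smooth_on_has_derivative[OF F T(2)])
  then have blA: "bounded_linear A" by (rule has_derivative_bounded_linear)
  then have linA: "linear A" by (rule bounded_linear.linear)
  obtain R where R: "linear R" "A \<circ> R = id"
    using linear_surjective_right_inverse[OF linA A(2)] by blast
  have AR: "A (R \<rho>) = \<rho>" for \<rho> using R(2) by (metis comp_apply id_apply)
  have blR: "bounded_linear R" by (rule linear_bounded_fin_dim[OF fd(2) R(1)])
  obtain K where K: "K > 0" "\<And>\<rho>. norm (R \<rho>) \<le> norm \<rho> * K"
    using bounded_linear.pos_bounded[OF blR] by blast
  \<comment> \<open>The right inverse \<open>R\<close> stretches by at most \<open>K\<close>, so the
    tolerance 1/(2K) makes the map \<open>G\<close> below contract by the factor 1/2.\<close>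
  obtain \<delta> where \<delta>: "\<delta> > 0" "ball x0 \<delta> \<subseteq> T" "\<And>x z. x \<in> ball x0 \<delta> \<Longrightarrow> z \<in> ball x0 \<delta> \<Longrightarrow>
    norm ((F x - A x) - (F z - A z)) \<le> (1 / (2 * K)) * norm (x - z)"
    using smooth_on_strict_derivative[OF fd(1) T F, of "1 / (2 * K)"] K(1) unfolding A(1) by auto
  define e where "e t = y t - F (x0 + t *\<^sub>R v)" for t
  have e0: "e 0 = 0" by (simp add: e_def y)
  have line: "((\<lambda>t. x0 + t *\<^sub>R v) has_derivative (\<lambda>t. t *\<^sub>R v)) (at 0)"
    by (auto intro!: derivative_eq_intros)
  have "((\<lambda>t. F (x0 + t *\<^sub>R v)) has_derivative (\<lambda>t. A (t *\<^sub>R v))) (at 0)"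
    by (rule has_derivative_compose[OF line]) (use DF in simp)
  then have "(e has_derivative (\<lambda>t. t *\<^sub>R A v - A (t *\<^sub>R v))) (at 0)"
    unfolding e_def by (intro has_derivative_diff) (use y in \<open>auto simp: has_vector_derivative_def\<close>)
  then have de: "(e has_derivative (\<lambda>t. 0)) (at 0)"
    by (simp add: linear_scale[OF linA])
  have lim_line: "((\<lambda>t. norm (t *\<^sub>R v)) \<longlongrightarrow> 0) (nhds 0)"
    by (rule tendsto_eq_intros refl filterlim_ident | simp)+
  have "isCont e 0" using de by (rule has_derivative_continuous)
  then have "(e \<longlongrightarrow> 0) (nhds 0)" by (simp add: continuous_at tendsto_nhds_iff e0)
  then have "((\<lambda>t. 2 * norm (e t) * K) \<longlongrightarrow> 0) (nhds 0)"
    by (auto intro!: tendsto_eq_intros)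
  then have "\<forall>\<^sub>F t in nhds 0. 2 * norm (e t) * K < \<delta> / 2"
    using \<delta>(1) by (intro order_tendstoD(2)) auto
  moreover have "\<forall>\<^sub>F t in nhds 0. norm (t *\<^sub>R v) < \<delta> / 2"
    using \<delta>(1) lim_line by (intro order_tendstoD(2)) auto
  ultimately have sol: "\<forall>\<^sub>F t in nhds 0. \<exists>\<rho>. norm \<rho> \<le> 2 * norm (e t) \<and> F (x0 + t *\<^sub>R v + R \<rho>) = y t"
  proof eventually_elim
    case (elim t)
    \<comment> \<open>The radius is dictated by the contraction: \<open>G 0\<close> has norm
      \<open>norm (e t)\<close>, and half of the radius twice that size adds the same amount again,
      so \<open>G\<close> maps the ball to itself.\<close>
    define S where "S = cball (0::'b) (2 * norm (e t))"
    \<comment> \<open>A Newton step with the derivative frozen at \<open>x0\<close>: as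
      \<open>A\<close> undoes \<open>R\<close>, the linear part of \<open>F\<close> cancels, and the
      fixed points are the solutions sought.\<close>
    define G where "G \<rho> = \<rho> - (F (x0 + t *\<^sub>R v + R \<rho>) - y t)" for \<rho>
    have in_ball: "x0 + t *\<^sub>R v + R \<rho> \<in> ball x0 \<delta>" if "\<rho> \<in> S" for \<rho>
    proof -
      have "norm (R \<rho>) \<le> 2 * norm (e t) * K"
        using K(2)[of \<rho>] that K(1) by (auto simp: S_def intro: order_trans mult_right_mono)
      then have "norm (t *\<^sub>R v + R \<rho>) < \<delta>"
        using elim norm_triangle_ineq[of "t *\<^sub>R v" "R \<rho>"] by linarith
      then show ?thesis by (simp add: dist_norm norm_minus_commute add.assoc) (metis norm_minus_cancel minus_add_distrib add.inverse_inverse diff_conv_add_uminus add.commute)?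
    qed
    have G_diff: "dist (G \<rho>) (G \<sigma>) \<le> 1/2 * dist \<rho> \<sigma>" if "\<rho> \<in> S" "\<sigma> \<in> S" for \<rho> \<sigma>
    proof -
      let ?x = "x0 + t *\<^sub>R v + R \<rho>" and ?z = "x0 + t *\<^sub>R v + R \<sigma>"
      have eq: "G \<rho> - G \<sigma> = - ((F ?x - A ?x) - (F ?z - A ?z))"
        by (simp add: G_def linear_add[OF linA] AR)
      have "norm (G \<rho> - G \<sigma>) \<le> (1 / (2 * K)) * norm (?x - ?z)"
        unfolding eq norm_minus_cancel using in_ball that by (intro \<delta>(3)) auto
      also have "?x - ?z = R (\<rho> - \<sigma>)" by (simp add: linear_diff[OF R(1)])
      also have "(1 / (2 * K)) * norm (R (\<rho> - \<sigma>)) \<le> (1 / (2 * K)) * (norm (\<rho> - \<sigma>) * K)"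
        using K by (intro mult_left_mono) auto
      also have "\<dots> = 1/2 * norm (\<rho> - \<sigma>)" using K(1) by simp
      finally show ?thesis by (simp add: dist_norm)
    qed
    have zero: "0 \<in> S" by (simp add: S_def)
    have G0: "G 0 = e t" by (simp add: G_def e_def linear_0[OF R(1)])
    have "G ` S \<subseteq> S"
    proof clarify
      fix \<rho> assume \<rho>: "\<rho> \<in> S"
      have "norm (G \<rho>) \<le> norm (G 0) + dist (G \<rho>) (G 0)"
        by (metis add.commute dist_norm norm_triangle_sub)
      also have "\<dots> \<le> norm (e t) + 1/2 * (2 * norm (e t))"
        using G_diff[OF \<rho> zero] \<rho> by (simp add: G0 S_def)
      finally show "G \<rho> \<in> S" by (simp add: S_def)
    qed
    moreover have "complete S"
    proof -
      have "complete (UNIV \<inter> S)"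
        by (rule complete_Int_closed[OF complete_fin_dim[OF fd(2)]]) (simp add: S_def)
      then show ?thesis by simp
    qed
    ultimately have "\<exists>!\<rho>\<in>S. G \<rho> = \<rho>"
      using zero G_diff by (intro Banach_fix[where c = "1/2"]) auto
    then obtain \<rho> where "\<rho> \<in> S" "G \<rho> = \<rho>" by blast
    then show ?case by (intro exI[of _ \<rho>]) (auto simp: S_def G_def)
  qed
  define P where "P t \<rho> \<longleftrightarrow> norm \<rho> \<le> 2 * norm (e t) \<and> F (x0 + t *\<^sub>R v + R \<rho>) = y t" for t \<rho>
  \<comment> \<open>The solution is chosen separately for each \<open>t\<close>. Its bound by twice
    \<open>norm (e t)\<close>, which is o(t), already gives derivative 0 at time 0.\<close>
  define r where "r t = (SOME \<rho>. P t \<rho>)" for t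
  have r: "\<forall>\<^sub>F t in nhds 0. P t (r t)"
    using sol unfolding r_def P_def[symmetric] by eventually_elim (rule someI_ex)
  have r0: "r 0 = 0" using eventually_nhds_x_imp_x[OF r] by (simp add: P_def e0)
  have "(r has_derivative (\<lambda>t. 0)) (at 0)"
    unfolding has_derivative_iff_norm
  proof (intro conjI bounded_linear_zero)
    have "((\<lambda>t. norm (e t) / norm t) \<longlongrightarrow> 0) (at 0)"
      using de by (simp add: has_derivative_iff_norm e0)
    then have lim: "((\<lambda>t. 2 * (norm (e t) / norm t)) \<longlongrightarrow> 0) (at 0)"
      by (rule tendsto_mult_right_zero)
    show "((\<lambda>t. norm (r t - r 0 - 0) / norm (t - 0)) \<longlongrightarrow> 0) (at 0)"
    proof (rule tendsto_sandwich[OF _ _ tendsto_const lim])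
      show "\<forall>\<^sub>F t in at 0. norm (r t - r 0 - 0) / norm (t - 0) \<le> 2 * (norm (e t) / norm t)"
        using eventually_nhds_conv_at[THEN iffD1, OF r, THEN conjunct1]
        by eventually_elim (auto simp: P_def r0 divide_right_mono)
    qed simp
  qed
  from bounded_linear.has_derivative[OF blR this]
  have "((\<lambda>t. R (r t)) has_derivative (\<lambda>t. 0)) (at 0)" by (simp add: linear_0[OF R(1)])
  from has_derivative_add[OF line this]
  have "((\<lambda>t. x0 + t *\<^sub>R v + R (r t)) has_vector_derivative v) (at 0)"
    by (simp add: has_vector_derivative_def)
  moreover have "\<forall>\<^sub>F t in nhds 0. F (x0 + t *\<^sub>R v + R (r t)) = y t"
    using r by eventually_elim (simp add: P_def)
  ultimately show ?thesis
    by (intro exI[of _ "\<lambda>t. x0 + t *\<^sub>R v + R (r t)"]) (simp add: r0 linear_0[OF R(1)])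
qed

section \<open>Curves on manifolds and tangent maps\<close>

text \<open>The fragment of \<open>is_manifold\<close> that is verified for the bundles as well:
  their charts are only shown to be injective with open image, and the preferred ones to contain
  their points.\<close>

definition charted :: "('a, 'e::real_normed_vector) manifold \<Rightarrow> bool" where
  "charted M \<longleftrightarrow> (\<forall>c\<in>atlas M. is_chart c) \<and>
     (\<forall>p\<in>points M. chart_at M p \<in> atlas M \<and> p \<in> fst (chart_at M p))"

lemma is_manifold_charted: "is_manifold M \<Longrightarrow> charted M"
  by (auto simp: is_manifold_def charted_def)

lemma chartedD:
  assumes "charted M" "p \<in> points M"
  shows "chart_at M p \<in> atlas M" "p \<in> fst (chart_at M p)"
  using assms by (auto simp: charted_def)

lemma is_chart_atlas: "charted M \<Longrightarrow> c \<in> atlas M \<Longrightarrow> is_chart c"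
  by (simp add: charted_def)

lemma atlas_points: "c \<in> atlas M \<Longrightarrow> p \<in> fst c \<Longrightarrow> p \<in> points M"
  by (auto simp: points_def)

lemma cinv_chart: "is_chart c \<Longrightarrow> p \<in> fst c \<Longrightarrow> cinv c (snd c p) = p"
  by (simp add: cinv_def is_chart_def)

lemma cinv_in: "x \<in> snd c ` fst c \<Longrightarrow> cinv c x \<in> fst c"
  by (simp add: cinv_def inv_into_into)

lemma chart_cinv: "x \<in> snd c ` fst c \<Longrightarrow> snd c (cinv c x) = x"
  by (simp add: cinv_def f_inv_into_f)

lemma open_chart: "is_chart c \<Longrightarrow> open (snd c ` fst c)"
  by (simp add: is_chart_def)

lemma chart_image_Int:
  assumes "is_chart c" "A \<subseteq> fst c" "B \<subseteq> fst c"
  shows "snd c ` (A \<inter> B) = snd c ` A \<inter> snd c ` B"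
  using assms by (auto simp: is_chart_def dest: inj_onD)

text \<open>Injectivity of charts lets images commute with intersections, which is what makes the
  defining collection a topology.\<close>

lemma openin_mtop:
  assumes "charted M"
  shows "openin (mtop M) U \<longleftrightarrow> U \<subseteq> points M \<and> (\<forall>c\<in>atlas M. open (snd c ` (U \<inter> fst c)))"
proof -
  let ?P = "\<lambda>U. U \<subseteq> points M \<and> (\<forall>c\<in>atlas M. open (snd c ` (U \<inter> fst c)))"
  have "istopology ?P"
    unfolding istopology_def
  proof (intro conjI allI impI)
    fix S T assume S: "?P S" and T: "?P T"
    show "S \<inter> T \<subseteq> points M" using S by blast
    show "\<forall>c\<in>atlas M. open (snd c ` (S \<inter> T \<inter> fst c))"
    proof
      fix c assume c: "c \<in> atlas M"
      have "snd c ` (S \<inter> T \<inter> fst c) = snd c ` (S \<inter> fst c) \<inter> snd c ` (T \<inter> fst c)"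
        using chart_image_Int[OF is_chart_atlas[OF assms c], of "S \<inter> fst c" "T \<inter> fst c"]
        by (simp add: Int_ac)
      then show "open (snd c ` (S \<inter> T \<inter> fst c))" using S T c by auto
    qed
  next
    fix \<K> assume K: "\<forall>K\<in>\<K>. ?P K"
    show "\<Union>\<K> \<subseteq> points M" using K by blast
    show "\<forall>c\<in>atlas M. open (snd c ` (\<Union>\<K> \<inter> fst c))"
    proof
      fix c assume c: "c \<in> atlas M"
      have "snd c ` (\<Union>\<K> \<inter> fst c) = (\<Union>K\<in>\<K>. snd c ` (K \<inter> fst c))" by blast
      then show "open (snd c ` (\<Union>\<K> \<inter> fst c))" using K c by auto
    qed
  qed
  then show ?thesis by (simp add: mtop_def topology_inverse')
qed

lemma smooth_openD:
  assumes M: "charted M" and f: "smooth_open M U N f"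
    and c: "c \<in> atlas M" "p \<in> fst c" "p \<in> U" and d: "d \<in> atlas N" "f p \<in> fst d"
  obtains T where "open T" "snd c p \<in> T" "T \<subseteq> snd c ` fst c" "smooth_on T (snd d \<circ> f \<circ> cinv c)"
    "\<And>x. x \<in> T \<Longrightarrow> cinv c x \<in> U \<and> f (cinv c x) \<in> fst d"
proof
  let ?V = "U \<inter> fst c \<inter> f -` fst d"
  show "open (snd c ` ?V)" "smooth_on (snd c ` ?V) (snd d \<circ> f \<circ> cinv c)"
    using f c(1) d(1) by (auto simp: smooth_open_def Let_def)
  show "snd c p \<in> snd c ` ?V" using c d by auto
  show "snd c ` ?V \<subseteq> snd c ` fst c" by auto
  show "cinv c x \<in> U \<and> f (cinv c x) \<in> fst d" if "x \<in> snd c ` ?V" for x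
    using that cinv_chart[OF is_chart_atlas[OF M c(1)]] by auto
qed

lemma smooth_map_onD:
  assumes M: "charted M" and f: "smooth_map_on M S N f"
    and c: "c \<in> atlas M" "p \<in> fst c" "p \<in> S" and d: "d \<in> atlas N" "f p \<in> fst d"
  obtains T F where "open T" "snd c p \<in> T" "T \<subseteq> snd c ` fst c" "smooth_on T F"
    "\<And>q. q \<in> S \<Longrightarrow> q \<in> fst c \<Longrightarrow> snd c q \<in> T \<Longrightarrow> f q \<in> fst d \<and> snd d (f q) = F (snd c q)"
proof -
  obtain U f' where U: "openin (mtop M) U" "p \<in> U" "smooth_open M U N f'" "\<And>q. q \<in> S \<inter> U \<Longrightarrow> f' q = f q"
    using f c(3) unfolding smooth_map_on_def by blast
  have d': "f' p \<in> fst d" using U(2,4) c d by auto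
  obtain T where T: "open T" "snd c p \<in> T" "T \<subseteq> snd c ` fst c" "smooth_on T (snd d \<circ> f' \<circ> cinv c)"
    "\<And>x. x \<in> T \<Longrightarrow> cinv c x \<in> U \<and> f' (cinv c x) \<in> fst d"
    by (rule smooth_openD[OF M U(3) c(1,2) U(2) d(1) d']) blast
  show thesis
  proof (rule that[OF T(1,2,3,4)])
    fix q assume q: "q \<in> S" "q \<in> fst c" "snd c q \<in> T"
    then have "cinv c (snd c q) = q" using cinv_chart[OF is_chart_atlas[OF M c(1)]] by simp
    then show "f q \<in> fst d \<and> snd d (f q) = (snd d \<circ> f' \<circ> cinv c) (snd c q)"
      using T(5)[OF q(3)] U(4)[of q] q by simp
  qed
qed

lemma smooth_map_on_image: "smooth_map_on M S N f \<Longrightarrow> p \<in> S \<Longrightarrow> f p \<in> points N"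
  by (auto simp: smooth_map_on_def)

lemma tmap_on_eq:
  "tmap_on M S N f (p, v) = (f p, frechet_derivative (snd (chart_at N (f p)) \<circ> f \<circ> cinv (chart_at M p))
     (at (snd (chart_at M p) p) within snd (chart_at M p) ` (S \<inter> fst (chart_at M p))) v)"
  by (simp add: tmap_on_def Let_def)

text \<open>Smoothness at one point by a local extension in preferred charts. In this form it passes
  to slices of a product by freezing a coordinate, as the translations in \<open>tleft\<close> and
  \<open>tright\<close> require.\<close>

definition smooth_rep_at ::
    "('a, 'e::real_normed_vector) manifold \<Rightarrow> 'a set \<Rightarrow> ('b, 'f::real_normed_vector) manifold
     \<Rightarrow> ('a \<Rightarrow> 'b) \<Rightarrow> 'a \<Rightarrow> bool" where
  "smooth_rep_at M S N f p \<longleftrightarrow> f p \<in> points N \<and>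
     (\<exists>T F. open T \<and> snd (chart_at M p) p \<in> T \<and> T \<subseteq> snd (chart_at M p) ` fst (chart_at M p) \<and> smooth_on T F \<and>
       (\<forall>q. q \<in> S \<longrightarrow> q \<in> fst (chart_at M p) \<longrightarrow> snd (chart_at M p) q \<in> T \<longrightarrow>
         f q \<in> fst (chart_at N (f p)) \<and> snd (chart_at N (f p)) (f q) = F (snd (chart_at M p) q)))"

lemma smooth_map_on_rep_at:
  assumes M: "charted M" and N: "charted N" and f: "smooth_map_on M S N f" and p: "p \<in> S" "p \<in> points M"
  shows "smooth_rep_at M S N f p"
proof -
  have fp: "f p \<in> points N" by (rule smooth_map_on_image[OF f p(1)])
  show ?thesis
    unfolding smooth_rep_at_def
    by (rule conjI[OF fp], rule smooth_map_onD[OF M f chartedD[OF M p(2)] p(1) chartedD[OF N fp]]) blast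
qed

text \<open>The extension \<open>F\<close> only witnesses differentiability. The derivative chosen
  by \<open>tmap_on\<close> may differ from that of \<open>F\<close> on vectors not tangent to
  \<open>S\<close>, so the conclusion speaks of the chosen one.\<close>

lemma tmap_on_has_derivative:
  assumes M: "charted M" and f: "smooth_rep_at M S N f p" and p: "p \<in> S" "p \<in> points M"
  shows "((snd (chart_at N (f p)) \<circ> f \<circ> cinv (chart_at M p)) has_derivative (\<lambda>v. snd (tmap_on M S N f (p, v))))
     (at (snd (chart_at M p) p) within snd (chart_at M p) ` (S \<inter> fst (chart_at M p)))"
proof -
  let ?c = "chart_at M p" and ?d = "chart_at N (f p)"
  obtain T F where T: "open T" "snd ?c p \<in> T" "T \<subseteq> snd ?c ` fst ?c" "smooth_on T F"
    "\<And>q. q \<in> S \<Longrightarrow> q \<in> fst ?c \<Longrightarrow> snd ?c q \<in> T \<Longrightarrow> f q \<in> fst ?d \<and> snd ?d (f q) = F (snd ?c q)"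
    using f unfolding smooth_rep_at_def by (elim conjE exE) blast
  have ch: "is_chart ?c" using M p(2) by (simp add: charted_def)
  have F: "(F has_derivative frechet_derivative F (at (snd ?c p)))
      (at (snd ?c p) within snd ?c ` (S \<inter> fst ?c))"
    by (rule has_derivative_at_withinI[OF smooth_on_has_derivative[OF T(4,2)]])
  have "((snd ?d \<circ> f \<circ> cinv ?c) has_derivative frechet_derivative F (at (snd ?c p)))
      (at (snd ?c p) within snd ?c ` (S \<inter> fst ?c))"
  proof (rule has_derivative_transform_eventually[OF F])
    have "\<forall>\<^sub>F x in at (snd ?c p) within snd ?c ` (S \<inter> fst ?c). x \<in> T"
      using eventually_nhds_in_open[OF T(1,2)] by (auto simp: eventually_at_filter elim: eventually_mono)
    moreover have "\<forall>\<^sub>F x in at (snd ?c p) within snd ?c ` (S \<inter> fst ?c). x \<in> snd ?c ` (S \<inter> fst ?c)"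
      by (simp add: eventually_at_filter)
    ultimately show "\<forall>\<^sub>F x in at (snd ?c p) within snd ?c ` (S \<inter> fst ?c). F x = (snd ?d \<circ> f \<circ> cinv ?c) x"
      by eventually_elim (use T(5) in \<open>auto simp: cinv_chart[OF ch]\<close>)
    show "snd ?c p \<in> snd ?c ` (S \<inter> fst ?c)" using p chartedD[OF M p(2)] by blast
    show "F (snd ?c p) = (snd ?d \<circ> f \<circ> cinv ?c) (snd ?c p)"
      using T(5)[OF p(1) chartedD(2)[OF M p(2)] T(2)] chartedD(2)[OF M p(2)] by (simp add: cinv_chart[OF ch])
  qed
  then have "(snd ?d \<circ> f \<circ> cinv ?c) differentiable (at (snd ?c p) within snd ?c ` (S \<inter> fst ?c))"
    by (auto simp: differentiable_def)
  then show ?thesis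
    by (simp add: tmap_on_eq frechet_derivative_works)
qed

text \<open>Differentiability is asked at time 0 only, which is all that the lifted curves offer.
  The preferred chart is the one in which \<open>v\<close> stands for a tangent vector.\<close>

definition has_tangent :: "('a, 'e::real_normed_vector) manifold \<Rightarrow> (real \<Rightarrow> 'a) \<Rightarrow> 'a \<Rightarrow> 'e \<Rightarrow> bool" where
  "has_tangent M \<gamma> p v \<longleftrightarrow> p \<in> points M \<and> \<gamma> 0 = p \<and> (\<forall>\<^sub>F t in nhds 0. \<gamma> t \<in> fst (chart_at M p)) \<and>
     ((\<lambda>t. snd (chart_at M p) (\<gamma> t)) has_vector_derivative v) (at 0)"

lemma has_vector_derivative_cong_nhds:
  assumes "(f has_vector_derivative v) (at a)" "\<forall>\<^sub>F t in nhds a. f t = g t"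
  shows "(g has_vector_derivative v) (at a)"
  using assms unfolding has_vector_derivative_def eventually_nhds_conv_at
  by (auto intro: has_derivative_transform_eventually)

lemma has_tangent_unique: "has_tangent M \<gamma> p v \<Longrightarrow> has_tangent M \<gamma> p w \<Longrightarrow> v = w"
  by (auto simp: has_tangent_def intro: vector_derivative_unique_at)

lemma has_tangent_points:
  assumes "charted M" "has_tangent M \<gamma> p v"
  shows "\<forall>\<^sub>F t in nhds 0. \<gamma> t \<in> points M"
proof -
  have "chart_at M p \<in> atlas M" using assms by (auto simp: has_tangent_def charted_def)
  then show ?thesis using assms(2) unfolding has_tangent_def
    by (auto elim!: eventually_mono intro: atlas_points)
qed

lemma has_tangent_cong:
  assumes "has_tangent M \<gamma> p v" "\<forall>\<^sub>F t in nhds 0. \<gamma> t = \<delta> t"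
  shows "has_tangent M \<delta> p v"
proof -
  have "\<gamma> 0 = \<delta> 0" using eventually_nhds_x_imp_x[OF assms(2)] .
  moreover have "\<forall>\<^sub>F t in nhds 0. \<delta> t \<in> fst (chart_at M p)"
    using assms(2) assms(1)[unfolded has_tangent_def, THEN conjunct2, THEN conjunct2, THEN conjunct1]
    by eventually_elim simp
  moreover have "\<forall>\<^sub>F t in nhds 0. snd (chart_at M p) (\<gamma> t) = snd (chart_at M p) (\<delta> t)"
    using assms(2) by eventually_elim simp
  then have "((\<lambda>t. snd (chart_at M p) (\<delta> t)) has_vector_derivative v) (at 0)"
    using assms(1) unfolding has_tangent_def by (blast intro: has_vector_derivative_cong_nhds)
  ultimately show ?thesis using assms(1) by (auto simp: has_tangent_def)
qed

text \<open>\<open>f\<close> is differentiated only within \<open>A\<close>. The times at which the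
  curve lies in \<open>A\<close> form a neighbourhood of 0, so restricting to them leaves the
  derivative of the curve unchanged.\<close>

lemma vector_derivative_compose_within:
  fixes x :: "real \<Rightarrow> 'a::real_normed_vector" and f :: "'a \<Rightarrow> 'b::real_normed_vector"
  assumes "(x has_vector_derivative v) (at 0)" "\<forall>\<^sub>F t in nhds 0. x t \<in> A" "(f has_derivative D) (at (x 0) within A)"
  shows "((\<lambda>t. f (x t)) has_vector_derivative D v) (at 0)"
proof -
  define s where "s = {t. x t \<in> A}"
  have "0 \<in> interior s"
    using assms(2) by (auto simp: eventually_nhds s_def interior_def)
  then have s: "at 0 within s = at 0" by (rule at_within_interior)
  have x: "(x has_derivative (\<lambda>t. t *\<^sub>R v)) (at 0 within s)"
    using assms(1) by (simp add: has_vector_derivative_def s)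
  have f: "(f has_derivative D) (at (x 0) within x ` s)"
    by (rule has_derivative_subset[OF assms(3)]) (auto simp: s_def)
  have "linear D" using assms(3) by (simp add: bounded_linear.linear has_derivative_bounded_linear)
  then show ?thesis
    using has_derivative_in_compose[OF x f] by (simp add: has_vector_derivative_def s linear_scale)
qed

text \<open>A curve inside \<open>S\<close> only sees the derivative within the image of
  \<open>S\<close>. This gives \<open>tmap_on\<close> a determined value on velocities of such
  curves, whichever derivative was chosen.\<close>

lemma has_tangent_map_rep:
  assumes M: "charted M" and f: "smooth_rep_at M S N f p"
    and \<gamma>: "has_tangent M \<gamma> p v" and S: "\<forall>\<^sub>F t in nhds 0. \<gamma> t \<in> S"
  shows "has_tangent N (\<lambda>t. f (\<gamma> t)) (f p) (snd (tmap_on M S N f (p, v)))"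
proof -
  let ?c = "chart_at M p" and ?d = "chart_at N (f p)"
  have p: "p \<in> points M" "\<gamma> 0 = p" using \<gamma> by (auto simp: has_tangent_def)
  have pS: "p \<in> S" using eventually_nhds_x_imp_x[OF S] p by simp
  have fp: "f p \<in> points N" using f by (simp add: smooth_rep_at_def)
  have ch: "is_chart ?c" using M p(1) by (simp add: charted_def)
  obtain T F where T: "open T" "snd ?c p \<in> T" "T \<subseteq> snd ?c ` fst ?c" "smooth_on T F"
    "\<And>q. q \<in> S \<Longrightarrow> q \<in> fst ?c \<Longrightarrow> snd ?c q \<in> T \<Longrightarrow> f q \<in> fst ?d \<and> snd ?d (f q) = F (snd ?c q)"
    using f unfolding smooth_rep_at_def by (elim conjE exE) blast
  have \<gamma>c: "\<forall>\<^sub>F t in nhds 0. \<gamma> t \<in> fst ?c"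
    and \<gamma>d: "((\<lambda>t. snd ?c (\<gamma> t)) has_vector_derivative v) (at 0)" using \<gamma> by (auto simp: has_tangent_def)
  have "isCont (\<lambda>t. snd ?c (\<gamma> t)) 0" using \<gamma>d by (rule has_vector_derivative_continuous)
  then have "((\<lambda>t. snd ?c (\<gamma> t)) \<longlongrightarrow> snd ?c p) (nhds 0)"
    by (simp add: continuous_at tendsto_nhds_iff p)
  then have T': "\<forall>\<^sub>F t in nhds 0. snd ?c (\<gamma> t) \<in> T" using T(1,2) by (rule topological_tendstoD)
  have "\<forall>\<^sub>F t in nhds 0. f (\<gamma> t) \<in> fst ?d"
    using S \<gamma>c T' by eventually_elim (use T(5) in blast)
  moreover have der: "((\<lambda>t. (snd ?d \<circ> f \<circ> cinv ?c) (snd ?c (\<gamma> t))) has_vector_derivative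
      snd (tmap_on M S N f (p, v))) (at 0)"
  proof (rule vector_derivative_compose_within[OF \<gamma>d])
    show "\<forall>\<^sub>F t in nhds 0. snd ?c (\<gamma> t) \<in> snd ?c ` (S \<inter> fst ?c)"
      using S \<gamma>c by eventually_elim auto
    show "((snd ?d \<circ> f \<circ> cinv ?c) has_derivative (\<lambda>v. snd (tmap_on M S N f (p, v))))
      (at (snd ?c (\<gamma> 0)) within snd ?c ` (S \<inter> fst ?c))"
      using tmap_on_has_derivative[OF M f pS p(1)] p(2) by simp
  qed
  moreover have "\<forall>\<^sub>F t in nhds 0. (snd ?d \<circ> f \<circ> cinv ?c) (snd ?c (\<gamma> t)) = snd ?d (f (\<gamma> t))"
    using \<gamma>c by eventually_elim (simp add: cinv_chart[OF ch])
  from has_vector_derivative_cong_nhds[OF der this]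
  have "((\<lambda>t. snd ?d (f (\<gamma> t))) has_vector_derivative snd (tmap_on M S N f (p, v))) (at 0)" .
  ultimately show ?thesis using fp p by (simp add: has_tangent_def)
qed

lemma has_tangent_map:
  assumes M: "charted M" and N: "charted N" and f: "smooth_map_on M S N f"
    and \<gamma>: "has_tangent M \<gamma> p v" and S: "\<forall>\<^sub>F t in nhds 0. \<gamma> t \<in> S"
  shows "has_tangent N (\<lambda>t. f (\<gamma> t)) (f p) (snd (tmap_on M S N f (p, v)))"
proof -
  have "p \<in> points M" "p \<in> S"
    using \<gamma> eventually_nhds_x_imp_x[OF S] by (auto simp: has_tangent_def)
  from has_tangent_map_rep[OF M smooth_map_on_rep_at[OF M N f this(2,1)] \<gamma> S] show ?thesis .
qed

lemma has_tangent_exists: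
  assumes M: "charted M" and p: "p \<in> points M"
  shows "\<exists>\<gamma>. has_tangent M \<gamma> p v"
proof -
  let ?c = "chart_at M p"
  have ch: "is_chart ?c" using M p by (simp add: charted_def)
  define x where "x t = snd ?c p + t *\<^sub>R v" for t
  have x: "(x has_vector_derivative v) (at 0)"
    unfolding x_def by (auto intro!: derivative_eq_intros simp: has_vector_derivative_def)
  have "isCont x 0" using x by (rule has_vector_derivative_continuous)
  then have "(x \<longlongrightarrow> snd ?c p) (nhds 0)"
    by (simp add: continuous_at tendsto_nhds_iff x_def)
  then have ev: "\<forall>\<^sub>F t in nhds 0. x t \<in> snd ?c ` fst ?c"
    by (rule topological_tendstoD) (use open_chart[OF ch] chartedD[OF M p] in auto)
  have "((\<lambda>t. snd ?c (cinv ?c (x t))) has_vector_derivative v) (at 0)"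
    by (rule has_vector_derivative_cong_nhds[OF x]) (use ev in \<open>eventually_elim, simp add: chart_cinv\<close>)
  moreover have "cinv ?c (x 0) = p" using cinv_chart[OF ch chartedD(2)[OF M p]] by (simp add: x_def)
  moreover have "\<forall>\<^sub>F t in nhds 0. cinv ?c (x t) \<in> fst ?c"
    using ev by eventually_elim (rule cinv_in)
  ultimately have "has_tangent M (\<lambda>t. cinv ?c (x t)) p v" using p by (simp add: has_tangent_def)
  then show ?thesis by blast
qed

lemma has_tangent_const:
  assumes "charted M" "p \<in> points M"
  shows "has_tangent M (\<lambda>t. p) p 0"
  using assms by (auto simp: has_tangent_def charted_def has_vector_derivative_def)

section \<open>Product manifolds\<close>

lemma atlas_prod:
  "atlas (prod_manifold M N) =
     {(fst c \<times> fst d, map_prod (snd c) (snd d)) | c d. c \<in> atlas M \<and> d \<in> atlas N}"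
  by (simp add: prod_manifold_def)

lemma atlas_prodI:
  "c \<in> atlas M \<Longrightarrow> d \<in> atlas N \<Longrightarrow>
    (fst c \<times> fst d, map_prod (snd c) (snd d)) \<in> atlas (prod_manifold M N)"
  unfolding atlas_prod by blast

lemma atlas_prodE:
  assumes "e \<in> atlas (prod_manifold M N)"
  obtains c d where "c \<in> atlas M" "d \<in> atlas N" "e = (fst c \<times> fst d, map_prod (snd c) (snd d))"
  using assms unfolding atlas_prod by blast

lemma points_prod: "points (prod_manifold M N) = points M \<times> points N"
proof (intro set_eqI iffI)
  fix x
  assume "x \<in> points (prod_manifold M N)"
  then obtain e where e: "e \<in> atlas (prod_manifold M N)" "x \<in> fst e" unfolding points_def by blast
  from e(1) show "x \<in> points M \<times> points N"
    by (rule atlas_prodE) (use e(2) in \<open>auto intro: atlas_points\<close>)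
next
  fix x
  assume "x \<in> points M \<times> points N"
  then obtain c d where "c \<in> atlas M" "d \<in> atlas N" "x \<in> fst c \<times> fst d" unfolding points_def by blast
  then show "x \<in> points (prod_manifold M N)"
    using atlas_points[OF atlas_prodI] by (metis fst_conv)
qed

lemma chart_at_prod:
  "chart_at (prod_manifold M N) (p, q) = (fst (chart_at M p) \<times> fst (chart_at N q),
     map_prod (snd (chart_at M p)) (snd (chart_at N q)))"
  by (simp add: prod_manifold_def)

lemma charted_prod:
  assumes "charted M" "charted N"
  shows "charted (prod_manifold M N)"
proof -
  have "is_chart (fst c \<times> fst d, map_prod (snd c) (snd d))" if "is_chart c" "is_chart d"
    for c :: "('a, 'b) chart" and d :: "('c, 'd) chart"
    using that unfolding is_chart_def by (auto simp: map_prod_surj_on intro: map_prod_inj_on open_Times)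
  moreover have "(fst (chart_at M p) \<times> fst (chart_at N q),
     map_prod (snd (chart_at M p)) (snd (chart_at N q))) \<in> atlas (prod_manifold M N)"
    if "p \<in> points M" "q \<in> points N" for p q
    using chartedD(1)[OF assms(1) that(1)] chartedD(1)[OF assms(2) that(2)] by (rule atlas_prodI)
  ultimately show ?thesis
    using assms unfolding charted_def points_prod
    by (auto simp: chart_at_prod) (auto simp: prod_manifold_def charted_def)
qed

lemma has_tangent_prod:
  fixes M :: "('a, 'b::real_normed_vector) manifold" and N :: "('c, 'd::real_normed_vector) manifold"
  shows "has_tangent (prod_manifold M N) (\<lambda>t. (\<gamma> t, \<delta> t)) (p, q) (v, w) \<longleftrightarrow>
     has_tangent M \<gamma> p v \<and> has_tangent N \<delta> q w"
proof -
  have "((\<lambda>t. (x t, y t)) has_vector_derivative (v, w)) (at 0) \<longleftrightarrow>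
      (x has_vector_derivative v) (at 0) \<and> (y has_vector_derivative w) (at 0)"
    for x :: "real \<Rightarrow> 'b" and y :: "real \<Rightarrow> 'd"
    using has_derivative_Pair[where f = x and g = y and f' = "\<lambda>t. t *\<^sub>R v" and g' = "\<lambda>t. t *\<^sub>R w"]
      has_derivative_fst[where g = "\<lambda>t. (x t, y t)" and g' = "\<lambda>t. t *\<^sub>R (v, w)"]
      has_derivative_snd[where g = "\<lambda>t. (x t, y t)" and g' = "\<lambda>t. t *\<^sub>R (v, w)"]
    by (auto simp: has_vector_derivative_def)
  then show ?thesis
    by (auto simp: has_tangent_def points_prod chart_at_prod eventually_conj_iff)
qed

lemma subtangent_points:
  assumes "is_manifold M" "p \<in> points M"
  shows "subtangent M (points M) p = UNIV"
proof -
  have "slice_chart M (points M) p (chart_at M p) UNIV"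
    using assms by (auto simp: slice_chart_def is_manifold_def intro!: imageI intro: atlas_points)
  then show ?thesis unfolding subtangent_def by (metis (mono_tags, lifting) UNIV_I UNIV_eq_I mem_Collect_eq)
qed

text \<open>In charts this is \<open>lift_curve\<close>: \<open>points M\<close> fills the open
  chart image, so the derivative within it is the ordinary one, and the submersion property makes it
  onto.\<close>

lemma has_tangent_lift:
  fixes M :: "('a, 'e::real_inner) manifold" and N :: "('b, 'f::real_inner) manifold"
  assumes M: "is_manifold M" and N: "is_manifold N" and f: "submersion_on M (points M) N (points N) f"
    and x: "has_tangent N x (f p) (snd (tmap M N f (p, v)))" and p: "p \<in> points M"
  shows "\<exists>\<gamma>. has_tangent M \<gamma> p v \<and> (\<forall>\<^sub>F t in nhds 0. f (\<gamma> t) = x t)"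
proof -
  let ?c = "chart_at M p" and ?d = "chart_at N (f p)"
  note chM = is_manifold_charted[OF M] and chN = is_manifold_charted[OF N]
  have ch: "is_chart ?c" "is_chart ?d" using chM chN p x by (auto simp: charted_def has_tangent_def)
  have fs: "smooth_map_on M (points M) N f" using f by (simp add: submersion_on_def)
  have fp: "f p \<in> points N" by (rule smooth_map_on_image[OF fs p])
  obtain T F where T: "open T" "snd ?c p \<in> T" "T \<subseteq> snd ?c ` fst ?c" "smooth_on T F"
    "\<And>q. q \<in> points M \<Longrightarrow> q \<in> fst ?c \<Longrightarrow> snd ?c q \<in> T \<Longrightarrow> f q \<in> fst ?d \<and> snd ?d (f q) = F (snd ?c q)"
    by (rule smooth_map_onD[OF chM fs chartedD[OF chM p] p chartedD[OF chN fp]]) blast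
  have pts: "points M \<inter> fst ?c = fst ?c" using chartedD(1)[OF chM p] by (auto intro: atlas_points)
  define A where "A = frechet_derivative F (at (snd ?c p))"
  have within: "at (snd ?c p) within snd ?c ` fst ?c = at (snd ?c p)"
    using open_chart[OF ch(1)] chartedD(2)[OF chM p] by (intro at_within_open) auto
  have Feq: "F z = (snd ?d \<circ> f \<circ> cinv ?c) z" if "z \<in> T" for z
    using T(3) T(5)[of "cinv ?c z"] that cinv_in[of z ?c] chart_cinv[of z ?c] pts by force
  have "((snd ?d \<circ> f \<circ> cinv ?c) has_derivative (\<lambda>v. snd (tmap M N f (p, v)))) (at (snd ?c p))"
    using tmap_on_has_derivative[OF chM smooth_map_on_rep_at[OF chM chN fs p p] p p] by (simp add: pts within)
  then have "(F has_derivative (\<lambda>v. snd (tmap M N f (p, v)))) (at (snd ?c p))"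
    by (rule has_derivative_transform_within_open[OF _ T(1,2)]) (simp add: Feq)
  then have A: "A v = snd (tmap M N f (p, v))" for v
    unfolding A_def by (metis frechet_derivative_at)
  have "surj A"
  unfolding surj_def
  proof (intro allI)
    fix w
    have "w \<in> subtangent N (points N) (f p)" by (simp add: subtangent_points[OF N fp])
    then obtain v where "tmap M N f (p, v) = (f p, w)"
      using f p unfolding submersion_on_def by blast
    then show "\<exists>v. w = A v" using A by (metis snd_conv)
  qed
  moreover have "((\<lambda>t. snd ?d (x t)) has_vector_derivative A v) (at 0)" "snd ?d (x 0) = F (snd ?c p)"
    using x T(5)[OF p chartedD(2)[OF chM p] T(2)] by (auto simp: has_tangent_def A)
  moreover have "fin_dim TYPE('e)" "fin_dim TYPE('f)"
    using M N by (auto simp: is_manifold_def intro: fin_dim_real_inner)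
  ultimately obtain y where y: "y 0 = snd ?c p" "(y has_vector_derivative v) (at 0)"
      "\<forall>\<^sub>F t in nhds 0. F (y t) = snd ?d (x t)"
    using lift_curve[OF _ _ T(1,2,4) A_def, of "\<lambda>t. snd ?d (x t)" v] by blast
  have "isCont y 0" using y(2) by (rule has_vector_derivative_continuous)
  then have "(y \<longlongrightarrow> snd ?c p) (nhds 0)" by (simp add: continuous_at tendsto_nhds_iff y(1))
  then have yT: "\<forall>\<^sub>F t in nhds 0. y t \<in> T" using T(1,2) by (rule topological_tendstoD)
  define \<gamma> where "\<gamma> t = cinv ?c (y t)" for t
  have \<gamma>c: "\<forall>\<^sub>F t in nhds 0. \<gamma> t \<in> fst ?c \<and> snd ?c (\<gamma> t) = y t"
    using yT by eventually_elim (use T(3) cinv_in[of _ ?c] chart_cinv[of _ ?c] in \<open>auto simp: \<gamma>_def\<close>)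
  have "\<gamma> 0 = p" using cinv_chart[OF ch(1) chartedD(2)[OF chM p]] by (simp add: \<gamma>_def y(1))
  moreover have "((\<lambda>t. snd ?c (\<gamma> t)) has_vector_derivative v) (at 0)"
    by (rule has_vector_derivative_cong_nhds[OF y(2)]) (use \<gamma>c in \<open>eventually_elim, simp\<close>)
  moreover have "\<forall>\<^sub>F t in nhds 0. \<gamma> t \<in> fst ?c" using \<gamma>c by eventually_elim simp
  ultimately have "has_tangent M \<gamma> p v" using p by (auto simp: has_tangent_def)
  moreover have "\<forall>\<^sub>F t in nhds 0. f (\<gamma> t) = x t"
  proof -
    have "\<forall>\<^sub>F t in nhds 0. x t \<in> fst ?d" using x by (simp add: has_tangent_def)
    then show ?thesis using \<gamma>c y(3) yT
    proof eventually_elim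
      case (elim t)
      have "f (\<gamma> t) \<in> fst ?d \<and> snd ?d (f (\<gamma> t)) = snd ?d (x t)"
        using elim T(5)[of "\<gamma> t"] pts by auto
      then show ?case using elim cinv_chart[OF ch(2)] by metis
    qed
  qed
  ultimately show ?thesis by blast
qed

section \<open>Transition maps and curves inside submanifolds\<close>

lemma compatible_has_derivative:
  assumes "compatible c d" "is_chart c" "p \<in> fst c" "p \<in> fst d"
  shows "((snd d \<circ> cinv c) has_derivative frechet_derivative (snd d \<circ> cinv c) (at (snd c p))) (at (snd c p))"
  using assms by (intro smooth_on_has_derivative[of "snd c ` (fst c \<inter> fst d)"]) (auto simp: compatible_def)

lemma compatible_sym: "compatible c d \<Longrightarrow> compatible d c"
  by (simp add: compatible_def Int_commute)

lemma has_tangent_chart: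
  assumes M: "charted M" and \<gamma>: "has_tangent M \<gamma> p v" and c: "compatible (chart_at M p) c" "p \<in> fst c"
  shows "((\<lambda>t. snd c (\<gamma> t)) has_vector_derivative dchart M c p v) (at 0)"
proof -
  let ?c = "chart_at M p"
  have p: "p \<in> points M" and \<gamma>0: "\<gamma> 0 = p" and ev: "\<forall>\<^sub>F t in nhds 0. \<gamma> t \<in> fst ?c"
    and d: "((\<lambda>t. snd ?c (\<gamma> t)) has_vector_derivative v) (at 0)" using \<gamma> by (auto simp: has_tangent_def)
  have ch: "is_chart ?c" using M p by (simp add: charted_def)
  have D: "((snd c \<circ> cinv ?c) has_derivative dchart M c p) (at (snd ?c (\<gamma> 0)))"
    unfolding dchart_def using compatible_has_derivative[OF c(1) ch chartedD(2)[OF M p] c(2)] by (simp add: \<gamma>0)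
  have "((\<lambda>t. (snd c \<circ> cinv ?c) (snd ?c (\<gamma> t))) has_vector_derivative dchart M c p v) (at 0)"
    by (rule vector_derivative_compose_within[OF d _ D]) simp
  then show ?thesis
    by (rule has_vector_derivative_cong_nhds) (use ev in \<open>eventually_elim, simp add: cinv_chart[OF ch]\<close>)
qed

lemma transition_inverse:
  assumes "compatible c d" "is_chart c" "is_chart d" "p \<in> fst c" "p \<in> fst d"
  shows "frechet_derivative (snd c \<circ> cinv d) (at (snd d p)) (frechet_derivative (snd d \<circ> cinv c) (at (snd c p)) v) = v"
proof -
  let ?f = "snd d \<circ> cinv c" and ?g = "snd c \<circ> cinv d"
  let ?V = "snd c ` (fst c \<inter> fst d)"
  have V: "open ?V" "snd c p \<in> ?V" using assms by (auto simp: compatible_def)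
  have fp: "?f (snd c p) = snd d p" using assms by (simp add: cinv_chart)
  have "(?f has_derivative frechet_derivative ?f (at (snd c p))) (at (snd c p))"
    by (rule compatible_has_derivative[OF assms(1,2,4,5)])
  moreover have "(?g has_derivative frechet_derivative ?g (at (snd d p))) (at (?f (snd c p)))"
    unfolding fp by (rule compatible_has_derivative[OF compatible_sym[OF assms(1)] assms(3,5,4)])
  ultimately have "((\<lambda>x. ?g (?f x)) has_derivative
      (\<lambda>v. frechet_derivative ?g (at (snd d p)) (frechet_derivative ?f (at (snd c p)) v))) (at (snd c p))"
    by (rule has_derivative_compose)
  then have "((\<lambda>x. x) has_derivative
      (\<lambda>v. frechet_derivative ?g (at (snd d p)) (frechet_derivative ?f (at (snd c p)) v))) (at (snd c p))"
    by (rule has_derivative_transform_within_open[OF _ V]) (use assms in \<open>auto simp: cinv_chart\<close>)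
  then have "(\<lambda>v. frechet_derivative ?g (at (snd d p)) (frechet_derivative ?f (at (snd c p)) v)) = (\<lambda>v. v)"
    using has_derivative_unique has_derivative_ident by blast
  then show ?thesis by metis
qed

text \<open>A straight line in a slice chart whose direction lies in \<open>W\<close> stays in
  \<open>W\<close>, hence its image stays in \<open>S\<close> for small times.\<close>

lemma subtangent_curve:
  assumes M: "charted M" and p: "p \<in> S" "S \<subseteq> points M" and v: "v \<in> subtangent M S p"
  shows "\<exists>\<gamma>. has_tangent M \<gamma> p v \<and> (\<forall>\<^sub>F t in nhds 0. \<gamma> t \<in> S)"
proof -
  let ?c = "chart_at M p"
  obtain c W where c: "slice_chart M S p c W" "dchart M c p v \<in> W" using v by (auto simp: subtangent_def)
  have pM: "p \<in> points M" using p by blast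
  have ch: "is_chart ?c" "is_chart c" "?c \<in> atlas M" "p \<in> fst ?c" "p \<in> fst c" "subspace W"
    and Weq: "snd c ` (fst c \<inter> S) = snd c ` fst c \<inter> W"
    using M pM c(1) by (auto simp: charted_def slice_chart_def)
  have comp: "compatible c ?c" using c(1) ch(3) by (simp add: slice_chart_def)
  define w where "w = dchart M c p v"
  define x where "x t = snd c p + t *\<^sub>R w" for t
  have x: "(x has_vector_derivative w) (at 0)" and x0: "x 0 = snd c p"
    unfolding x_def by (auto intro!: derivative_eq_intros simp: has_vector_derivative_def)
  have "isCont x 0" using x by (rule has_vector_derivative_continuous)
  then have lim: "(x \<longlongrightarrow> snd c p) (nhds 0)" by (simp add: continuous_at tendsto_nhds_iff x0)
  have V: "open (snd c ` (fst c \<inter> fst ?c))" "snd c p \<in> snd c ` (fst c \<inter> fst ?c)"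
    using comp ch by (auto simp: compatible_def)
  have ev: "\<forall>\<^sub>F t in nhds 0. x t \<in> snd c ` (fst c \<inter> fst ?c)" by (rule topological_tendstoD[OF lim V])
  have inW: "x t \<in> W" for t
  proof -
    have "snd c p \<in> W" using Weq p(1) ch(5) by blast
    then show ?thesis using c(2) ch(6) by (simp add: x_def w_def subspace_add subspace_scale)
  qed
  define \<gamma> where "\<gamma> t = cinv c (x t)" for t
  have \<gamma>0: "\<gamma> 0 = p" by (simp add: \<gamma>_def x0 cinv_chart[OF ch(2,5)])
  have evc: "\<forall>\<^sub>F t in nhds 0. \<gamma> t \<in> fst ?c"
    using ev by eventually_elim (use cinv_chart[OF ch(2)] in \<open>auto simp: \<gamma>_def\<close>)
  have "((\<lambda>t. (snd ?c \<circ> cinv c) (x t)) has_vector_derivative frechet_derivative (snd ?c \<circ> cinv c) (at (snd c p)) w) (at 0)"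
    by (rule vector_derivative_compose_within[OF x, where A = UNIV])
      (use compatible_has_derivative[OF comp ch(2,5,4)] in \<open>auto simp: x0 o_def\<close>)
  moreover have "frechet_derivative (snd ?c \<circ> cinv c) (at (snd c p)) w = v"
    unfolding w_def dchart_def by (rule transition_inverse[OF compatible_sym[OF comp] ch(1,2,4,5)])
  ultimately have "has_tangent M \<gamma> p v"
    using pM \<gamma>0 evc by (simp add: has_tangent_def \<gamma>_def)
  moreover have "\<forall>\<^sub>F t in nhds 0. \<gamma> t \<in> S"
    using ev
  proof eventually_elim
    case (elim t)
    then have "x t \<in> snd c ` (fst c \<inter> S)" using inW[of t] unfolding Weq by blast
    then show ?case using cinv_chart[OF ch(2)] by (auto simp: \<gamma>_def)
  qed
  ultimately show ?thesis by blast
qed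

section \<open>Transport along chartwise diffeomorphisms\<close>

text \<open>
  Only the expression of \<open>\<phi>\<close> in a single chart enters, so that the transport below does not need the
  charts of \<open>TG \<oplus> T*G\<close> or \<open>TM \<oplus> A*G\<close> to be compatible with one another.
\<close>

definition chartwise_diffeo ::
    "('a, 'e::real_normed_vector) manifold \<Rightarrow> ('a \<Rightarrow> 'a) \<Rightarrow> ('a \<Rightarrow> 'a) \<Rightarrow> bool" where
  "chartwise_diffeo M \<phi> \<psi> \<longleftrightarrow>
     (\<forall>p\<in>points M. chart_at M (\<phi> p) = chart_at M p) \<and>
     (\<forall>c\<in>atlas M. (\<forall>p\<in>fst c. \<phi> p \<in> fst c \<and> \<psi> p \<in> fst c \<and> \<psi> (\<phi> p) = p \<and> \<phi> (\<psi> p) = p) \<and>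
       (\<exists>R. smooth_on (snd c ` fst c) R \<and> (\<forall>p\<in>fst c. snd c (\<phi> p) = R (snd c p))) \<and>
       (\<exists>R. smooth_on (snd c ` fst c) R \<and> (\<forall>p\<in>fst c. snd c (\<psi> p) = R (snd c p))))"

lemma chartwise_diffeoD:
  assumes "chartwise_diffeo M \<phi> \<psi>" "c \<in> atlas M" "p \<in> fst c"
  shows "\<phi> p \<in> fst c" "\<psi> p \<in> fst c" "\<psi> (\<phi> p) = p" "\<phi> (\<psi> p) = p"
  using assms by (auto simp: chartwise_diffeo_def)

lemma chartwise_diffeo_points:
  assumes "chartwise_diffeo M \<phi> \<psi>" "p \<in> points M"
  shows "\<phi> p \<in> points M" "\<psi> p \<in> points M" "\<psi> (\<phi> p) = p" "\<phi> (\<psi> p) = p"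
proof -
  obtain c where c: "c \<in> atlas M" "p \<in> fst c" using assms(2) unfolding points_def by blast
  note D = chartwise_diffeoD[OF assms(1) c]
  show "\<phi> p \<in> points M" "\<psi> p \<in> points M" "\<psi> (\<phi> p) = p" "\<phi> (\<psi> p) = p"
    by (rule atlas_points[OF c(1) D(1)], rule atlas_points[OF c(1) D(2)], rule D(3), rule D(4))
qed

lemma chartwise_diffeo_chart_at:
  "chartwise_diffeo M \<phi> \<psi> \<Longrightarrow> p \<in> points M \<Longrightarrow> chart_at M (\<phi> p) = chart_at M p"
  by (simp add: chartwise_diffeo_def)

lemma chartwise_diffeo_sym:
  assumes "chartwise_diffeo M \<phi> \<psi>"
  shows "chartwise_diffeo M \<psi> \<phi>"
proof -
  have "chart_at M (\<psi> p) = chart_at M p" if "p \<in> points M" for p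
    using chartwise_diffeo_chart_at[OF assms chartwise_diffeo_points(2)[OF assms that]]
      chartwise_diffeo_points(4)[OF assms that] by simp
  then show ?thesis using assms unfolding chartwise_diffeo_def by blast
qed

lemma chartwise_diffeo_smooth:
  assumes "chartwise_diffeo M \<phi> \<psi>" "c \<in> atlas M"
  obtains R where "smooth_on (snd c ` fst c) R" "\<And>p. p \<in> fst c \<Longrightarrow> snd c (\<phi> p) = R (snd c p)"
proof -
  have "\<exists>R. smooth_on (snd c ` fst c) R \<and> (\<forall>p\<in>fst c. snd c (\<phi> p) = R (snd c p))"
    using assms unfolding chartwise_diffeo_def by (elim conjE ballE) auto
  then obtain R where "smooth_on (snd c ` fst c) R" "\<forall>p\<in>fst c. snd c (\<phi> p) = R (snd c p)" by (elim exE conjE)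
  then show thesis by (intro that[of R]) auto
qed

lemma chartwise_diffeo_inj:
  "chartwise_diffeo M \<phi> \<psi> \<Longrightarrow> p \<in> points M \<Longrightarrow> q \<in> points M \<Longrightarrow> \<phi> p = \<phi> q \<longleftrightarrow> p = q"
  by (metis chartwise_diffeo_points(3))

text \<open>In the chart, the image under \<open>\<phi>\<close> is the preimage of the coordinate
  image of \<open>V\<close> under the continuous representative of \<open>\<psi>\<close>.\<close>

lemma chartwise_diffeo_open_image:
  assumes M: "charted M" and D: "chartwise_diffeo M \<phi> \<psi>" and c: "c \<in> atlas M"
    and V: "V \<subseteq> fst c" "open (snd c ` V)"
  shows "open (snd c ` \<phi> ` V)"
proof -
  obtain Q where Q: "smooth_on (snd c ` fst c) Q" "\<And>p. p \<in> fst c \<Longrightarrow> snd c (\<psi> p) = Q (snd c p)"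
    by (rule chartwise_diffeo_smooth[OF chartwise_diffeo_sym[OF D] c]) blast
  have inj: "inj_on (snd c) (fst c)" and op: "open (snd c ` fst c)"
    using is_chart_atlas[OF M c] by (auto simp: is_chart_def)
  have "snd c ` \<phi> ` V = snd c ` fst c \<inter> Q -` (snd c ` V)"
  proof (intro set_eqI iffI)
    fix x assume "x \<in> snd c ` \<phi> ` V"
    then obtain p where p: "p \<in> V" "x = snd c (\<phi> p)" by blast
    then have "p \<in> fst c" using V by blast
    then have "Q x = snd c p" using p Q(2)[of "\<phi> p"] chartwise_diffeoD[OF D c] by simp
    then show "x \<in> snd c ` fst c \<inter> Q -` (snd c ` V)"
      using p \<open>p \<in> fst c\<close> chartwise_diffeoD[OF D c] by auto
  next
    fix x assume x: "x \<in> snd c ` fst c \<inter> Q -` (snd c ` V)"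
    then obtain q p where q: "q \<in> fst c" "x = snd c q" "p \<in> V" "Q x = snd c p" by blast
    then have "snd c (\<psi> q) = snd c p" using Q(2) by simp
    then have "\<psi> q = p" using inj q V chartwise_diffeoD[OF D c] by (auto dest: inj_onD)
    then have "q = \<phi> p" using chartwise_diffeoD[OF D c q(1)] by simp
    then show "x \<in> snd c ` \<phi> ` V" using q by blast
  qed
  then show ?thesis
    using continuous_open_preimage[OF smooth_on_continuous_on[OF Q(1)] op V(2)] by simp
qed

lemma chartwise_diffeo_image_Int:
  assumes "chartwise_diffeo M \<phi> \<psi>" "c \<in> atlas M" "U \<subseteq> points M"
  shows "\<phi> ` U \<inter> fst c = \<phi> ` (U \<inter> fst c)"
proof -
  have "p \<in> fst c" if "p \<in> U" "\<phi> p \<in> fst c" for p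
    using chartwise_diffeoD(2)[OF assms(1,2) that(2)] chartwise_diffeo_points(3)[OF assms(1)] that assms(3)
    by (metis subsetD)
  then show ?thesis using chartwise_diffeoD(1)[OF assms(1,2)] by blast
qed

lemma chartwise_diffeo_openin:
  assumes "charted M" "chartwise_diffeo M \<phi> \<psi>" "openin (mtop M) U"
  shows "openin (mtop M) (\<phi> ` U)"
proof -
  have U: "U \<subseteq> points M" "\<And>c. c \<in> atlas M \<Longrightarrow> open (snd c ` (U \<inter> fst c))"
    using assms(1,3) by (auto simp: openin_mtop)
  have "\<phi> ` U \<subseteq> points M" using U(1) chartwise_diffeo_points(1)[OF assms(2)] by blast
  moreover have "open (snd c ` (\<phi> ` U \<inter> fst c))" if "c \<in> atlas M" for c
    unfolding chartwise_diffeo_image_Int[OF assms(2) that U(1)]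
    by (rule chartwise_diffeo_open_image[OF assms(1,2) that]) (use U that in auto)
  ultimately show ?thesis using assms(1) by (simp add: openin_mtop)
qed

lemma smooth_open_transport:
  fixes M :: "('a, 'e::real_normed_vector) manifold" and N :: "('b, 'f::real_normed_vector) manifold"
  assumes fd: "fin_dim TYPE('e)" "fin_dim TYPE('f)" and M: "charted M" and N: "charted N"
    and \<phi>: "chartwise_diffeo M \<phi> \<psi>" and \<phi>': "chartwise_diffeo N \<phi>' \<psi>'"
    and U: "U \<subseteq> points M" and f: "smooth_open M U N f"
  shows "smooth_open M (\<phi> ` U) N (\<phi>' \<circ> f \<circ> \<psi>)"
  unfolding smooth_open_def Let_def
proof (intro conjI ballI)
  have fU: "f ` U \<subseteq> points N" using f by (simp add: smooth_open_def)
  have \<psi>\<phi>: "\<psi> (\<phi> p) = p" if "p \<in> U" for p using chartwise_diffeo_points(3)[OF \<phi>] U that by blast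
  show "(\<phi>' \<circ> f \<circ> \<psi>) ` \<phi> ` U \<subseteq> points N"
    using fU chartwise_diffeo_points(1)[OF \<phi>'] by (auto simp: \<psi>\<phi>)
  fix c d assume c: "c \<in> atlas M" and d: "d \<in> atlas N"
  let ?V = "U \<inter> fst c \<inter> f -` fst d"
  let ?V' = "\<phi> ` U \<inter> fst c \<inter> (\<phi>' \<circ> f \<circ> \<psi>) -` fst d"
  have V: "open (snd c ` ?V)" "smooth_on (snd c ` ?V) (snd d \<circ> f \<circ> cinv c)"
    using f c d by (auto simp: smooth_open_def Let_def)
  have "\<phi>' y \<in> fst d \<longleftrightarrow> y \<in> fst d" if "y \<in> points N" for y
    using chartwise_diffeoD[OF \<phi>' d] chartwise_diffeo_points(3)[OF \<phi>' that] by metis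
  \<comment> \<open>\<open>\<phi>'\<close> moves no point into or out of \<open>fst d\<close>, so
    conjugation does not alter the condition on the values of \<open>f\<close>.\<close>
  then have V': "?V' = \<phi> ` ?V"
    unfolding chartwise_diffeo_image_Int[OF \<phi> c U] using fU by (auto simp: \<psi>\<phi>)
  show op: "open (snd c ` ?V')"
    unfolding V' by (rule chartwise_diffeo_open_image[OF M \<phi> c _ V(1)]) auto
  obtain Q where Q: "smooth_on (snd c ` fst c) Q" "\<And>p. p \<in> fst c \<Longrightarrow> snd c (\<psi> p) = Q (snd c p)"
    by (rule chartwise_diffeo_smooth[OF chartwise_diffeo_sym[OF \<phi>] c]) blast
  obtain R where R: "smooth_on (snd d ` fst d) R" "\<And>p. p \<in> fst d \<Longrightarrow> snd d (\<phi>' p) = R (snd d p)"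
    by (rule chartwise_diffeo_smooth[OF \<phi>' d]) blast
  note inv = cinv_chart[OF is_chart_atlas[OF M c]]
  have Qeq: "Q (snd c (\<phi> p)) = snd c p" if "p \<in> fst c" for p
    using Q(2)[of "\<phi> p"] chartwise_diffeoD[OF \<phi> c that] by simp
  have "smooth_on (snd c ` ?V') (\<lambda>x. (snd d \<circ> f \<circ> cinv c) (Q x))"
    by (rule smooth_on_compose[OF fd(1) op smooth_on_subset[OF Q(1)] V(2)])
      (auto simp: V' Qeq chartwise_diffeoD[OF \<phi> c] \<psi>\<phi>)
  then have "smooth_on (snd c ` ?V') (\<lambda>x. R ((snd d \<circ> f \<circ> cinv c) (Q x)))"
    by (rule smooth_on_compose[OF fd(2) op _ R(1)]) (auto simp: V' Qeq inv)
  then show "smooth_on (snd c ` ?V') (snd d \<circ> (\<phi>' \<circ> f \<circ> \<psi>) \<circ> cinv c)"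
  proof (rule smooth_on_cong[OF op, rotated])
    fix x assume "x \<in> snd c ` ?V'"
    then obtain p where p: "p \<in> ?V" "x = snd c (\<phi> p)" unfolding V' by blast
    then have "\<phi> p \<in> fst c" using chartwise_diffeoD[OF \<phi> c] by auto
    then show "R ((snd d \<circ> f \<circ> cinv c) (Q x)) = (snd d \<circ> (\<phi>' \<circ> f \<circ> \<psi>) \<circ> cinv c) x"
      using p by (simp add: Qeq inv \<psi>\<phi> R(2))
  qed
qed

text \<open>By equivariance the conjugate of a local extension of \<open>f\<close> is again a local
  extension of \<open>f\<close>, now around the transported point.\<close>

lemma smooth_map_on_transport:
  fixes M :: "('a, 'e::real_normed_vector) manifold" and N :: "('b, 'f::real_normed_vector) manifold"
  assumes fd: "fin_dim TYPE('e)" "fin_dim TYPE('f)" and M: "charted M" and N: "charted N"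
    and \<phi>: "chartwise_diffeo M \<phi> \<psi>" and \<phi>': "chartwise_diffeo N \<phi>' \<psi>'"
    and f: "smooth_map_on M S N f" and S: "S \<subseteq> points M" and eq: "\<And>p. p \<in> S \<Longrightarrow> f (\<phi> p) = \<phi>' (f p)"
  shows "smooth_map_on M (\<phi> ` S) N f"
  unfolding smooth_map_on_def
proof (intro conjI ballI)
  show "f ` \<phi> ` S \<subseteq> points N"
    using smooth_map_on_image[OF f] chartwise_diffeo_points(1)[OF \<phi>'] by (auto simp: eq)
  fix q assume "q \<in> \<phi> ` S"
  then obtain p where p: "p \<in> S" "q = \<phi> p" by blast
  obtain U f' where U: "openin (mtop M) U" "p \<in> U" "smooth_open M U N f'" "\<forall>q\<in>S \<inter> U. f' q = f q"
    using f p(1) unfolding smooth_map_on_def by blast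
  have UM: "U \<subseteq> points M" using U(1) M by (simp add: openin_mtop)
  have "(\<phi>' \<circ> f' \<circ> \<psi>) r = f r" if r: "r \<in> \<phi> ` S \<inter> \<phi> ` U" for r
  proof -
    obtain s u where s: "s \<in> S" "u \<in> U" "r = \<phi> s" "r = \<phi> u" using r by blast
    have "s = u" using s UM S chartwise_diffeo_inj[OF \<phi>, of s u] by (metis subsetD)
    then have "s \<in> S \<inter> U" using s by simp
    then show ?thesis using U(4) s eq chartwise_diffeo_points(3)[OF \<phi>, of s] S by auto
  qed
  then show "\<exists>U f'. openin (mtop M) U \<and> q \<in> U \<and> smooth_open M U N f' \<and> (\<forall>q\<in>\<phi> ` S \<inter> U. f' q = f q)"
    using chartwise_diffeo_openin[OF M \<phi> U(1)] smooth_open_transport[OF fd M N \<phi> \<phi>' UM U(3)] p(2) U(2)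
    by (intro exI[of _ "\<phi> ` U"] exI[of _ "\<phi>' \<circ> f' \<circ> \<psi>"]) auto
qed

text \<open>The pushed chart gives \<open>\<phi> q\<close> the coordinates of \<open>q\<close>, so
  the slice is unchanged. Its transition maps with an atlas chart \<open>d\<close> are those of
  \<open>c\<close> combined with the representative of \<open>\<phi>\<close> or
  \<open>\<psi>\<close> in \<open>d\<close> alone.\<close>

lemma slice_chart_transport:
  fixes M :: "('a, 'e::real_normed_vector) manifold"
  assumes fd: "fin_dim TYPE('e)" and M: "charted M" and \<phi>: "chartwise_diffeo M \<phi> \<psi>"
    and c: "slice_chart M S p c W" and S: "S \<subseteq> points M"
  shows "slice_chart M (\<phi> ` S) (\<phi> p) (\<phi> ` fst c, snd c \<circ> \<psi>) W"
proof -
  have ch: "is_chart c" and cM: "fst c \<subseteq> points M" and comp: "\<And>d. d \<in> atlas M \<Longrightarrow> compatible c d"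
    and p: "p \<in> fst c" and W: "subspace W" and eq: "snd c ` (fst c \<inter> S) = snd c ` fst c \<inter> W"
    using c by (auto simp: slice_chart_def)
  let ?c = "(\<phi> ` fst c, snd c \<circ> \<psi>)"
  have \<psi>\<phi>: "\<psi> (\<phi> q) = q" if "q \<in> points M" for q using chartwise_diffeo_points(3)[OF \<phi> that] .
  have img: "snd ?c ` \<phi> ` A = snd c ` A" if "A \<subseteq> points M" for A
    using that by (force simp: \<psi>\<phi> subset_iff)
  have imgc: "snd ?c ` fst ?c = snd c ` fst c" using img[OF cM] by simp
  have "inj_on (snd ?c) (fst ?c)"
  proof (rule inj_onI)
    fix x y assume "x \<in> fst ?c" "y \<in> fst ?c" "snd ?c x = snd ?c y"
    then show "x = y" using ch cM by (auto simp: is_chart_def \<psi>\<phi> subset_iff dest: inj_onD)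
  qed
  then have ch': "is_chart ?c" using ch imgc by (simp add: is_chart_def)
  have cinv': "cinv ?c (snd c q) = \<phi> q" if "q \<in> fst c" for q
    using cinv_chart[OF ch', of "\<phi> q"] that cM \<psi>\<phi>[of q] by auto
  have "compatible ?c d" if d: "d \<in> atlas M" for d
  proof -
    let ?V = "fst c \<inter> fst d"
    have int: "fst ?c \<inter> fst d = \<phi> ` ?V" using chartwise_diffeo_image_Int[OF \<phi> d cM] by simp
    have VM: "?V \<subseteq> points M" using cM by blast
    have V: "open (snd c ` ?V)" "smooth_on (snd c ` ?V) (snd d \<circ> cinv c)"
      "open (snd d ` ?V)" "smooth_on (snd d ` ?V) (snd c \<circ> cinv d)"
      using comp[OF d] by (auto simp: compatible_def)
    have op: "open (snd d ` \<phi> ` ?V)" by (rule chartwise_diffeo_open_image[OF M \<phi> d _ V(3)]) auto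
    obtain Q where Q: "smooth_on (snd d ` fst d) Q" "\<And>p. p \<in> fst d \<Longrightarrow> snd d (\<psi> p) = Q (snd d p)"
      by (rule chartwise_diffeo_smooth[OF chartwise_diffeo_sym[OF \<phi>] d]) blast
    obtain R where R: "smooth_on (snd d ` fst d) R" "\<And>p. p \<in> fst d \<Longrightarrow> snd d (\<phi> p) = R (snd d p)"
      by (rule chartwise_diffeo_smooth[OF \<phi> d]) blast
    note invd = cinv_chart[OF is_chart_atlas[OF M d]] and invc = cinv_chart[OF ch]
    have Qeq: "Q (snd d (\<phi> q)) = snd d q" if "q \<in> fst d" for q
      using Q(2)[of "\<phi> q"] chartwise_diffeoD[OF \<phi> d that] by simp
    have "smooth_on (snd c ` ?V) (\<lambda>x. R ((snd d \<circ> cinv c) x))"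
      by (rule smooth_on_compose[OF fd V(1,2) R(1)]) (auto simp: invc)
    then have 1: "smooth_on (snd c ` ?V) (snd d \<circ> cinv ?c)"
      by (rule smooth_on_cong[OF V(1), rotated]) (auto simp: invc cinv' R(2))
    have "smooth_on (snd d ` \<phi> ` ?V) (\<lambda>x. (snd c \<circ> cinv d) (Q x))"
      by (rule smooth_on_compose[OF fd op smooth_on_subset[OF Q(1)] V(4)])
        (auto simp: Qeq chartwise_diffeoD[OF \<phi> d])
    then have 2: "smooth_on (snd d ` \<phi> ` ?V) (snd ?c \<circ> cinv d)"
      by (rule smooth_on_cong[OF op, rotated]) (use cM in \<open>auto simp: Qeq invd \<psi>\<phi> chartwise_diffeoD[OF \<phi> d] subset_iff\<close>)
    show ?thesis
      unfolding compatible_def int img[OF VM] using V(1) 1 op 2 by blast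
  qed
  moreover have "fst ?c \<subseteq> points M" using cM chartwise_diffeo_points(1)[OF \<phi>] by auto
  moreover have "snd ?c ` (fst ?c \<inter> \<phi> ` S) = snd ?c ` fst ?c \<inter> W"
  proof -
    have "fst ?c \<inter> \<phi> ` S = \<phi> ` (fst c \<inter> S)"
    proof -
      have "q = r" if "q \<in> fst c" "r \<in> S" "\<phi> q = \<phi> r" for q r
        using that cM S chartwise_diffeo_inj[OF \<phi>, of q r] by (metis subsetD)
      then show ?thesis by fastforce
    qed
    then show ?thesis unfolding imgc using img[of "fst c \<inter> S"] cM eq by auto
  qed
  ultimately show ?thesis using ch' p W by (simp add: slice_chart_def)
qed

lemma embedded_submanifold_transport:
  fixes M :: "('a, 'e::real_normed_vector) manifold"
  assumes fd: "fin_dim TYPE('e)" and M: "charted M" and \<phi>: "chartwise_diffeo M \<phi> \<psi>"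
    and S: "embedded_submanifold M S"
  shows "embedded_submanifold M (\<phi> ` S)"
proof -
  obtain k where SM: "S \<subseteq> points M" and k: "\<And>p. p \<in> S \<Longrightarrow> \<exists>c W. slice_chart M S p c W \<and> dim W = k"
    using S unfolding embedded_submanifold_def by blast
  have "\<exists>c W. slice_chart M (\<phi> ` S) q c W \<and> dim W = k" if "q \<in> \<phi> ` S" for q
    using that k slice_chart_transport[OF fd M \<phi> _ SM] by blast
  moreover have "\<phi> ` S \<subseteq> points M" using SM chartwise_diffeo_points(1)[OF \<phi>] by blast
  ultimately show ?thesis unfolding embedded_submanifold_def by blast
qed

text \<open>One chart serves on both sides because the maps it is used for keep the preferred chart;
  the value is then a tangent vector at \<open>\<phi> p\<close> in the convention of
  \<open>chart_at\<close>.\<close>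

definition tangent_of :: "('a, 'e::real_normed_vector) manifold \<Rightarrow> ('a \<Rightarrow> 'a) \<Rightarrow> 'a \<Rightarrow> 'e \<Rightarrow> 'e" where
  "tangent_of M \<phi> p = frechet_derivative (snd (chart_at M p) \<circ> \<phi> \<circ> cinv (chart_at M p)) (at (snd (chart_at M p) p))"

lemma has_tangent_transport:
  assumes M: "charted M" and \<phi>: "chartwise_diffeo M \<phi> \<psi>" and \<gamma>: "has_tangent M \<gamma> p v"
  shows "has_tangent M (\<lambda>t. \<phi> (\<gamma> t)) (\<phi> p) (tangent_of M \<phi> p v)"
proof -
  let ?c = "chart_at M p"
  have p: "p \<in> points M" and \<gamma>0: "\<gamma> 0 = p" and ev: "\<forall>\<^sub>F t in nhds 0. \<gamma> t \<in> fst ?c"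
    and d: "((\<lambda>t. snd ?c (\<gamma> t)) has_vector_derivative v) (at 0)" using \<gamma> by (auto simp: has_tangent_def)
  have c: "?c \<in> atlas M" "p \<in> fst ?c" using chartedD[OF M p] .
  have ch: "is_chart ?c" by (rule is_chart_atlas[OF M c(1)])
  obtain R where R: "smooth_on (snd ?c ` fst ?c) R" "\<And>p. p \<in> fst ?c \<Longrightarrow> snd ?c (\<phi> p) = R (snd ?c p)"
    by (rule chartwise_diffeo_smooth[OF \<phi> c(1)]) blast
  have "(R has_derivative frechet_derivative R (at (snd ?c p))) (at (snd ?c p))"
    by (rule smooth_on_has_derivative[OF R(1)]) (use c in auto)
  then have D: "((snd ?c \<circ> \<phi> \<circ> cinv ?c) has_derivative frechet_derivative R (at (snd ?c p))) (at (snd ?c p))"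
    by (rule has_derivative_transform_within_open[OF _ open_chart[OF ch]]) (use c in \<open>auto simp: R(2) cinv_chart[OF ch]\<close>)
  then have D: "((snd ?c \<circ> \<phi> \<circ> cinv ?c) has_derivative tangent_of M \<phi> p) (at (snd ?c (\<gamma> 0)))"
    using frechet_derivative_at[OF D] by (simp add: tangent_of_def \<gamma>0)
  have "((\<lambda>t. (snd ?c \<circ> \<phi> \<circ> cinv ?c) (snd ?c (\<gamma> t))) has_vector_derivative tangent_of M \<phi> p v) (at 0)"
    by (rule vector_derivative_compose_within[OF d _ D]) simp
  then have "((\<lambda>t. snd ?c (\<phi> (\<gamma> t))) has_vector_derivative tangent_of M \<phi> p v) (at 0)"
    by (rule has_vector_derivative_cong_nhds) (use ev in \<open>eventually_elim, simp add: cinv_chart[OF ch]\<close>)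
  moreover have "\<forall>\<^sub>F t in nhds 0. \<phi> (\<gamma> t) \<in> fst ?c"
    using ev by eventually_elim (rule chartwise_diffeoD(1)[OF \<phi> c(1)])
  ultimately show ?thesis
    using chartwise_diffeo_points(1)[OF \<phi> p] chartwise_diffeo_chart_at[OF \<phi> p] by (simp add: has_tangent_def \<gamma>0)
qed

lemma tangent_of_inverse:
  assumes M: "charted M" and \<phi>: "chartwise_diffeo M \<phi> \<psi>" and p: "p \<in> points M"
  shows "tangent_of M \<psi> (\<phi> p) (tangent_of M \<phi> p v) = v"
proof -
  obtain \<gamma> where \<gamma>: "has_tangent M \<gamma> p v" using has_tangent_exists[OF M p] by blast
  have "has_tangent M (\<lambda>t. \<psi> (\<phi> (\<gamma> t))) p (tangent_of M \<psi> (\<phi> p) (tangent_of M \<phi> p v))"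
    using has_tangent_transport[OF M chartwise_diffeo_sym[OF \<phi>] has_tangent_transport[OF M \<phi> \<gamma>]]
    by (simp add: chartwise_diffeo_points(3)[OF \<phi> p])
  moreover have "\<forall>\<^sub>F t in nhds 0. \<psi> (\<phi> (\<gamma> t)) = \<gamma> t"
    using has_tangent_points[OF M \<gamma>] by eventually_elim (rule chartwise_diffeo_points(3)[OF \<phi>])
  ultimately show ?thesis by (rule has_tangent_unique[OF has_tangent_cong \<gamma>])
qed

text \<open>The pushed curve has in the pushed chart the same coordinates as the original curve in
  \<open>c\<close>, so both velocities have the same coordinates and membership in \<open>W\<close>
  carries over.\<close>

lemma subtangent_transport:
  fixes M :: "('a, 'e::real_normed_vector) manifold"
  assumes fd: "fin_dim TYPE('e)" and M: "charted M" and \<phi>: "chartwise_diffeo M \<phi> \<psi>"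
    and v: "v \<in> subtangent M S p" and S: "S \<subseteq> points M" and p: "p \<in> points M"
  shows "tangent_of M \<phi> p v \<in> subtangent M (\<phi> ` S) (\<phi> p)"
proof -
  obtain c W where c: "slice_chart M S p c W" and w: "dchart M c p v \<in> W" using v by (auto simp: subtangent_def)
  let ?c = "(\<phi> ` fst c, snd c \<circ> \<psi>)"
  have c': "slice_chart M (\<phi> ` S) (\<phi> p) ?c W" by (rule slice_chart_transport[OF fd M \<phi> c S])
  obtain \<gamma> where \<gamma>: "has_tangent M \<gamma> p v" using has_tangent_exists[OF M p] by blast
  have "chart_at M p \<in> atlas M" "chart_at M (\<phi> p) \<in> atlas M"
    using chartedD(1)[OF M] p chartwise_diffeo_points(1)[OF \<phi> p] by auto
  then have comp: "compatible (chart_at M p) c" "p \<in> fst c" "compatible (chart_at M (\<phi> p)) ?c" "\<phi> p \<in> fst ?c"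
    using c c' compatible_sym unfolding slice_chart_def by metis+
  have 1: "((\<lambda>t. snd c (\<gamma> t)) has_vector_derivative dchart M c p v) (at 0)"
    by (rule has_tangent_chart[OF M \<gamma> comp(1,2)])
  have 2: "((\<lambda>t. snd ?c (\<phi> (\<gamma> t))) has_vector_derivative dchart M ?c (\<phi> p) (tangent_of M \<phi> p v)) (at 0)"
    by (rule has_tangent_chart[OF M has_tangent_transport[OF M \<phi> \<gamma>] comp(3,4)])
  have "\<forall>\<^sub>F t in nhds 0. snd ?c (\<phi> (\<gamma> t)) = snd c (\<gamma> t)"
    using has_tangent_points[OF M \<gamma>] by eventually_elim (simp add: chartwise_diffeo_points(3)[OF \<phi>])
  from has_vector_derivative_cong_nhds[OF 2 this] 1
  have "dchart M ?c (\<phi> p) (tangent_of M \<phi> p v) = dchart M c p v" by (rule vector_derivative_unique_at)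
  then show ?thesis using c' w unfolding subtangent_def by force
qed

text \<open>The given vector is pulled back along \<open>\<psi>'\<close>, lifted through
  \<open>f\<close>, and the lift is realised by a curve in \<open>S\<close>. By equivariance
  \<open>f\<close> maps the pushed curve to the push of its image, whose velocity is the given
  vector.\<close>

lemma submersion_on_transport:
  fixes M :: "('a, 'e::real_normed_vector) manifold" and N :: "('b, 'f::real_normed_vector) manifold"
  assumes fd: "fin_dim TYPE('e)" "fin_dim TYPE('f)" and M: "charted M" and N: "charted N"
    and \<phi>: "chartwise_diffeo M \<phi> \<psi>" and \<phi>': "chartwise_diffeo N \<phi>' \<psi>'"
    and f: "submersion_on M S N R f" and S: "S \<subseteq> points M" and R: "R \<subseteq> points N"
    and eq: "\<And>p. p \<in> S \<Longrightarrow> f (\<phi> p) = \<phi>' (f p)"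
  shows "submersion_on M (\<phi> ` S) N (\<phi>' ` R) f"
  unfolding submersion_on_def
proof (intro conjI ballI)
  have fs: "smooth_map_on M S N f" and fS: "f ` S \<subseteq> R" using f by (auto simp: submersion_on_def)
  show fs': "smooth_map_on M (\<phi> ` S) N f" by (rule smooth_map_on_transport[OF fd M N \<phi> \<phi>' fs S eq])
  show "f ` \<phi> ` S \<subseteq> \<phi>' ` R" using fS by (auto simp: eq)
  fix q w' assume "q \<in> \<phi> ` S" and w': "w' \<in> subtangent N (\<phi>' ` R) (f q)"
  then obtain p where p: "p \<in> S" "q = \<phi> p" by blast
  have pM: "p \<in> points M" and fp: "f p \<in> points N" using p S fS R by auto
  have fq: "f q = \<phi>' (f p)" using p eq by simp
  define w where "w = tangent_of N \<psi>' (\<phi>' (f p)) w'"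
  have "w \<in> subtangent N (\<psi>' ` \<phi>' ` R) (\<psi>' (\<phi>' (f p)))"
    unfolding w_def
  proof (rule subtangent_transport[OF fd(2) N chartwise_diffeo_sym[OF \<phi>']])
    show "w' \<in> subtangent N (\<phi>' ` R) (\<phi>' (f p))" using w' fq by simp
    show "\<phi>' ` R \<subseteq> points N" using R chartwise_diffeo_points(1)[OF \<phi>'] by blast
    show "\<phi>' (f p) \<in> points N" using fp chartwise_diffeo_points(1)[OF \<phi>'] by blast
  qed
  moreover have "\<psi>' ` \<phi>' ` R = R" using R chartwise_diffeo_points(3)[OF \<phi>'] by (force simp: subset_iff)
  ultimately have "w \<in> subtangent N R (f p)" by (simp add: chartwise_diffeo_points(3)[OF \<phi>' fp])
  then obtain v where v: "v \<in> subtangent M S p" "tmap_on M S N f (p, v) = (f p, w)"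
    using f p(1) unfolding submersion_on_def by blast
  obtain \<gamma> where \<gamma>: "has_tangent M \<gamma> p v" "\<forall>\<^sub>F t in nhds 0. \<gamma> t \<in> S"
    using subtangent_curve[OF M p(1) S v(1)] by blast
  have "has_tangent N (\<lambda>t. f (\<gamma> t)) (f p) w"
    using has_tangent_map[OF M N fs \<gamma>] v(2) by simp
  from has_tangent_transport[OF N \<phi>' this]
  have 1: "has_tangent N (\<lambda>t. \<phi>' (f (\<gamma> t))) (\<phi>' (f p)) (tangent_of N \<phi>' (f p) w)" .
  have w'eq: "tangent_of N \<phi>' (f p) w = w'"
    using tangent_of_inverse[OF N chartwise_diffeo_sym[OF \<phi>'], of "\<phi>' (f p)" w']
      chartwise_diffeo_points[OF \<phi>' fp] by (simp add: w_def)
  have "\<forall>\<^sub>F t in nhds 0. \<phi> (\<gamma> t) \<in> \<phi> ` S" using \<gamma>(2) by eventually_elim simp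
  from has_tangent_map[OF M N fs' has_tangent_transport[OF M \<phi> \<gamma>(1)] this]
  have 2: "has_tangent N (\<lambda>t. f (\<phi> (\<gamma> t))) (\<phi>' (f p)) (snd (tmap_on M (\<phi> ` S) N f (\<phi> p, tangent_of M \<phi> p v)))"
    using p fq by simp
  have "\<forall>\<^sub>F t in nhds 0. f (\<phi> (\<gamma> t)) = \<phi>' (f (\<gamma> t))" using \<gamma>(2) by eventually_elim (rule eq)
  from has_tangent_unique[OF has_tangent_cong[OF 2 this] 1]
  have "tmap_on M (\<phi> ` S) N f (q, tangent_of M \<phi> p v) = (f q, w')"
    using w'eq p(2) by (simp add: tmap_on_eq)
  moreover have "tangent_of M \<phi> p v \<in> subtangent M (\<phi> ` S) q"
    using subtangent_transport[OF fd(1) M \<phi> v(1) S pM] p(2) by simp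
  ultimately show "\<exists>v\<in>subtangent M (\<phi> ` S) q. tmap_on M (\<phi> ` S) N f (q, v) = (f q, w')" by blast
qed

lemma chartwise_diffeo_prod:
  fixes M :: "('a, 'e::real_normed_vector) manifold" and N :: "('b, 'f::real_normed_vector) manifold"
  assumes fd: "fin_dim TYPE('e)" "fin_dim TYPE('f)" and M: "charted M" and N: "charted N"
    and \<phi>: "chartwise_diffeo M \<phi> \<psi>" and \<phi>': "chartwise_diffeo N \<phi>' \<psi>'"
  shows "chartwise_diffeo (prod_manifold M N) (map_prod \<phi> \<phi>') (map_prod \<psi> \<psi>')"
proof -
  have rep: "\<exists>R. smooth_on (snd e ` fst e) R \<and> (\<forall>p\<in>fst e. snd e (map_prod \<phi> \<phi>' p) = R (snd e p))"
    if \<phi>: "chartwise_diffeo M \<phi> \<psi>" and \<phi>': "chartwise_diffeo N \<phi>' \<psi>'"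
      and c: "c \<in> atlas M" and d: "d \<in> atlas N" and e: "e = (fst c \<times> fst d, map_prod (snd c) (snd d))"
    for \<phi> \<psi> \<phi>' \<psi>' c d e
  proof -
    obtain Q where Q: "smooth_on (snd c ` fst c) Q" "\<And>p. p \<in> fst c \<Longrightarrow> snd c (\<phi> p) = Q (snd c p)"
      by (rule chartwise_diffeo_smooth[OF \<phi> c]) blast
    obtain R where R: "smooth_on (snd d ` fst d) R" "\<And>p. p \<in> fst d \<Longrightarrow> snd d (\<phi>' p) = R (snd d p)"
      by (rule chartwise_diffeo_smooth[OF \<phi>' d]) blast
    have img: "snd e ` fst e = (snd c ` fst c) \<times> (snd d ` fst d)" by (simp add: e map_prod_surj_on)
    have op: "open (snd e ` fst e)"
      unfolding img by (intro open_Times open_chart is_chart_atlas[OF M c] is_chart_atlas[OF N d])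
    have "smooth_on (snd e ` fst e) (\<lambda>x. (Q (fst x), R (snd x)))"
      by (intro smooth_on_Pair op smooth_on_compose[OF fd(1) op _ Q(1)] smooth_on_compose[OF fd(2) op _ R(1)]
          smooth_on_bounded_linear bounded_linear_fst bounded_linear_snd) (auto simp: img)
    then show ?thesis
      by (intro exI[of _ "\<lambda>x. (Q (fst x), R (snd x))"]) (auto simp: e Q(2) R(2))
  qed
  show ?thesis
    unfolding chartwise_diffeo_def
  proof (intro conjI ballI)
    show "chart_at (prod_manifold M N) (map_prod \<phi> \<phi>' p) = chart_at (prod_manifold M N) p"
      if "p \<in> points (prod_manifold M N)" for p
      using that chartwise_diffeo_chart_at[OF \<phi>] chartwise_diffeo_chart_at[OF \<phi>']
      by (auto simp: points_prod chart_at_prod)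
  next
    fix e p assume "e \<in> atlas (prod_manifold M N)" and p: "p \<in> fst e"
    then obtain c d where e: "c \<in> atlas M" "d \<in> atlas N" "e = (fst c \<times> fst d, map_prod (snd c) (snd d))"
      by (rule_tac atlas_prodE)
    show "map_prod \<phi> \<phi>' p \<in> fst e" "map_prod \<psi> \<psi>' p \<in> fst e"
      "map_prod \<psi> \<psi>' (map_prod \<phi> \<phi>' p) = p" "map_prod \<phi> \<phi>' (map_prod \<psi> \<psi>' p) = p"
      using p chartwise_diffeoD[OF \<phi> e(1)] chartwise_diffeoD[OF \<phi>' e(2)] by (auto simp: e(3))
  next
    fix e assume "e \<in> atlas (prod_manifold M N)"
    then obtain c d where e: "c \<in> atlas M" "d \<in> atlas N" "e = (fst c \<times> fst d, map_prod (snd c) (snd d))"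
      by (rule atlas_prodE)
    show "\<exists>R. smooth_on (snd e ` fst e) R \<and> (\<forall>p\<in>fst e. snd e (map_prod \<phi> \<phi>' p) = R (snd e p))"
      by (rule rep[OF \<phi> \<phi>' e])
    show "\<exists>R. smooth_on (snd e ` fst e) R \<and> (\<forall>p\<in>fst e. snd e (map_prod \<psi> \<psi>' p) = R (snd e p))"
      by (rule rep[OF chartwise_diffeo_sym[OF \<phi>] chartwise_diffeo_sym[OF \<phi>'] e])
  qed
qed

text \<open>Equivariance is assumed on \<open>H\<close> and \<open>K\<close> only, since the
  identities for \<open>comul\<close> and \<open>counit\<close> will be available just for
  composable pairs and for actual points of the base bundle.\<close>

lemma lie_groupoid_on_transport:
  fixes G :: "('g, 'e::real_normed_vector, 'm, 'f::real_normed_vector) groupoid"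
  assumes fd: "fin_dim TYPE('e)" "fin_dim TYPE('f)" and M: "charted (arrows G)" and N: "charted (objects G)"
    and \<phi>: "chartwise_diffeo (arrows G) \<phi> \<psi>" and \<phi>': "chartwise_diffeo (objects G) \<phi>' \<psi>'"
    and G: "lie_groupoid_on G H K"
    and src: "\<And>g. g \<in> H \<Longrightarrow> gsrc G (\<phi> g) = \<phi>' (gsrc G g)"
    and tgt: "\<And>g. g \<in> H \<Longrightarrow> gtgt G (\<phi> g) = \<phi>' (gtgt G g)"
    and mul: "\<And>g h. g \<in> H \<Longrightarrow> h \<in> H \<Longrightarrow> gtgt G h = gsrc G g \<Longrightarrow> gmul G (\<phi> g) (\<phi> h) = \<phi> (gmul G g h)"
    and unit: "\<And>x. x \<in> K \<Longrightarrow> gunit G (\<phi>' x) = \<phi> (gunit G x)"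
    and inv: "\<And>g. g \<in> H \<Longrightarrow> ginv G (\<phi> g) = \<phi> (ginv G g)"
  shows "lie_groupoid_on G (\<phi> ` H) (\<phi>' ` K)"
proof -
  note G' = G[unfolded lie_groupoid_on_def]
  have H: "H \<subseteq> points (arrows G)" and K: "K \<subseteq> points (objects G)"
    using G' by (auto simp: embedded_submanifold_def)
  have mem: "\<And>g. g \<in> H \<Longrightarrow> gsrc G g \<in> K" "\<And>g. g \<in> H \<Longrightarrow> gtgt G g \<in> K"
    using G' by (auto simp: submersion_on_def)
  have inj: "\<phi>' x = \<phi>' y \<longleftrightarrow> x = y" if "x \<in> K" "y \<in> K" for x y
    using chartwise_diffeo_inj[OF \<phi>', of x y] that K by blast
  \<comment> \<open>\<open>\<phi>'\<close> is injective on \<open>K\<close>, so transported arrows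
    are composable exactly when the original ones are.\<close>
  have comp: "composable G (\<phi> ` H) = map_prod \<phi> \<phi> ` composable G H"
    unfolding composable_def using inj mem by (auto simp: src tgt image_iff)
  have cH: "composable G H \<subseteq> points (prod_manifold (arrows G) (arrows G))"
    using H by (auto simp: composable_def points_prod)
  have "smooth_map_on (prod_manifold (arrows G) (arrows G)) (composable G H) (arrows G) (\<lambda>(g, h). gmul G g h)"
    using G' by blast
  then have m: "smooth_map_on (prod_manifold (arrows G) (arrows G)) (composable G (\<phi> ` H)) (arrows G)
      (\<lambda>(g, h). gmul G g h)"
    unfolding comp
    by (rule smooth_map_on_transport[OF fin_dim_prod[OF fd(1) fd(1)] fd(1) charted_prod[OF M M] M
          chartwise_diffeo_prod[OF fd(1) fd(1) M M \<phi> \<phi>] \<phi> _ cH]) (auto simp: composable_def mul)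
  have s: "submersion_on (arrows G) (\<phi> ` H) (objects G) (\<phi>' ` K) (gsrc G)"
    by (rule submersion_on_transport[OF fd M N \<phi> \<phi>' _ H K]) (use G' src in blast)+
  have t: "submersion_on (arrows G) (\<phi> ` H) (objects G) (\<phi>' ` K) (gtgt G)"
    by (rule submersion_on_transport[OF fd M N \<phi> \<phi>' _ H K]) (use G' tgt in blast)+
  have u: "smooth_map_on (objects G) (\<phi>' ` K) (arrows G) (gunit G)"
    by (rule smooth_map_on_transport[OF fd(2,1) N M \<phi>' \<phi> _ K]) (use G' unit in blast)+
  have i: "smooth_map_on (arrows G) (\<phi> ` H) (arrows G) (ginv G)"
    by (rule smooth_map_on_transport[OF fd(1,1) M M \<phi> \<phi> _ H]) (use G' inv in blast)+
  have e: "embedded_submanifold (arrows G) (\<phi> ` H)" "embedded_submanifold (objects G) (\<phi>' ` K)"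
    using embedded_submanifold_transport[OF fd(1) M \<phi>] embedded_submanifold_transport[OF fd(2) N \<phi>'] G' by blast+
  have alg: "gunit G x \<in> H" "gsrc G (gunit G x) = x" "gtgt G (gunit G x) = x" if "x \<in> K" for x
    using G' that by auto
  have alg2: "ginv G g \<in> H" "gmul G (gunit G (gtgt G g)) g = g" "gmul G g (gunit G (gsrc G g)) = g"
    "gsrc G (ginv G g) = gtgt G g" "gtgt G (ginv G g) = gsrc G g"
    "gmul G g (ginv G g) = gunit G (gtgt G g)" "gmul G (ginv G g) g = gunit G (gsrc G g)" if "g \<in> H" for g
    using G' that by auto
  have alg3: "gmul G g h \<in> H" "gsrc G (gmul G g h) = gsrc G h" "gtgt G (gmul G g h) = gtgt G g"
    if "g \<in> H" "h \<in> H" "gtgt G h = gsrc G g" for g h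
    using G' that by (auto simp: composable_def)
  have alg4: "gmul G (gmul G g h) k = gmul G g (gmul G h k)"
    if "g \<in> H" "h \<in> H" "k \<in> H" "gtgt G h = gsrc G g" "gtgt G k = gsrc G h" for g h k
    using G' that by (auto simp: composable_def)
  note simps = alg alg2 alg3 src tgt mul unit[symmetric] inv mem inj
  show ?thesis
    unfolding lie_groupoid_on_def
  proof (intro conjI e s t m u i)
    show "gunit G ` \<phi>' ` K \<subseteq> \<phi> ` H" "ginv G ` \<phi> ` H \<subseteq> \<phi> ` H"
      using alg(1) alg2(1) by (auto simp: unit inv)
    show "\<forall>(g, h)\<in>composable G (\<phi> ` H). gmul G g h \<in> \<phi> ` H \<and> gsrc G (gmul G g h) = gsrc G h \<and>
        gtgt G (gmul G g h) = gtgt G g"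
      unfolding comp by (auto simp: composable_def simps)
    show "\<forall>(g, h)\<in>composable G (\<phi> ` H). \<forall>k\<in>\<phi> ` H. gtgt G k = gsrc G h \<longrightarrow>
        gmul G (gmul G g h) k = gmul G g (gmul G h k)"
      unfolding comp by (auto simp: composable_def simps alg4)
    show "\<forall>x\<in>\<phi>' ` K. gsrc G (gunit G x) = x \<and> gtgt G (gunit G x) = x"
      by (auto simp: unit src tgt alg)
    show "\<forall>g\<in>\<phi> ` H. gmul G (gunit G (gtgt G g)) g = g \<and> gmul G g (gunit G (gsrc G g)) = g \<and>
        gsrc G (ginv G g) = gtgt G g \<and> gtgt G (ginv G g) = gsrc G g \<and>
        gmul G g (ginv G g) = gunit G (gtgt G g) \<and> gmul G (ginv G g) g = gunit G (gsrc G g)"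
      by (auto simp: unit src tgt alg alg2 mul inv mem)
  qed
qed

lemma Blinfun_apply: "bounded_linear f \<Longrightarrow> blinfun_apply (Blinfun f) w = f w"
  by (simp add: bounded_linear_Blinfun_apply)

section \<open>Gauge transformations of Dirac structures\<close>

definition gchart ::
    "('a, 'e::real_normed_vector) manifold \<Rightarrow> ('a, 'e) chart \<Rightarrow> ('a \<times> 'e gvec, 'e \<times> 'e gvec) chart" where
  "gchart M c = ({(p, e). p \<in> fst c},
     \<lambda>(p, v, \<alpha>). (snd c p, dchart M c p v, Blinfun (\<lambda>w. blinfun_apply \<alpha> (dchart_inv M c p w))))"

lemma fst_gchart: "fst (gchart M c) = fst c \<times> UNIV"
  by (auto simp: gchart_def)

lemma snd_gchart:
  "snd (gchart M c) (p, v, \<alpha>) =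
     (snd c p, dchart M c p v, Blinfun (\<lambda>w. blinfun_apply \<alpha> (dchart_inv M c p w)))"
  by (simp add: gchart_def)

lemma atlas_gtangent: "atlas (gtangent M) = gchart M ` atlas M"
  by (simp add: gtangent_def gchart_def Let_def image_def)

lemma chart_at_gtangent: "chart_at (gtangent M) (p, e) = gchart M (chart_at M p)"
  by (simp add: gtangent_def gchart_def Let_def)

lemma points_gtangent: "points (gtangent M) = points M \<times> UNIV"
  by (auto simp: points_def atlas_gtangent fst_gchart)

context
  fixes M :: "('a, 'e::real_inner) manifold"
  assumes M: "is_manifold M"
begin

lemma manifold_fin_dim: "fin_dim TYPE('e)"
  using M by (auto simp: is_manifold_def intro: fin_dim_real_inner)

lemma manifold_compatible: "c \<in> atlas M \<Longrightarrow> d \<in> atlas M \<Longrightarrow> compatible c d"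
  using M by (auto simp: is_manifold_def)

lemma manifold_is_chart: "c \<in> atlas M \<Longrightarrow> is_chart c"
  using M by (auto simp: is_manifold_def)

lemmas manifold_chart_at = chartedD[OF is_manifold_charted[OF M]]

lemma
  assumes c: "c \<in> atlas M" "p \<in> fst c"
  shows linear_dchart: "linear (dchart M c p)"
    and linear_dchart_inv: "linear (dchart_inv M c p)"
    and dchart_inv_dchart: "dchart_inv M c p (dchart M c p v) = v"
    and dchart_dchart_inv: "dchart M c p (dchart_inv M c p v) = v"
proof -
  have p: "p \<in> points M" using c by (rule atlas_points)
  let ?c = "chart_at M p"
  note ca = manifold_chart_at[OF p]
  note ch = manifold_is_chart[OF ca(1)] manifold_is_chart[OF c(1)]
  note comp = manifold_compatible[OF ca(1) c(1)] manifold_compatible[OF c(1) ca(1)]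
  show "linear (dchart M c p)"
    unfolding dchart_def by (rule bounded_linear.linear[OF has_derivative_bounded_linear[OF
        compatible_has_derivative[OF comp(1) ch(1) ca(2) c(2)]]])
  show "linear (dchart_inv M c p)"
    unfolding dchart_inv_def by (rule bounded_linear.linear[OF has_derivative_bounded_linear[OF
        compatible_has_derivative[OF comp(2) ch(2) c(2) ca(2)]]])
  show "dchart_inv M c p (dchart M c p v) = v"
    unfolding dchart_def dchart_inv_def by (rule transition_inverse[OF comp(1) ch ca(2) c(2)])
  show "dchart M c p (dchart_inv M c p v) = v"
    unfolding dchart_def dchart_inv_def by (rule transition_inverse[OF comp(2) ch(2,1) c(2) ca(2)])
qed

text \<open>The Cartan formulas are written in the preferred chart; there the representatives of
  fields and forms at \<open>p\<close> are their values themselves.\<close>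

lemma
  assumes p: "p \<in> points M"
  shows dchart_chart_at: "dchart M (chart_at M p) p v = v"
    and dchart_inv_chart_at: "dchart_inv M (chart_at M p) p v = v"
proof -
  let ?c = "chart_at M p"
  note ca = manifold_chart_at[OF p]
  note ch = manifold_is_chart[OF ca(1)]
  have "((snd ?c \<circ> cinv ?c) has_derivative (\<lambda>v. v)) (at (snd ?c p))"
    by (rule has_derivative_transform_within_open[OF has_derivative_ident open_chart[OF ch]])
      (use ca in \<open>auto simp: cinv_chart[OF ch]\<close>)
  then have "frechet_derivative (snd ?c \<circ> cinv ?c) (at (snd ?c p)) = (\<lambda>v. v)"
    by (metis frechet_derivative_at)
  then show "dchart M ?c p v = v" "dchart_inv M ?c p v = v" by (simp_all add: dchart_def dchart_inv_def)
qed

lemma bounded_linear_dchart: "c \<in> atlas M \<Longrightarrow> p \<in> fst c \<Longrightarrow> bounded_linear (dchart M c p)"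
  by (rule linear_bounded_fin_dim[OF manifold_fin_dim linear_dchart])

lemma bounded_linear_dchart_inv: "c \<in> atlas M \<Longrightarrow> p \<in> fst c \<Longrightarrow> bounded_linear (dchart_inv M c p)"
  by (rule linear_bounded_fin_dim[OF manifold_fin_dim linear_dchart_inv])

lemma Blinfun_covector:
  assumes "c \<in> atlas M" "p \<in> fst c"
  shows "blinfun_apply (Blinfun (\<lambda>w. blinfun_apply \<alpha> (dchart_inv M c p w))) w = blinfun_apply \<alpha> (dchart_inv M c p w)"
  by (rule Blinfun_apply)
    (rule bounded_linear_compose[OF blinfun.bounded_linear_right bounded_linear_dchart_inv[OF assms]])

lemma gchart_image:
  assumes c: "c \<in> atlas M"
  shows "snd (gchart M c) ` fst (gchart M c) = (snd c ` fst c) \<times> UNIV"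
proof (intro set_eqI iffI)
  fix y assume "y \<in> snd (gchart M c) ` fst (gchart M c)"
  then show "y \<in> (snd c ` fst c) \<times> UNIV" by (auto simp: fst_gchart snd_gchart)
next
  fix y :: "'e \<times> 'e gvec" assume "y \<in> (snd c ` fst c) \<times> UNIV"
  then obtain p v \<alpha> where y: "y = (snd c p, v, \<alpha>)" "p \<in> fst c" by (cases y) auto
  let ?\<beta> = "Blinfun (\<lambda>w. blinfun_apply \<alpha> (dchart M c p w))"
  have "blinfun_apply ?\<beta> w = blinfun_apply \<alpha> (dchart M c p w)" for w
    by (rule Blinfun_apply)
      (rule bounded_linear_compose[OF blinfun.bounded_linear_right bounded_linear_dchart[OF c y(2)]])
  then have "y = snd (gchart M c) (p, dchart_inv M c p v, ?\<beta>)"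
    by (simp add: y snd_gchart dchart_dchart_inv[OF c y(2)] blinfun_apply_inverse)
  then show "y \<in> snd (gchart M c) ` fst (gchart M c)" using y(2) by (auto simp: fst_gchart)
qed

lemma is_chart_gchart:
  assumes c: "c \<in> atlas M"
  shows "is_chart (gchart M c)"
  unfolding is_chart_def
proof
  show "open (snd (gchart M c) ` fst (gchart M c))"
    unfolding gchart_image[OF c] by (intro open_Times open_chart manifold_is_chart c) simp
  show "inj_on (snd (gchart M c)) (fst (gchart M c))"
  proof (rule inj_onI)
    fix x y assume xy: "x \<in> fst (gchart M c)" "y \<in> fst (gchart M c)" "snd (gchart M c) x = snd (gchart M c) y"
    obtain p v \<alpha> where x: "x = (p, v, \<alpha>)" by (cases x)
    obtain q w \<beta> where y: "y = (q, w, \<beta>)" by (cases y)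
    have p: "p \<in> fst c" and q: "q \<in> fst c" using xy by (auto simp: x y fst_gchart)
    have "p = q" using xy(3) p q manifold_is_chart[OF c] by (auto simp: x y snd_gchart is_chart_def dest: inj_onD)
    moreover have "v = w" using xy(3) dchart_inv_dchart[OF c q] by (auto simp: x y snd_gchart \<open>p = q\<close>) metis
    moreover have "\<alpha> = \<beta>"
    proof (rule blinfun_eqI)
      fix u
      have "blinfun_apply \<alpha> (dchart_inv M c q w) = blinfun_apply \<beta> (dchart_inv M c q w)" for w
        using xy(3) Blinfun_covector[OF c q, of \<alpha> w] Blinfun_covector[OF c q, of \<beta> w]
        by (simp add: x y snd_gchart \<open>p = q\<close>)
      from this[of "dchart M c q u"] show "blinfun_apply \<alpha> u = blinfun_apply \<beta> u"
        by (simp add: dchart_inv_dchart[OF c q])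
    qed
    ultimately show "x = y" by (simp add: x y)
  qed
qed

lemma charted_gtangent: "charted (gtangent M)"
  using is_chart_gchart manifold_chart_at
  by (auto simp: charted_def atlas_gtangent points_gtangent chart_at_gtangent fst_gchart)

lemma fin_dim_gvec: "fin_dim TYPE('e gvec)"
  by (intro fin_dim_prod fin_dim_dual manifold_fin_dim)

section \<open>The 2-form and its gauge transformation in coordinates\<close>

lemma form2_rep_eq:
  assumes "c \<in> atlas M" "p \<in> fst c"
  shows "form2_rep M c B (snd c p) (dchart M c p u) w = blinfun_apply (blinfun_apply (B p) u) (dchart_inv M c p w)"
  using assms by (simp add: form2_rep_def cinv_chart manifold_is_chart dchart_inv_dchart)

lemma linear_form2_rep:
  assumes "c \<in> atlas M" "x \<in> snd c ` fst c"
  shows "linear (\<lambda>u. form2_rep M c B x u w)" "linear (form2_rep M c B x u)"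
proof -
  have "linear (dchart_inv M c (cinv c x))" using assms by (intro linear_dchart_inv cinv_in)
  then show "linear (\<lambda>u. form2_rep M c B x u w)" "linear (form2_rep M c B x u)"
    by (auto simp: form2_rep_def linear_iff blinfun.add_right blinfun.scaleR_right blinfun.add_left blinfun.scaleR_left)
qed

lemma two_form_rep_smooth: "two_form M B \<Longrightarrow> c \<in> atlas M \<Longrightarrow> smooth_on (snd c ` fst c) (\<lambda>x. form2_rep M c B x u w)"
  by (simp add: two_form_def)

lemma two_form_alt:
  assumes "two_form M B" "p \<in> points M"
  shows "blinfun_apply (blinfun_apply (B p) v) v = 0"
    and "blinfun_apply (blinfun_apply (B p) v) w = - blinfun_apply (blinfun_apply (B p) w) v"
proof -
  have alt: "blinfun_apply (blinfun_apply (B p) v) v = 0" for v using assms by (simp add: two_form_def)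
  then show "blinfun_apply (blinfun_apply (B p) v) v = 0" .
  show "blinfun_apply (blinfun_apply (B p) v) w = - blinfun_apply (blinfun_apply (B p) w) v"
    using alt[of "v + w"] alt[of v] alt[of w] by (simp add: blinfun.add_left blinfun.add_right)
qed

lemma two_form_uminus: "two_form M B \<Longrightarrow> two_form M (\<lambda>p. - B p)"
proof -
  assume B: "two_form M B"
  have "smooth_on (snd c ` fst c) (\<lambda>x. form2_rep M c (\<lambda>p. - B p) x u w)" if c: "c \<in> atlas M" for c u w
    using smooth_on_bounded_linear_compose[OF open_chart[OF manifold_is_chart[OF c]] bounded_linear_minus[OF bounded_linear_ident]
        two_form_rep_smooth[OF B c]] by (simp add: form2_rep_def blinfun.minus_left)
  then show "two_form M (\<lambda>p. - B p)" using B by (simp add: two_form_def blinfun.minus_left)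
qed

text \<open>Smoothness of \<open>form2_rep\<close> is given for fixed vectors; linearity admits
  moving vectors, one slot at a time.\<close>

lemma smooth_on_form_insert:
  fixes u :: "'x::real_normed_vector \<Rightarrow> 'e" and x :: "'x \<Rightarrow> 'e"
  assumes B: "two_form M B" and c: "c \<in> atlas M" and S: "open S"
    and x: "smooth_on S x" "x ` S \<subseteq> snd c ` fst c" and u: "smooth_on S u" and w: "smooth_on S w"
  shows "smooth_on S (\<lambda>y. form2_rep M c B (x y) (u y) (w y))"
proof -
  have "smooth_on S (\<lambda>y. form2_rep M c B (x y) u w)" for u w
    by (rule smooth_on_compose[OF manifold_fin_dim S x(1) two_form_rep_smooth[OF B c] x(2)])
  then have "smooth_on S (\<lambda>y. form2_rep M c B (x y) (u y) w)" for w
    using linear_form2_rep(1)[OF c] x(2)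
    by (intro smooth_on_linear_apply[OF manifold_fin_dim S _ _ u, where A = "\<lambda>y u. form2_rep M c B (x y) u w"]) auto
  then show ?thesis
    using linear_form2_rep(2)[OF c] x(2)
    by (intro smooth_on_linear_apply[OF manifold_fin_dim S _ _ w, where A = "\<lambda>y. form2_rep M c B (x y) (u y)"]) auto
qed

lemma smooth_on_form_contract:
  fixes u :: "'x::real_normed_vector \<Rightarrow> 'e" and x :: "'x \<Rightarrow> 'e"
  assumes B: "two_form M B" and c: "c \<in> atlas M" and S: "open S"
    and x: "smooth_on S x" "x ` S \<subseteq> snd c ` fst c" and u: "smooth_on S u"
  shows "smooth_on S (\<lambda>y. Blinfun (form2_rep M c B (x y) (u y)))"
  using x(2) linear_form2_rep(2)[OF c]
  by (intro smooth_on_Blinfun[OF manifold_fin_dim S] smooth_on_form_insert[OF B c S x u] smooth_on_const S) auto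

lemma Blinfun_form2_rep:
  assumes "c \<in> atlas M" "x \<in> snd c ` fst c"
  shows "blinfun_apply (Blinfun (form2_rep M c B x u)) w = form2_rep M c B x u w"
  by (rule Blinfun_apply) (rule linear_bounded_fin_dim[OF manifold_fin_dim linear_form2_rep(2)[OF assms]])

lemma tau_inverse: "tau (\<lambda>p. - B p) (tau B x) = x" "tau B (tau (\<lambda>p. - B p) x) = x"
  for B :: "'b \<Rightarrow> 'e \<Rightarrow>\<^sub>L 'e \<Rightarrow>\<^sub>L real"
  by (cases x; simp add: tau_def blinfun.minus_left)+

lemma tau_chart_rep:
  assumes B: "two_form M B" and d: "d \<in> atlas (gtangent M)"
  shows "\<exists>R. smooth_on (snd d ` fst d) R \<and> (\<forall>p\<in>fst d. snd d (tau B p) = R (snd d p))"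
proof -
  obtain c where c: "c \<in> atlas M" and d: "d = gchart M c" using d by (auto simp: atlas_gtangent)
  let ?S = "(snd c ` fst c) \<times> (UNIV :: 'e gvec set)"
  define R where "R y = (fst y, fst (snd y), snd (snd y) + Blinfun (form2_rep M c B (fst y) (fst (snd y))))" for y :: "'e \<times> 'e gvec"
  have S: "open ?S" by (intro open_Times open_chart manifold_is_chart c) simp
  have "smooth_on ?S R"
    unfolding R_def
    by (intro smooth_on_Pair S smooth_on_add smooth_on_form_contract[OF B c S] smooth_on_fst smooth_on_snd smooth_on_ident) auto
  moreover have "snd d (tau B y) = R (snd d y)" if y: "y \<in> fst d" for y
  proof -
    obtain p v \<alpha> where y': "y = (p, v, \<alpha>)" by (cases y)
    have p: "p \<in> fst c" using y by (simp add: y' d fst_gchart)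
    have "Blinfun (\<lambda>w. blinfun_apply (\<alpha> + blinfun_apply (B p) v) (dchart_inv M c p w)) =
        Blinfun (\<lambda>w. blinfun_apply \<alpha> (dchart_inv M c p w)) + Blinfun (form2_rep M c B (snd c p) (dchart M c p v))"
      by (rule blinfun_eqI)
        (use p Blinfun_covector[OF c p, of "\<alpha> + blinfun_apply (B p) v"] in \<open>simp add: Blinfun_covector[OF c p] blinfun.add_left Blinfun_form2_rep[OF c] form2_rep_eq[OF c p]\<close>)
    then show ?thesis by (simp add: y' d tau_def snd_gchart R_def)
  qed
  ultimately show ?thesis unfolding d gchart_image[OF c] by blast
qed

lemma chartwise_diffeo_tau:
  assumes B: "two_form M B"
  shows "chartwise_diffeo (gtangent M) (tau B) (tau (\<lambda>p. - B p))"
  unfolding chartwise_diffeo_def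
proof (intro conjI ballI)
  show "chart_at (gtangent M) (tau B p) = chart_at (gtangent M) p" for p
    by (cases p) (simp add: tau_def chart_at_gtangent)
  show "tau B p \<in> fst c" "tau (\<lambda>p. - B p) p \<in> fst c" if "c \<in> atlas (gtangent M)" "p \<in> fst c" for c p
    using that by (cases p; auto simp: tau_def atlas_gtangent fst_gchart)+
qed (simp_all add: tau_inverse tau_chart_rep[OF B] tau_chart_rep[OF two_form_uminus[OF B]])

definition gauge :: "('a \<Rightarrow> 'e \<Rightarrow>\<^sub>L 'e \<Rightarrow>\<^sub>L real) \<Rightarrow> 'a \<Rightarrow> 'e gvec \<Rightarrow> 'e gvec" where
  "gauge B p e = (fst e, snd e + blinfun_apply (B p) (fst e))"

lemma tau_gauge: "tau B (p, e) = (p, gauge B p e)"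
  by (cases e) (simp add: tau_def gauge_def)

lemma gauge_inverse: "gauge (\<lambda>p. - B p) p (gauge B p e) = e" "gauge B p (gauge (\<lambda>p. - B p) p e) = e"
  by (simp_all add: gauge_def blinfun.minus_left)

lemma linear_gauge: "linear (gauge B p)"
  by (rule linearI) (auto simp: gauge_def blinfun.add_right blinfun.scaleR_right scaleR_add_right)

lemma inj_gauge: "inj (gauge B p)"
  by (metis gauge_inverse(1) injI)

lemma fibre_tau: "fibre (tau B ` L) p = gauge B p ` fibre L p"
  by (force simp: fibre_def tau_gauge image_iff)

lemma smooth_open_tau:
  assumes B: "two_form M B" and U: "U \<subseteq> points M" and e: "smooth_open M U (gtangent M) (\<lambda>p. (p, e p))"
  shows "smooth_open M U (gtangent M) (\<lambda>p. (p, gauge B p (e p)))"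
proof -
  note ch = is_manifold_charted[OF M]
  \<comment> \<open>With the identity on the base, transport by \<open>tau B\<close> becomes
    postcomposition, which is the gauged section.\<close>
  have "chartwise_diffeo M id id"
    unfolding chartwise_diffeo_def
    using smooth_on_ident[OF open_chart[OF manifold_is_chart]] by (auto intro!: exI[of _ "\<lambda>x. x"])
  from smooth_open_transport[OF manifold_fin_dim _ ch charted_gtangent this chartwise_diffeo_tau[OF B] U e]
  show ?thesis by (simp add: o_def tau_gauge fin_dim_prod[OF manifold_fin_dim fin_dim_gvec])
qed

text \<open>On each fibre \<open>gauge\<close> is a linear bijection, and it preserves smoothness of
  sections, so it carries local frames to local frames of the same length.\<close>

lemma subbundle_tau:
  assumes B: "two_form M B" and L: "subbundle M L"
  shows "subbundle M (tau B ` L)"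
proof -
  obtain k where L1: "L \<subseteq> points (gtangent M)" and k: "\<forall>p\<in>points M. \<exists>U (\<sigma> :: nat \<Rightarrow> 'a \<Rightarrow> 'e gvec).
        openin (mtop M) U \<and> p \<in> U \<and>
        (\<forall>i<k. smooth_open M U (gtangent M) (\<lambda>q. (q, \<sigma> i q))) \<and>
        (\<forall>q\<in>U. inj_on (\<lambda>i. \<sigma> i q) {..<k} \<and> independent ((\<lambda>i. \<sigma> i q) ` {..<k}) \<and>
                span ((\<lambda>i. \<sigma> i q) ` {..<k}) = fibre L q)"
    using L unfolding subbundle_def by blast
  have "\<exists>U (\<sigma> :: nat \<Rightarrow> 'a \<Rightarrow> 'e gvec).
        openin (mtop M) U \<and> p \<in> U \<and>
        (\<forall>i<k. smooth_open M U (gtangent M) (\<lambda>q. (q, \<sigma> i q))) \<and>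
        (\<forall>q\<in>U. inj_on (\<lambda>i. \<sigma> i q) {..<k} \<and> independent ((\<lambda>i. \<sigma> i q) ` {..<k}) \<and>
                span ((\<lambda>i. \<sigma> i q) ` {..<k}) = fibre (tau B ` L) q)" if p: "p \<in> points M" for p
  proof -
    obtain U and \<sigma> :: "nat \<Rightarrow> 'a \<Rightarrow> 'e gvec" where U: "openin (mtop M) U" "p \<in> U"
      and s: "\<And>i. i < k \<Longrightarrow> smooth_open M U (gtangent M) (\<lambda>q. (q, \<sigma> i q))"
      and f: "\<And>q. q \<in> U \<Longrightarrow> inj_on (\<lambda>i. \<sigma> i q) {..<k}" "\<And>q. q \<in> U \<Longrightarrow> independent ((\<lambda>i. \<sigma> i q) ` {..<k})"
        "\<And>q. q \<in> U \<Longrightarrow> span ((\<lambda>i. \<sigma> i q) ` {..<k}) = fibre L q"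
      using bspec[OF k p] by (elim exE conjE) blast
    have UM: "U \<subseteq> points M" using U(1) is_manifold_charted[OF M] by (simp add: openin_mtop)
    have img: "(\<lambda>i. gauge B q (\<sigma> i q)) ` {..<k} = gauge B q ` (\<lambda>i. \<sigma> i q) ` {..<k}" for q by auto
    show ?thesis
    proof (intro exI[of _ U] exI[of _ "\<lambda>i q. gauge B q (\<sigma> i q)"] conjI U allI impI ballI)
      show "smooth_open M U (gtangent M) (\<lambda>q. (q, gauge B q (\<sigma> i q)))" if "i < k" for i
        by (rule smooth_open_tau[OF B UM s[OF that]])
      show "inj_on (\<lambda>i. gauge B q (\<sigma> i q)) {..<k}" if "q \<in> U" for q
        using f(1)[OF that] by (auto simp: inj_on_def dest: injD[OF inj_gauge])
      show "independent ((\<lambda>i. gauge B q (\<sigma> i q)) ` {..<k})" if "q \<in> U" for q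
        unfolding img using f(2)[OF that] inj_gauge
        by (intro linear_independent_injective_image linear_gauge) (auto intro: inj_on_subset)
      show "span ((\<lambda>i. gauge B q (\<sigma> i q)) ` {..<k}) = fibre (tau B ` L) q" if "q \<in> U" for q
        unfolding img fibre_tau f(3)[OF that, symmetric] by (rule linear_span_image[OF linear_gauge])
    qed
  qed
  moreover have "tau B ` L \<subseteq> points (gtangent M)"
    using L1 by (auto simp: points_gtangent tau_gauge)
  ultimately show ?thesis unfolding subbundle_def by blast
qed

text \<open>The added terms B(X, Y) and B(Y, X) cancel by skew-symmetry; orthogonal complements are
  therefore carried along.\<close>

lemma gpair_gauge:
  assumes "two_form M B" "p \<in> points M"
  shows "gpair (gauge B p e) (gauge B p e') = gpair e e'"
  using two_form_alt(2)[OF assms, of "fst e" "fst e'"]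
  by (simp add: gpair_def gauge_def split_def blinfun.add_left)

lemma smooth_open_cong:
  assumes "smooth_open M U N f" "\<And>p. p \<in> U \<Longrightarrow> f p = g p"
  shows "smooth_open M U N g"
  unfolding smooth_open_def Let_def
proof (intro conjI ballI)
  show "g ` U \<subseteq> points N" using assms by (auto simp: smooth_open_def)
  fix c d assume c: "c \<in> atlas M" and d: "d \<in> atlas N"
  have V: "U \<inter> fst c \<inter> g -` fst d = U \<inter> fst c \<inter> f -` fst d" using assms(2) by auto
  have *: "open (snd c ` (U \<inter> fst c \<inter> f -` fst d))"
    "smooth_on (snd c ` (U \<inter> fst c \<inter> f -` fst d)) (snd d \<circ> f \<circ> cinv c)"
    using assms(1) c d by (auto simp: smooth_open_def Let_def)
  show "open (snd c ` (U \<inter> fst c \<inter> g -` fst d))" unfolding V by (rule *)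
  show "smooth_on (snd c ` (U \<inter> fst c \<inter> g -` fst d)) (snd d \<circ> g \<circ> cinv c)"
    unfolding V by (rule smooth_on_cong[OF *(1) _ *(2)]) (auto simp: cinv_chart[OF manifold_is_chart[OF c]] assms(2))
qed

text \<open>Two sections may differ off \<open>points M\<close>, and the bracket identity
  \<open>courant_bracket_gauge\<close> is available only on it.\<close>

lemma sections_cong:
  assumes "e \<in> sections M L" "\<And>p. p \<in> points M \<Longrightarrow> e p = e' p"
  shows "e' \<in> sections M L"
  using assms smooth_open_cong[of "points M" "gtangent M" "\<lambda>p. (p, e p)" "\<lambda>p. (p, e' p)"]
  by (auto simp: sections_def)

lemma sections_tau:
  assumes B: "two_form M B" and e: "e \<in> sections M L"
  shows "(\<lambda>p. gauge B p (e p)) \<in> sections M (tau B ` L)"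
proof -
  have "smooth_open M (points M) (gtangent M) (\<lambda>p. (p, e p))" using e by (simp add: sections_def)
  from smooth_open_tau[OF B order_refl this] show ?thesis
    using e by (auto simp: sections_def tau_gauge[symmetric])
qed

section \<open>Compatibility of the Courant bracket with gauge transformations\<close>

lemma section_rep_smooth:
  assumes e: "e \<in> sections M L" and c: "c \<in> atlas M"
  shows "smooth_on (snd c ` fst c) (vf_rep M c (fst \<circ> e))" "smooth_on (snd c ` fst c) (cov_rep M c (snd \<circ> e))"
proof -
  have s: "smooth_open M (points M) (gtangent M) (\<lambda>p. (p, e p))" using e by (simp add: sections_def)
  have "gchart M c \<in> atlas (gtangent M)" using c by (simp add: atlas_gtangent)
  then have "smooth_on (snd c ` (points M \<inter> fst c \<inter> (\<lambda>p. (p, e p)) -` fst (gchart M c)))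
      (snd (gchart M c) \<circ> (\<lambda>p. (p, e p)) \<circ> cinv c)"
    using s c unfolding smooth_open_def Let_def by blast
  moreover have "points M \<inter> fst c \<inter> (\<lambda>p. (p, e p)) -` fst (gchart M c) = fst c"
    using c by (auto simp: fst_gchart intro: atlas_points)
  ultimately have s: "smooth_on (snd c ` fst c) (snd (gchart M c) \<circ> (\<lambda>p. (p, e p)) \<circ> cinv c)" by simp
  have op: "open (snd c ` fst c)" by (rule open_chart[OF manifold_is_chart[OF c]])
  have eq: "(snd (gchart M c) \<circ> (\<lambda>p. (p, e p)) \<circ> cinv c) x =
      (snd c (cinv c x), vf_rep M c (fst \<circ> e) x, cov_rep M c (snd \<circ> e) x)" for x
    by (simp add: gchart_def split_def vf_rep_def cov_rep_def)
  show "smooth_on (snd c ` fst c) (vf_rep M c (fst \<circ> e))" "smooth_on (snd c ` fst c) (cov_rep M c (snd \<circ> e))"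
    using smooth_on_fst[OF op smooth_on_snd[OF op s]] smooth_on_snd[OF op smooth_on_snd[OF op s]]
    by (simp_all only: eq fst_conv snd_conv)
qed

text \<open>Product rule in the base point and the first argument. Passing to \<open>Blinfun\<close>
  turns evaluation into a bounded bilinear operation; its base-point part is then recognised as the
  derivative with the argument frozen at \<open>Y x\<close>.\<close>

lemma form2_rep_has_derivative:
  assumes B: "two_form M B" and c: "c \<in> atlas M" and x: "x \<in> snd c ` fst c" and Y: "(Y has_derivative Y') (at x)"
  shows "((\<lambda>y. form2_rep M c B y (Y y) v) has_derivative
     (\<lambda>u. frechet_derivative (\<lambda>y. form2_rep M c B y (Y x) v) (at x) u + form2_rep M c B x (Y' u) v)) (at x)"
proof -
  have op: "open (snd c ` fst c)" by (rule open_chart[OF manifold_is_chart[OF c]])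
  let ?b = "\<lambda>y. Blinfun (\<lambda>u. form2_rep M c B y u v)"
  have b: "blinfun_apply (?b y) u = form2_rep M c B y u v" if "y \<in> snd c ` fst c" for y u
    by (rule Blinfun_apply)
      (rule linear_bounded_fin_dim[OF manifold_fin_dim linear_form2_rep(1)[OF c that]])
  have "smooth_on (snd c ` fst c) ?b"
    by (intro smooth_on_Blinfun[OF manifold_fin_dim op] linear_form2_rep(1)[OF c] two_form_rep_smooth[OF B c])
  from smooth_on_has_derivative[OF this x]
  obtain b' where b': "(?b has_derivative b') (at x)" by blast
  have "((\<lambda>y. blinfun_apply (?b y) (Y x)) has_derivative (\<lambda>u. blinfun_apply (b' u) (Y x))) (at x)"
    by (rule bounded_linear.has_derivative[OF blinfun.bounded_linear_left b'])
  then have "((\<lambda>y. form2_rep M c B y (Y x) v) has_derivative (\<lambda>u. blinfun_apply (b' u) (Y x))) (at x)"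
    by (rule has_derivative_transform_within_open[OF _ op x]) (simp add: b)
  from frechet_derivative_at[OF this]
  have b'eq: "blinfun_apply (b' u) (Y x) = frechet_derivative (\<lambda>y. form2_rep M c B y (Y x) v) (at x) u" for u by metis
  have "((\<lambda>y. blinfun_apply (?b y) (Y y)) has_derivative
      (\<lambda>u. blinfun_apply (?b x) (Y' u) + blinfun_apply (b' u) (Y x))) (at x)"
    by (rule bounded_bilinear.FDERIV[OF bounded_bilinear_blinfun_apply b' Y])
  then have "((\<lambda>y. form2_rep M c B y (Y y) v) has_derivative
      (\<lambda>u. blinfun_apply (?b x) (Y' u) + blinfun_apply (b' u) (Y x))) (at x)"
    by (rule has_derivative_transform_within_open[OF _ op x]) (simp add: b)
  then show ?thesis by (simp add: b[OF x] b'eq add.commute)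
qed

text \<open>Besides the derivative of the covector there are the derivative of B at a frozen field,
  which will assemble to dB, and B applied to the derivative of the field, which will assemble to
  the Lie bracket term.\<close>

lemma cov_rep_gauge_derivative:
  assumes B: "two_form M B" and e: "e \<in> sections M L" and c: "c \<in> atlas M" and x: "x \<in> snd c ` fst c"
  shows "blinfun_apply (frechet_derivative (cov_rep M c (\<lambda>p. snd (gauge B p (e p)))) (at x) u) v =
     blinfun_apply (frechet_derivative (cov_rep M c (snd \<circ> e)) (at x) u) v +
     frechet_derivative (\<lambda>y. form2_rep M c B y (vf_rep M c (fst \<circ> e) x) v) (at x) u +
     form2_rep M c B x (frechet_derivative (vf_rep M c (fst \<circ> e)) (at x) u) v"
proof -
  let ?Y = "vf_rep M c (fst \<circ> e)" and ?\<beta> = "cov_rep M c (snd \<circ> e)"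
  let ?\<beta>' = "cov_rep M c (\<lambda>p. snd (gauge B p (e p)))"
  note sm = section_rep_smooth[OF e c]
  have op: "open (snd c ` fst c)" by (rule open_chart[OF manifold_is_chart[OF c]])
  have rep: "?\<beta>' y = ?\<beta> y + Blinfun (form2_rep M c B y (?Y y))" if y: "y \<in> snd c ` fst c" for y
  proof (rule blinfun_eqI)
    fix w
    have p: "cinv c y \<in> fst c" by (rule cinv_in[OF y])
    show "blinfun_apply (?\<beta>' y) w = blinfun_apply (?\<beta> y + Blinfun (form2_rep M c B y (?Y y))) w"
      using form2_rep_eq[OF c p, of B "fst (e (cinv c y))" w] chart_cinv[OF y]
        Blinfun_covector[OF c p, of "snd (gauge B (cinv c y) (e (cinv c y)))" w]
      by (simp add: cov_rep_def vf_rep_def Blinfun_covector[OF c p] gauge_def blinfun.add_left Blinfun_form2_rep[OF c y])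
  qed
  have Y: "(?Y has_derivative frechet_derivative ?Y (at x)) (at x)"
    and \<beta>: "(?\<beta> has_derivative frechet_derivative ?\<beta> (at x)) (at x)"
    using smooth_on_has_derivative[OF sm(1) x] smooth_on_has_derivative[OF sm(2) x] .
  let ?F = "\<lambda>y. Blinfun (form2_rep M c B y (?Y y))"
  have "smooth_on (snd c ` fst c) ?F"
    by (rule smooth_on_form_contract[OF B c op smooth_on_ident[OF op] _ sm(1)]) simp
  from smooth_on_has_derivative[OF this x]
  obtain F' where F': "(?F has_derivative F') (at x)" by blast
  have "((\<lambda>y. blinfun_apply (?F y) v) has_derivative (\<lambda>u. blinfun_apply (F' u) v)) (at x)"
    by (rule bounded_linear.has_derivative[OF blinfun.bounded_linear_left F'])
  then have "((\<lambda>y. form2_rep M c B y (?Y y) v) has_derivative (\<lambda>u. blinfun_apply (F' u) v)) (at x)"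
    by (rule has_derivative_transform_within_open[OF _ op x]) (simp add: Blinfun_form2_rep[OF c])
  from has_derivative_unique[OF this form2_rep_has_derivative[OF B c x Y]]
  have F'eq: "blinfun_apply (F' u) v = frechet_derivative (\<lambda>y. form2_rep M c B y (?Y x) v) (at x) u +
      form2_rep M c B x (frechet_derivative ?Y (at x) u) v" by metis
  have "((\<lambda>y. ?\<beta> y + ?F y) has_derivative (\<lambda>u. frechet_derivative ?\<beta> (at x) u + F' u)) (at x)"
    by (rule has_derivative_add[OF \<beta> F'])
  then have "(?\<beta>' has_derivative (\<lambda>u. frechet_derivative ?\<beta> (at x) u + F' u)) (at x)"
    by (rule has_derivative_transform_within_open[OF _ op x]) (simp add: rep)
  from frechet_derivative_at[OF this, symmetric] show ?thesis
    by (simp add: blinfun.add_left F'eq)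
qed

text \<open>Cartan calculus gives L_X(i_Y B) - i_Y d(i_X B) = i_[X,Y] B + i_Y i_X dB, and closedness
  removes the last term. The identity is checked in the preferred chart, where the operations are
  defined.\<close>

lemma courant_bracket_gauge:
  assumes B: "two_form M B" and dB: "closed_form M B"
    and e1: "e1 \<in> sections M L" and e2: "e2 \<in> sections M L" and p: "p \<in> points M"
  shows "courant_bracket M (\<lambda>p. gauge B p (e1 p)) (\<lambda>p. gauge B p (e2 p)) p = gauge B p (courant_bracket M e1 e2 p)"
proof -
  define c where "c = chart_at M p"
  define x where "x = snd c p"
  have c: "c \<in> atlas M" and pc: "p \<in> fst c" using manifold_chart_at[OF p] by (auto simp: c_def)
  have x: "x \<in> snd c ` fst c" using pc by (simp add: x_def)
  define X where "X = vf_rep M c (fst \<circ> e1)"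
  define Y where "Y = vf_rep M c (fst \<circ> e2)"
  define X' where "X' = frechet_derivative X (at x)"
  define Y' where "Y' = frechet_derivative Y (at x)"
  define A where "A = frechet_derivative (cov_rep M c (snd \<circ> e1)) (at x)"
  define C where "C = frechet_derivative (cov_rep M c (snd \<circ> e2)) (at x)"
  define b where "b u w = blinfun_apply (blinfun_apply (B p) u) w" for u w
  define D where "D u w = frechet_derivative (\<lambda>y. form2_rep M c B y u w) (at x)" for u w
  note s1 = section_rep_smooth[OF e1 c] and s2 = section_rep_smooth[OF e2 c]
  have "linear (frechet_derivative F (at x))" if "smooth_on (snd c ` fst c) F"
    for F :: "'e \<Rightarrow> 'z::real_normed_vector"
    by (rule bounded_linear.linear[OF has_derivative_bounded_linear[OF smooth_on_has_derivative[OF that x]]])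
  then have lin: "linear X'" "linear Y'" and linA: "linear A"
    unfolding X'_def Y'_def A_def X_def Y_def using s1 s2 by blast+
  have Xp: "X x = fst (e1 p)" and Yp: "Y x = fst (e2 p)"
    by (simp_all add: X_def Y_def vf_rep_def x_def cinv_chart[OF manifold_is_chart[OF c] pc])
      (simp_all add: c_def dchart_chart_at[OF p])
  have bx: "form2_rep M c B x u w = b u w" for u w
    by (simp add: form2_rep_def x_def cinv_chart[OF manifold_is_chart[OF c] pc] b_def)
      (simp add: c_def dchart_inv_chart_at[OF p])
  have fg: "fst \<circ> (\<lambda>p. gauge B p (e p)) = fst \<circ> e" for e :: "'a \<Rightarrow> 'e gvec" by (auto simp: gauge_def)
  have sg: "snd \<circ> (\<lambda>p. gauge B p (e p)) = (\<lambda>p. snd (gauge B p (e p)))" for e :: "'a \<Rightarrow> 'e gvec" by auto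
  have lb: "lie_bracket M (fst \<circ> e1) (fst \<circ> e2) p = Y' (X x) - X' (Y x)"
    by (simp add: lie_bracket_def Let_def c_def[symmetric] x_def[symmetric] X_def[symmetric] Y_def[symmetric]
        X'_def Y'_def Xp Yp)
  \<comment> \<open>dB on the triple (X, Y, v), where \<open>D u w z\<close> is the derivative along
    \<open>z\<close> of the coefficient B(u, w).\<close>
  have dB': "D (Y x) v (X x) - D (X x) v (Y x) + D (X x) (Y x) v = 0" for v
    using dB p by (auto simp: closed_form_def ext_deriv2_def Let_def c_def[symmetric] x_def[symmetric] D_def)
  have skew: "b u w = - b w u" for u w unfolding b_def by (rule two_form_alt(2)[OF B p])
  have bl: "b (u - u') w = b u w - b u' w" for u u' w by (simp add: b_def blinfun.diff_left blinfun.diff_right)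
  define f where "f v = lie_deriv1 M (fst \<circ> e1) (snd \<circ> e2) p v - ext_deriv1 M (snd \<circ> e1) p (fst (e2 p)) v" for v
  have f_fun: "f = (\<lambda>v. lie_deriv1 M (fst \<circ> e1) (snd \<circ> e2) p v - ext_deriv1 M (snd \<circ> e1) p (fst (e2 p)) v)"
    by (rule ext) (rule f_def)
  have f: "f v = blinfun_apply (C (X x)) v + blinfun_apply (snd (e2 p)) (X' v) -
      (blinfun_apply (A (Y x)) v - blinfun_apply (A v) (Y x))" for v
    by (simp add: f_def lie_deriv1_def ext_deriv1_def Let_def c_def[symmetric] x_def[symmetric] X_def[symmetric]
        X'_def A_def C_def Xp Yp)
  have "linear f"
    unfolding f by (rule linearI) (simp_all add: linear_add[OF lin(1)] linear_scale[OF lin(1)] linear_add[OF linA]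
        linear_scale[OF linA] blinfun.add_right blinfun.scaleR_right blinfun.add_left blinfun.scaleR_left algebra_simps)
  then have blf: "bounded_linear f" by (rule linear_bounded_fin_dim[OF manifold_fin_dim])
  have "lie_deriv1 M (fst \<circ> e1) (\<lambda>p. snd (gauge B p (e2 p))) p v -
      ext_deriv1 M (\<lambda>p. snd (gauge B p (e1 p))) p (fst (e2 p)) v = f v + b (Y' (X x) - X' (Y x)) v" for v
  proof -
    have "lie_deriv1 M (fst \<circ> e1) (\<lambda>p. snd (gauge B p (e2 p))) p v =
        blinfun_apply (C (X x)) v + D (Y x) v (X x) + b (Y' (X x)) v +
        (blinfun_apply (snd (e2 p)) (X' v) + b (Y x) (X' v))"
      unfolding lie_deriv1_def Let_def c_def[symmetric] x_def[symmetric]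
        cov_rep_gauge_derivative[OF B e2 c x]
      by (simp add: X_def[symmetric] Y_def[symmetric] X'_def[symmetric] Y'_def[symmetric] C_def[symmetric]
          D_def bx Xp Yp gauge_def blinfun.add_left b_def)
    moreover have "ext_deriv1 M (\<lambda>p. snd (gauge B p (e1 p))) p (fst (e2 p)) v =
        (blinfun_apply (A (Y x)) v + D (X x) v (Y x) + b (X' (Y x)) v) -
        (blinfun_apply (A v) (Y x) + D (X x) (Y x) v + b (X' v) (Y x))"
      unfolding ext_deriv1_def Let_def c_def[symmetric] x_def[symmetric]
        cov_rep_gauge_derivative[OF B e1 c x]
      by (simp add: X_def[symmetric] X'_def[symmetric] A_def[symmetric] D_def bx Xp Yp)
    \<comment> \<open>The three \<open>D\<close> terms add up to dB(X, Y, v), and the two terms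
      containing \<open>X' v\<close> cancel by skew-symmetry. What remains beyond \<open>f v\<close>
      is B([X, Y], v).\<close>
    ultimately show ?thesis using dB'[of v] skew[of "X' v" "Y x"] by (simp add: f bl)
  qed
  then have "Blinfun (\<lambda>v. lie_deriv1 M (fst \<circ> e1) (\<lambda>p. snd (gauge B p (e2 p))) p v -
      ext_deriv1 M (\<lambda>p. snd (gauge B p (e1 p))) p (fst (e2 p)) v) =
      Blinfun (\<lambda>v. f v + b (Y' (X x) - X' (Y x)) v)" by presburger
  also have "\<dots> = Blinfun f + blinfun_apply (B p) (Y' (X x) - X' (Y x))"
    by (rule blinfun_eqI) (simp add: Blinfun_apply bounded_linear_add blf blinfun.bounded_linear_right
        blinfun.add_left b_def)
  finally show ?thesis
    unfolding courant_bracket_def Let_def fg sg lb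
    using f_fun by (simp add: gauge_def lb o_def)
qed

lemma dirac_structure_tau:
  assumes B: "two_form M B" and dB: "closed_form M B" and L: "dirac_structure M L"
  shows "dirac_structure M (tau B ` L)"
  unfolding dirac_structure_def
proof (intro conjI ballI)
  show "subbundle M (tau B ` L)" using L by (intro subbundle_tau B) (simp add: dirac_structure_def)
next
  fix p assume p: "p \<in> points M"
  have L': "{e. \<forall>e'\<in>fibre L p. gpair e e' = 0} = fibre L p" using L p by (simp add: dirac_structure_def)
  have "(\<forall>e'\<in>fibre (tau B ` L) p. gpair e e' = 0) \<longleftrightarrow> e \<in> fibre (tau B ` L) p" for e
  proof -
    let ?e = "gauge (\<lambda>p. - B p) p e"
    have "(\<forall>e'\<in>fibre (tau B ` L) p. gpair e e' = 0) \<longleftrightarrow> (\<forall>e'\<in>fibre L p. gpair ?e e' = 0)"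
      using gpair_gauge[OF B p, of ?e] by (simp add: fibre_tau gauge_inverse)
    also have "\<dots> \<longleftrightarrow> ?e \<in> fibre L p" using L' by blast
    also have "\<dots> \<longleftrightarrow> e \<in> fibre (tau B ` L) p"
      unfolding fibre_tau by (auto simp: gauge_inverse intro: image_eqI[where x = ?e])
    finally show ?thesis .
  qed
  then show "{e. \<forall>e'\<in>fibre (tau B ` L) p. gpair e e' = 0} = fibre (tau B ` L) p" by blast
next
  fix e1 e2 assume e: "e1 \<in> sections M (tau B ` L)" "e2 \<in> sections M (tau B ` L)"
  \<comment> \<open>Gauging by -B returns both sections to \<open>L\<close>, where involutivity is
    known.\<close>
  define d where "d e p = gauge (\<lambda>p. - B p) p (e p)" for e :: "'a \<Rightarrow> 'e gvec" and p
  have "tau (\<lambda>p. - B p) ` tau B ` L = L" by (force simp: tau_inverse image_iff)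
  then have d: "d e1 \<in> sections M L" "d e2 \<in> sections M L"
    using sections_tau[OF two_form_uminus[OF B]] e unfolding d_def by metis+
  have eq: "e1 = (\<lambda>p. gauge B p (d e1 p))" "e2 = (\<lambda>p. gauge B p (d e2 p))" by (simp_all add: d_def gauge_inverse)
  have "courant_bracket M (d e1) (d e2) \<in> sections M L" using L d by (simp add: dirac_structure_def)
  from sections_tau[OF B this] show "courant_bracket M e1 e2 \<in> sections M (tau B ` L)"
    by (rule sections_cong) (subst (2) eq(1), subst (2) eq(2), rule courant_bracket_gauge[OF B dB d, symmetric])
qed

end

section \<open>The tangent groupoid\<close>

text \<open>Freezing one coordinate in the local extension \<open>F\<close> extends the partial map.
  Applied to the multiplication this makes left and right translations smooth on source and target
  fibres at the point concerned.\<close>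

lemma smooth_rep_at_slice:
  fixes M :: "('a, 'e::real_normed_vector) manifold" and N :: "('b, 'f::real_normed_vector) manifold"
  assumes fd: "fin_dim TYPE('e)" "fin_dim TYPE('f)" and M: "charted M" and N: "charted N"
    and f: "smooth_rep_at (prod_manifold M N) S P f (p, q)" and p: "p \<in> points M" and q: "q \<in> points N"
  shows "smooth_rep_at N {y. (p, y) \<in> S} P (\<lambda>y. f (p, y)) q"
    and "smooth_rep_at M {x. (x, q) \<in> S} P (\<lambda>x. f (x, q)) p"
proof -
  let ?c = "chart_at M p" and ?d = "chart_at N q" and ?e = "chart_at P (f (p, q))"
  have ch: "is_chart ?c" "is_chart ?d" using M N p q by (auto simp: charted_def)
  note ca = chartedD[OF M p] chartedD[OF N q]
  obtain T F where T: "open T" "(snd ?c p, snd ?d q) \<in> T" "smooth_on T F"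
    "\<And>x y. (x, y) \<in> S \<Longrightarrow> x \<in> fst ?c \<Longrightarrow> y \<in> fst ?d \<Longrightarrow> (snd ?c x, snd ?d y) \<in> T \<Longrightarrow>
       f (x, y) \<in> fst ?e \<and> snd ?e (f (x, y)) = F (snd ?c x, snd ?d y)" and P: "f (p, q) \<in> points P"
    using f unfolding smooth_rep_at_def chart_at_prod by (elim conjE exE) auto
  let ?T1 = "snd ?d ` fst ?d \<inter> (\<lambda>y. (snd ?c p, y)) -` T"
  have T1: "open ?T1"
    by (rule continuous_open_preimage[OF _ open_chart[OF ch(2)] T(1)]) (intro continuous_intros)
  have "smooth_on ?T1 (\<lambda>y. F (snd ?c p, y))"
    by (rule smooth_on_compose[OF fin_dim_prod[OF fd] T1 smooth_on_Pair[OF T1 smooth_on_const[OF T1] smooth_on_ident[OF T1]] T(3)]) auto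
  then show "smooth_rep_at N {y. (p, y) \<in> S} P (\<lambda>y. f (p, y)) q"
    unfolding smooth_rep_at_def
    using T1 T(2,4) ca P by (intro conjI exI[of _ ?T1] exI[of _ "\<lambda>y. F (snd ?c p, y)"]) auto
  let ?T2 = "snd ?c ` fst ?c \<inter> (\<lambda>x. (x, snd ?d q)) -` T"
  have T2: "open ?T2"
    by (rule continuous_open_preimage[OF _ open_chart[OF ch(1)] T(1)]) (intro continuous_intros)
  have "smooth_on ?T2 (\<lambda>x. F (x, snd ?d q))"
    by (rule smooth_on_compose[OF fin_dim_prod[OF fd] T2 smooth_on_Pair[OF T2 smooth_on_ident[OF T2] smooth_on_const[OF T2]] T(3)]) auto
  then show "smooth_rep_at M {x. (x, q) \<in> S} P (\<lambda>x. f (x, q)) p"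
    unfolding smooth_rep_at_def
    using T2 T(2,4) ca P by (intro conjI exI[of _ ?T2] exI[of _ "\<lambda>x. F (x, snd ?d q)"]) auto
qed

context
  fixes G :: "('g, 'e::real_inner, 'm, 'f::real_inner) groupoid"
  assumes G: "lie_groupoid G"
begin

abbreviation (input) "arr \<equiv> points (arrows G)"
abbreviation (input) "obj \<equiv> points (objects G)"
abbreviation (input) "Ts g v \<equiv> snd (tsrc G (g, v))"
abbreviation (input) "Tt g v \<equiv> snd (ttgt G (g, v))"
abbreviation (input) "Tu x X \<equiv> snd (tunit G (x, X))"
abbreviation (input) "Ti g v \<equiv> snd (tinv G (g, v))"
abbreviation (input) "Tm g v h w \<equiv> snd (tmul G (g, v) (h, w))"

lemma arrows_manifold: "is_manifold (arrows G)" and objects_manifold: "is_manifold (objects G)"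
  using G by (auto simp: lie_groupoid_def)

lemmas arrows_charted = is_manifold_charted[OF arrows_manifold]
lemmas objects_charted = is_manifold_charted[OF objects_manifold]

lemma groupoid_smooth:
  "submersion_on (arrows G) arr (objects G) obj (gsrc G)"
  "submersion_on (arrows G) arr (objects G) obj (gtgt G)"
  "smooth_map_on (prod_manifold (arrows G) (arrows G)) (composable G arr) (arrows G) (\<lambda>(g, h). gmul G g h)"
  "smooth_map_on (objects G) obj (arrows G) (gunit G)"
  "smooth_map_on (arrows G) arr (arrows G) (ginv G)"
  "smooth_map_on (arrows G) arr (objects G) (gsrc G)"
  "smooth_map_on (arrows G) arr (objects G) (gtgt G)"
proof -
  note G' = conjunct2[OF conjunct2[OF G[unfolded lie_groupoid_def]], unfolded lie_groupoid_on_def]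
  show s: "submersion_on (arrows G) arr (objects G) obj (gsrc G)"
    and t: "submersion_on (arrows G) arr (objects G) obj (gtgt G)"
    using G' by simp_all
  show "smooth_map_on (prod_manifold (arrows G) (arrows G)) (composable G arr) (arrows G) (\<lambda>(g, h). gmul G g h)"
    "smooth_map_on (objects G) obj (arrows G) (gunit G)"
    "smooth_map_on (arrows G) arr (arrows G) (ginv G)"
    using G' by simp_all
  show "smooth_map_on (arrows G) arr (objects G) (gsrc G)"
    "smooth_map_on (arrows G) arr (objects G) (gtgt G)"
    using s t by (simp_all add: submersion_on_def)
qed

lemma groupoid_simps:
  "g \<in> arr \<Longrightarrow> gsrc G g \<in> obj"
  "g \<in> arr \<Longrightarrow> gtgt G g \<in> obj"
  "x \<in> obj \<Longrightarrow> gunit G x \<in> arr"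
  "g \<in> arr \<Longrightarrow> ginv G g \<in> arr"
  "x \<in> obj \<Longrightarrow> gsrc G (gunit G x) = x"
  "x \<in> obj \<Longrightarrow> gtgt G (gunit G x) = x"
  "g \<in> arr \<Longrightarrow> gmul G (gunit G (gtgt G g)) g = g"
  "g \<in> arr \<Longrightarrow> gmul G g (gunit G (gsrc G g)) = g"
  "g \<in> arr \<Longrightarrow> gsrc G (ginv G g) = gtgt G g"
  "g \<in> arr \<Longrightarrow> gtgt G (ginv G g) = gsrc G g"
  "g \<in> arr \<Longrightarrow> gmul G g (ginv G g) = gunit G (gtgt G g)"
  "g \<in> arr \<Longrightarrow> gmul G (ginv G g) g = gunit G (gsrc G g)"
  using G smooth_map_on_image[OF groupoid_smooth(6)] smooth_map_on_image[OF groupoid_smooth(7)]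
  unfolding lie_groupoid_def lie_groupoid_on_def by (auto simp: image_subset_iff)

lemma groupoid_mul:
  assumes "g \<in> arr" "h \<in> arr" "gtgt G h = gsrc G g"
  shows "gmul G g h \<in> arr" "gsrc G (gmul G g h) = gsrc G h" "gtgt G (gmul G g h) = gtgt G g"
  using G assms unfolding lie_groupoid_def lie_groupoid_on_def composable_def by auto

lemma groupoid_assoc:
  assumes "g \<in> arr" "h \<in> arr" "k \<in> arr"
    "gtgt G h = gsrc G g" "gtgt G k = gsrc G h"
  shows "gmul G (gmul G g h) k = gmul G g (gmul G h k)"
  using G assms unfolding lie_groupoid_def lie_groupoid_on_def composable_def by auto

lemma groupoid_inv_inv:
  assumes "g \<in> arr"
  shows "ginv G (ginv G g) = g"
proof -
  let ?i = "ginv G g"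
  note s = groupoid_simps
  have "ginv G ?i = gmul G (ginv G ?i) (gmul G ?i g)" using assms s(8)[of "ginv G ?i"] by (simp add: s)
  also have "\<dots> = gmul G (gmul G (ginv G ?i) ?i) g" using assms by (subst groupoid_assoc) (auto simp: s)
  also have "\<dots> = g" using assms by (simp add: s)
  finally show ?thesis .
qed

lemma tsrc_eq: "tsrc G (g, v) = (gsrc G g, Ts g v)" and ttgt_eq: "ttgt G (g, v) = (gtgt G g, Tt g v)"
  by (simp_all add: tsrc_def ttgt_def tmap_on_eq)

section \<open>Curves under the structure maps\<close>

abbreviation (input) "tangentA \<equiv> has_tangent (arrows G)"
abbreviation (input) "tangentO \<equiv> has_tangent (objects G)"

lemma has_tangent_src: "tangentA \<gamma> g v \<Longrightarrow> tangentO (\<lambda>t. gsrc G (\<gamma> t)) (gsrc G g) (Ts g v)"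
  unfolding tsrc_def
  by (rule has_tangent_map[OF arrows_charted objects_charted groupoid_smooth(6)])
    (auto intro: has_tangent_points[OF arrows_charted])

lemma has_tangent_tgt: "tangentA \<gamma> g v \<Longrightarrow> tangentO (\<lambda>t. gtgt G (\<gamma> t)) (gtgt G g) (Tt g v)"
  unfolding ttgt_def
  by (rule has_tangent_map[OF arrows_charted objects_charted groupoid_smooth(7)])
    (auto intro: has_tangent_points[OF arrows_charted])

lemma has_tangent_inv: "tangentA \<gamma> g v \<Longrightarrow> tangentA (\<lambda>t. ginv G (\<gamma> t)) (ginv G g) (Ti g v)"
  unfolding tinv_def
  by (rule has_tangent_map[OF arrows_charted arrows_charted groupoid_smooth(5)])
    (auto intro: has_tangent_points[OF arrows_charted])

lemma has_tangent_unit: "tangentO \<gamma> x X \<Longrightarrow> tangentA (\<lambda>t. gunit G (\<gamma> t)) (gunit G x) (Tu x X)"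
  unfolding tunit_def
  by (rule has_tangent_map[OF objects_charted arrows_charted groupoid_smooth(4)])
    (auto intro: has_tangent_points[OF objects_charted])

lemma has_tangent_mul:
  assumes \<gamma>: "tangentA \<gamma> g v" and \<delta>: "tangentA \<delta> h w" and c: "\<forall>\<^sub>F t in nhds 0. gtgt G (\<delta> t) = gsrc G (\<gamma> t)"
  shows "tangentA (\<lambda>t. gmul G (\<gamma> t) (\<delta> t)) (gmul G g h) (Tm g v h w)"
proof -
  let ?P = "prod_manifold (arrows G) (arrows G)"
  have "has_tangent ?P (\<lambda>t. (\<gamma> t, \<delta> t)) (g, h) (v, w)" using \<gamma> \<delta> by (simp add: has_tangent_prod)
  moreover have "\<forall>\<^sub>F t in nhds 0. (\<gamma> t, \<delta> t) \<in> composable G arr"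
    using c has_tangent_points[OF arrows_charted \<gamma>] has_tangent_points[OF arrows_charted \<delta>]
    by eventually_elim (simp add: composable_def)
  ultimately show ?thesis
    using has_tangent_map[OF charted_prod[OF arrows_charted arrows_charted] arrows_charted groupoid_smooth(3)]
    by (fastforce simp: tmul_def)
qed

lemma has_tangent_lift_src:
  assumes "tangentO x (gsrc G g) (Ts g v)" "g \<in> arr"
  obtains \<gamma> where "tangentA \<gamma> g v" "\<forall>\<^sub>F t in nhds 0. gsrc G (\<gamma> t) = x t"
  using has_tangent_lift[OF arrows_manifold objects_manifold groupoid_smooth(1), of x g v] assms
  unfolding tsrc_def by blast

lemma has_tangent_lift_tgt:
  assumes "tangentO x (gtgt G g) (Tt g v)" "g \<in> arr"
  obtains \<gamma> where "tangentA \<gamma> g v" "\<forall>\<^sub>F t in nhds 0. gtgt G (\<gamma> t) = x t"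
  using has_tangent_lift[OF arrows_manifold objects_manifold groupoid_smooth(2), of x g v] assms
  unfolding ttgt_def by blast

definition tcomposable :: "'g \<Rightarrow> 'e \<Rightarrow> 'g \<Rightarrow> 'e \<Rightarrow> bool" where
  "tcomposable g v h w \<longleftrightarrow> g \<in> arr \<and> h \<in> arr \<and> gtgt G h = gsrc G g \<and> Tt h w = Ts g v"

lemma tangent_exists:
  assumes "g \<in> arr"
  obtains \<gamma> where "tangentA \<gamma> g v"
  using has_tangent_exists[OF arrows_charted assms] by blast

text \<open>The target curve of \<open>\<delta>\<close> has velocity Tt w = Ts v, so it lifts
  through the source map to a curve whose velocity is exactly \<open>v\<close>.\<close>

lemma tcomposable_curves:
  assumes "tcomposable g v h w" "tangentA \<delta> h w"
  obtains \<gamma> where "tangentA \<gamma> g v" "\<forall>\<^sub>F t in nhds 0. gtgt G (\<delta> t) = gsrc G (\<gamma> t)"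
proof -
  have "tangentO (\<lambda>t. gtgt G (\<delta> t)) (gsrc G g) (Ts g v)"
    using has_tangent_tgt[OF assms(2)] assms(1) by (simp add: tcomposable_def)
  then obtain \<gamma> where \<gamma>: "tangentA \<gamma> g v" "\<forall>\<^sub>F t in nhds 0. gsrc G (\<gamma> t) = gtgt G (\<delta> t)"
    by (rule has_tangent_lift_src) (use assms(1) in \<open>simp add: tcomposable_def\<close>)
  have "\<forall>\<^sub>F t in nhds 0. gtgt G (\<delta> t) = gsrc G (\<gamma> t)" using \<gamma>(2) by eventually_elim simp
  with \<gamma>(1) show thesis by (rule that)
qed

lemma linear_tmap:
  fixes M :: "('a, 'x::real_normed_vector) manifold" and N :: "('b, 'y::real_normed_vector) manifold"
  assumes "charted M" "charted N" "smooth_map_on M S N f" "p \<in> S" "p \<in> points M"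
  shows "linear (\<lambda>v. snd (tmap_on M S N f (p, v)))"
  using tmap_on_has_derivative[OF assms(1) smooth_map_on_rep_at[OF assms] assms(4,5)]
  by (rule bounded_linear.linear[OF has_derivative_bounded_linear])

lemma linear_Ts: "g \<in> arr \<Longrightarrow> linear (Ts g)"
  unfolding tsrc_def by (rule linear_tmap[OF arrows_charted objects_charted groupoid_smooth(6)])

lemma linear_Tt: "g \<in> arr \<Longrightarrow> linear (Tt g)"
  unfolding ttgt_def by (rule linear_tmap[OF arrows_charted objects_charted groupoid_smooth(7)])

lemma linear_Tu: "x \<in> obj \<Longrightarrow> linear (Tu x)"
  unfolding tunit_def by (rule linear_tmap[OF objects_charted arrows_charted groupoid_smooth(4)])

lemma linear_Ti: "g \<in> arr \<Longrightarrow> linear (Ti g)"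
  unfolding tinv_def by (rule linear_tmap[OF arrows_charted arrows_charted groupoid_smooth(5)])

lemma linear_Tm:
  assumes "g \<in> arr" "h \<in> arr" "gtgt G h = gsrc G g"
  shows "linear (\<lambda>(v, w). Tm g v h w)"
  using linear_tmap[OF charted_prod[OF arrows_charted arrows_charted] arrows_charted groupoid_smooth(3), of "(g, h)"] assms
  by (simp add: tmul_def composable_def points_prod split_def)

section \<open>Differentiated groupoid identities\<close>

lemma
  assumes "tcomposable g v h w"
  shows Ts_mul: "Ts (gmul G g h) (Tm g v h w) = Ts h w"
    and Tt_mul: "Tt (gmul G g h) (Tm g v h w) = Tt g v"
proof -
  have p: "g \<in> arr" "h \<in> arr" "gtgt G h = gsrc G g"
    using assms by (auto simp: tcomposable_def)
  obtain \<delta> where \<delta>: "tangentA \<delta> h w" by (rule tangent_exists[OF p(2)])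
  obtain \<gamma> where \<gamma>: "tangentA \<gamma> g v" and c: "\<forall>\<^sub>F t in nhds 0. gtgt G (\<delta> t) = gsrc G (\<gamma> t)"
    by (rule tcomposable_curves[OF assms \<delta>])
  note m = has_tangent_mul[OF \<gamma> \<delta> c]
  note ev = has_tangent_points[OF arrows_charted \<gamma>] has_tangent_points[OF arrows_charted \<delta>] c
  have 1: "\<forall>\<^sub>F t in nhds 0. gsrc G (gmul G (\<gamma> t) (\<delta> t)) = gsrc G (\<delta> t)"
    using ev by eventually_elim (rule groupoid_mul)
  have 2: "\<forall>\<^sub>F t in nhds 0. gtgt G (gmul G (\<gamma> t) (\<delta> t)) = gtgt G (\<gamma> t)"
    using ev by eventually_elim (rule groupoid_mul)
  show "Ts (gmul G g h) (Tm g v h w) = Ts h w"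
    using has_tangent_unique[OF has_tangent_cong[OF has_tangent_src[OF m] 1]] has_tangent_src[OF \<delta>] groupoid_mul[OF p] by simp
  show "Tt (gmul G g h) (Tm g v h w) = Tt g v"
    using has_tangent_unique[OF has_tangent_cong[OF has_tangent_tgt[OF m] 2]] has_tangent_tgt[OF \<gamma>] groupoid_mul[OF p] by simp
qed

lemma
  assumes x: "x \<in> obj"
  shows Ts_unit: "Ts (gunit G x) (Tu x X) = X" and Tt_unit: "Tt (gunit G x) (Tu x X) = X"
proof -
  obtain \<gamma> where \<gamma>: "tangentO \<gamma> x X" using has_tangent_exists[OF objects_charted x] by blast
  note u = has_tangent_unit[OF \<gamma>] and ev = has_tangent_points[OF objects_charted \<gamma>]
  have 1: "\<forall>\<^sub>F t in nhds 0. gsrc G (gunit G (\<gamma> t)) = \<gamma> t" using ev by eventually_elim (rule groupoid_simps)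
  have 2: "\<forall>\<^sub>F t in nhds 0. gtgt G (gunit G (\<gamma> t)) = \<gamma> t" using ev by eventually_elim (rule groupoid_simps)
  show "Ts (gunit G x) (Tu x X) = X"
    using has_tangent_unique[OF has_tangent_cong[OF has_tangent_src[OF u] 1]] \<gamma> groupoid_simps(5)[OF x] by simp
  show "Tt (gunit G x) (Tu x X) = X"
    using has_tangent_unique[OF has_tangent_cong[OF has_tangent_tgt[OF u] 2]] \<gamma> groupoid_simps(6)[OF x] by simp
qed

text \<open>All curves here are functions of a single \<open>\<gamma>\<close>, so composability
  comes from the groupoid axioms and no curve has to be lifted.\<close>

lemma
  assumes g: "g \<in> arr"
  shows Tm_unit_left: "Tm (gunit G (gtgt G g)) (Tu (gtgt G g) (Tt g v)) g v = v"
    and Tm_unit_right: "Tm g v (gunit G (gsrc G g)) (Tu (gsrc G g) (Ts g v)) = v"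
    and Ts_inv: "Ts (ginv G g) (Ti g v) = Tt g v"
    and Tt_inv: "Tt (ginv G g) (Ti g v) = Ts g v"
    and Tm_inv_right: "Tm g v (ginv G g) (Ti g v) = Tu (gtgt G g) (Tt g v)"
    and Tm_inv_left: "Tm (ginv G g) (Ti g v) g v = Tu (gsrc G g) (Ts g v)"
    and Ti_inv: "Ti (ginv G g) (Ti g v) = v"
proof -
  obtain \<gamma> where \<gamma>: "tangentA \<gamma> g v" by (rule tangent_exists[OF g])
  note ev = has_tangent_points[OF arrows_charted \<gamma>]
  note gs = groupoid_simps and s = has_tangent_src[OF \<gamma>] and t = has_tangent_tgt[OF \<gamma>] and i = has_tangent_inv[OF \<gamma>]
  have us: "\<forall>\<^sub>F t in nhds 0. gtgt G (gunit G (gsrc G (\<gamma> t))) = gsrc G (\<gamma> t)"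
    and ut: "\<forall>\<^sub>F t in nhds 0. gtgt G (\<gamma> t) = gsrc G (gunit G (gtgt G (\<gamma> t)))"
    and ist: "\<forall>\<^sub>F t in nhds 0. gtgt G (ginv G (\<gamma> t)) = gsrc G (\<gamma> t)"
    and it: "\<forall>\<^sub>F t in nhds 0. gtgt G (\<gamma> t) = gsrc G (ginv G (\<gamma> t))"
    and it': "\<forall>\<^sub>F t in nhds 0. gsrc G (ginv G (\<gamma> t)) = gtgt G (\<gamma> t)"
    and ul: "\<forall>\<^sub>F t in nhds 0. gmul G (gunit G (gtgt G (\<gamma> t))) (\<gamma> t) = \<gamma> t"
    and ur: "\<forall>\<^sub>F t in nhds 0. gmul G (\<gamma> t) (gunit G (gsrc G (\<gamma> t))) = \<gamma> t"
    and ir: "\<forall>\<^sub>F t in nhds 0. gmul G (\<gamma> t) (ginv G (\<gamma> t)) = gunit G (gtgt G (\<gamma> t))"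
    and il: "\<forall>\<^sub>F t in nhds 0. gmul G (ginv G (\<gamma> t)) (\<gamma> t) = gunit G (gsrc G (\<gamma> t))"
    and ii: "\<forall>\<^sub>F t in nhds 0. ginv G (ginv G (\<gamma> t)) = \<gamma> t"
    using ev by (eventually_elim, simp add: gs groupoid_inv_inv)+
  show "Tm (gunit G (gtgt G g)) (Tu (gtgt G g) (Tt g v)) g v = v"
    using has_tangent_unique[OF has_tangent_cong[OF has_tangent_mul[OF has_tangent_unit[OF t] \<gamma> ut] ul]] \<gamma>
    by (simp add: gs g)
  show "Tm g v (gunit G (gsrc G g)) (Tu (gsrc G g) (Ts g v)) = v"
    using has_tangent_unique[OF has_tangent_cong[OF has_tangent_mul[OF \<gamma> has_tangent_unit[OF s] us] ur]] \<gamma>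
    by (simp add: gs g)
  show "Ts (ginv G g) (Ti g v) = Tt g v"
    using has_tangent_unique[OF has_tangent_cong[OF has_tangent_src[OF i] it']] t by (simp add: gs g)
  show "Tt (ginv G g) (Ti g v) = Ts g v"
    using has_tangent_unique[OF has_tangent_cong[OF has_tangent_tgt[OF i] ist]] s by (simp add: gs g)
  show "Tm g v (ginv G g) (Ti g v) = Tu (gtgt G g) (Tt g v)"
    using has_tangent_unique[OF has_tangent_cong[OF has_tangent_mul[OF \<gamma> i ist] ir]] has_tangent_unit[OF t]
    by (simp add: gs g)
  show "Tm (ginv G g) (Ti g v) g v = Tu (gsrc G g) (Ts g v)"
    using has_tangent_unique[OF has_tangent_cong[OF has_tangent_mul[OF i \<gamma> it] il]] has_tangent_unit[OF s]
    by (simp add: gs g)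
  show "Ti (ginv G g) (Ti g v) = v"
    using has_tangent_unique[OF has_tangent_cong[OF has_tangent_inv[OF i] ii]] \<gamma> by (simp add: groupoid_inv_inv g)
qed

text \<open>The composable triple of curves is built from the right: \<open>\<kappa>\<close> is
  arbitrary, \<open>\<delta>\<close> is lifted to match its target, and \<open>\<gamma>\<close> to
  match the target of \<open>\<delta>\<close>.\<close>

lemma Tm_assoc:
  assumes gh: "tcomposable g u h v" and hk: "tcomposable h v k w"
  shows "Tm (gmul G g h) (Tm g u h v) k w = Tm g u (gmul G h k) (Tm h v k w)"
proof -
  have p: "g \<in> arr" "h \<in> arr" "k \<in> arr"
    "gtgt G h = gsrc G g" "gtgt G k = gsrc G h"
    using gh hk by (auto simp: tcomposable_def)
  obtain \<kappa> where \<kappa>: "tangentA \<kappa> k w" by (rule tangent_exists[OF p(3)])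
  obtain \<delta> where \<delta>: "tangentA \<delta> h v" and ck: "\<forall>\<^sub>F t in nhds 0. gtgt G (\<kappa> t) = gsrc G (\<delta> t)"
    by (rule tcomposable_curves[OF hk \<kappa>])
  obtain \<gamma> where \<gamma>: "tangentA \<gamma> g u" and cg: "\<forall>\<^sub>F t in nhds 0. gtgt G (\<delta> t) = gsrc G (\<gamma> t)"
    by (rule tcomposable_curves[OF gh \<delta>])
  note ev = has_tangent_points[OF arrows_charted \<gamma>] has_tangent_points[OF arrows_charted \<delta>]
    has_tangent_points[OF arrows_charted \<kappa>] cg ck
  have 1: "\<forall>\<^sub>F t in nhds 0. gtgt G (\<kappa> t) = gsrc G (gmul G (\<gamma> t) (\<delta> t))"
    using ev by eventually_elim (simp add: groupoid_mul)
  have 2: "\<forall>\<^sub>F t in nhds 0. gtgt G (gmul G (\<delta> t) (\<kappa> t)) = gsrc G (\<gamma> t)"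
    using ev by eventually_elim (simp add: groupoid_mul)
  have 3: "\<forall>\<^sub>F t in nhds 0. gmul G (gmul G (\<gamma> t) (\<delta> t)) (\<kappa> t) = gmul G (\<gamma> t) (gmul G (\<delta> t) (\<kappa> t))"
    using ev by eventually_elim (rule groupoid_assoc)
  have "tangentA (\<lambda>t. gmul G (gmul G (\<gamma> t) (\<delta> t)) (\<kappa> t)) (gmul G (gmul G g h) k) (Tm (gmul G g h) (Tm g u h v) k w)"
    by (rule has_tangent_mul[OF has_tangent_mul[OF \<gamma> \<delta> cg] \<kappa> 1])
  from has_tangent_cong[OF this 3]
  have a: "tangentA (\<lambda>t. gmul G (\<gamma> t) (gmul G (\<delta> t) (\<kappa> t))) (gmul G g (gmul G h k)) (Tm (gmul G g h) (Tm g u h v) k w)"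
    by (simp add: groupoid_assoc[OF p])
  have b: "tangentA (\<lambda>t. gmul G (\<gamma> t) (gmul G (\<delta> t) (\<kappa> t))) (gmul G g (gmul G h k)) (Tm g u (gmul G h k) (Tm h v k w))"
    by (rule has_tangent_mul[OF \<gamma> has_tangent_mul[OF \<delta> \<kappa> ck] 2])
  show ?thesis by (rule has_tangent_unique[OF a b])
qed

text \<open>A vector killed by Tt is the velocity of a curve inside a target fibre, found by lifting
  the constant curve. Multiplying this curve by the constant arrow exhibits translation as a product
  with a zero vector, the form to which multiplicativity of B applies.\<close>

lemma tleft_eq:
  assumes g: "g \<in> arr" and a: "Tt (gunit G (gsrc G g)) a = 0"
  shows "tleft G g a = Tm g 0 (gunit G (gsrc G g)) a"
proof -
  let ?x = "gsrc G g" and ?A = "arrows G"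
  let ?S = "{h \<in> points ?A. gtgt G h = ?x}" and ?C = "composable G (points ?A)"
  note gs = groupoid_simps
  have x: "?x \<in> obj" and u: "gunit G ?x \<in> points ?A" using g by (auto simp: gs)
  have C: "(g, gunit G ?x) \<in> ?C" using g by (simp add: composable_def gs)
  have S: "{y. (g, y) \<in> ?C} = ?S" using g by (auto simp: composable_def)
  have fd: "fin_dim TYPE('e)" by (rule manifold_fin_dim[OF arrows_manifold])
  have "smooth_rep_at (prod_manifold ?A ?A) ?C ?A (\<lambda>(g, h). gmul G g h) (g, gunit G ?x)"
    by (rule smooth_map_on_rep_at[OF charted_prod[OF arrows_charted arrows_charted] arrows_charted groupoid_smooth(3) C])
      (simp add: points_prod g u)
  from smooth_rep_at_slice(1)[OF fd fd arrows_charted arrows_charted this g u]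
  have rep: "smooth_rep_at ?A ?S ?A (\<lambda>h. gmul G g h) (gunit G ?x)" by (simp add: S)
  have "tangentO (\<lambda>t. ?x) (gtgt G (gunit G ?x)) (Tt (gunit G ?x) a)"
    using has_tangent_const[OF objects_charted x] by (simp add: a gs x)
  then obtain \<gamma> where \<gamma>: "tangentA \<gamma> (gunit G ?x) a" "\<forall>\<^sub>F t in nhds 0. gtgt G (\<gamma> t) = ?x"
    by (rule has_tangent_lift_tgt[OF _ u])
  have "\<forall>\<^sub>F t in nhds 0. \<gamma> t \<in> ?S"
    using \<gamma>(2) has_tangent_points[OF arrows_charted \<gamma>(1)] by eventually_elim simp
  from has_tangent_map_rep[OF arrows_charted rep \<gamma>(1) this]
  have "tangentA (\<lambda>t. gmul G g (\<gamma> t)) (gmul G g (gunit G ?x)) (tleft G g a)" by (simp add: tleft_def)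
  moreover have "tangentA (\<lambda>t. gmul G g (\<gamma> t)) (gmul G g (gunit G ?x)) (Tm g 0 (gunit G ?x) a)"
    by (rule has_tangent_mul[OF has_tangent_const[OF arrows_charted g] \<gamma>])
  ultimately show ?thesis by (rule has_tangent_unique)
qed

lemma tright_eq:
  assumes g: "g \<in> arr" and b: "Ts (gunit G (gtgt G g)) b = 0"
  shows "tright G g b = Tm (gunit G (gtgt G g)) b g 0"
proof -
  let ?x = "gtgt G g" and ?A = "arrows G"
  let ?S = "{h \<in> points ?A. gsrc G h = ?x}" and ?C = "composable G (points ?A)"
  note gs = groupoid_simps
  have x: "?x \<in> obj" and u: "gunit G ?x \<in> points ?A" using g by (auto simp: gs)
  have C: "(gunit G ?x, g) \<in> ?C" using g by (simp add: composable_def gs)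
  have S: "{y. (y, g) \<in> ?C} = ?S" using g by (auto simp: composable_def)
  have fd: "fin_dim TYPE('e)" by (rule manifold_fin_dim[OF arrows_manifold])
  have "smooth_rep_at (prod_manifold ?A ?A) ?C ?A (\<lambda>(g, h). gmul G g h) (gunit G ?x, g)"
    by (rule smooth_map_on_rep_at[OF charted_prod[OF arrows_charted arrows_charted] arrows_charted groupoid_smooth(3) C])
      (simp add: points_prod g u)
  from smooth_rep_at_slice(2)[OF fd fd arrows_charted arrows_charted this u g]
  have rep: "smooth_rep_at ?A ?S ?A (\<lambda>h. gmul G h g) (gunit G ?x)" by (simp add: S)
  have "tangentO (\<lambda>t. ?x) (gsrc G (gunit G ?x)) (Ts (gunit G ?x) b)"
    using has_tangent_const[OF objects_charted x] by (simp add: b gs x)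
  then obtain \<gamma> where \<gamma>: "tangentA \<gamma> (gunit G ?x) b" "\<forall>\<^sub>F t in nhds 0. gsrc G (\<gamma> t) = ?x"
    by (rule has_tangent_lift_src[OF _ u])
  have "\<forall>\<^sub>F t in nhds 0. \<gamma> t \<in> ?S"
    using \<gamma>(2) has_tangent_points[OF arrows_charted \<gamma>(1)] by eventually_elim simp
  from has_tangent_map_rep[OF arrows_charted rep \<gamma>(1) this]
  have "tangentA (\<lambda>t. gmul G (\<gamma> t) g) (gmul G (gunit G ?x) g) (tright G g b)" by (simp add: tright_def)
  moreover have c: "\<forall>\<^sub>F t in nhds 0. ?x = gsrc G (\<gamma> t)" using \<gamma>(2) by eventually_elim simp
  have "tangentA (\<lambda>t. gmul G (\<gamma> t) g) (gmul G (gunit G ?x) g) (Tm (gunit G ?x) b g 0)"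
    by (rule has_tangent_mul[OF \<gamma>(1) has_tangent_const[OF arrows_charted g] c])
  ultimately show ?thesis by (rule has_tangent_unique)
qed

lemma minus_anchor_eq:
  "x \<in> obj \<Longrightarrow> minus_anchor G x a = a - Tu x (Tt (gunit G x) a)"
  unfolding minus_anchor_def by (subst ttgt_eq) (simp add: groupoid_simps)

lemma Tt_minus_anchor:
  assumes "x \<in> obj"
  shows "Tt (gunit G x) (minus_anchor G x a) = 0"
  using assms by (simp add: minus_anchor_eq linear_diff[OF linear_Tt] groupoid_simps Tt_unit)

section \<open>The multiplication of the cotangent groupoid\<close>

text \<open>The source submersion provides some \<open>w\<close> over \<open>h\<close> with the same
  source as \<open>z\<close>; then \<open>v\<close> is the product of \<open>z\<close> with the
  inverse of \<open>w\<close>.\<close>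

lemma Tm_surj:
  assumes g: "g \<in> arr" and h: "h \<in> arr" and c: "gtgt G h = gsrc G g"
  obtains v w where "tcomposable g v h w" "Tm g v h w = z"
proof -
  note gs = groupoid_simps and gm = groupoid_mul[OF g h c]
  let ?gh = "gmul G g h"
  obtain w where w: "Ts h w = Ts ?gh z"
  proof -
    have "Ts ?gh z \<in> subtangent (objects G) obj (gsrc G h)"
      by (simp add: subtangent_points[OF objects_manifold] gs h)
    then obtain w where "tmap (arrows G) (objects G) (gsrc G) (h, w) = (gsrc G h, Ts ?gh z)"
      using groupoid_smooth(1) h unfolding submersion_on_def by blast
    then show thesis by (intro that[of w]) (simp add: tsrc_def)
  qed
  let ?i = "ginv G h" and ?wi = "Ti h w"
  have c1: "tcomposable ?gh z ?i ?wi"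
    using gm h w by (simp add: tcomposable_def gs Tt_inv)
  have c2: "tcomposable ?i ?wi h w"
    using h by (simp add: tcomposable_def gs Ts_inv)
  have e: "gmul G ?gh ?i = g"
    using g h c by (simp add: groupoid_assoc gs)
  let ?v = "Tm ?gh z ?i ?wi"
  have "Ts g ?v = Ts ?i ?wi" using Ts_mul[OF c1] e by simp
  then have comp: "tcomposable g ?v h w" using g h c by (simp add: tcomposable_def Ts_inv)
  have "Tm g ?v h w = Tm ?gh z (gmul G ?i h) (Tm ?i ?wi h w)"
    using Tm_assoc[OF c1 c2] e by simp
  also have "\<dots> = Tm ?gh z (gunit G (gsrc G ?gh)) (Tu (gsrc G ?gh) (Ts ?gh z))"
    using gm h w by (simp add: gs Tm_inv_left)
  also have "\<dots> = z" by (rule Tm_unit_right[OF gm(1)])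
  finally show thesis using comp by (rule that[rotated])
qed

lemma Tm_zero:
  assumes "g \<in> arr" "h \<in> arr" "gtgt G h = gsrc G g"
  shows "Tm g 0 h 0 = 0"
  using linear_0[OF linear_Tm[OF assms]] by (simp add: zero_prod_def)

lemma Tm_add:
  assumes "g \<in> arr" "h \<in> arr" "gtgt G h = gsrc G g"
  shows "Tm g (v + v') h (w + w') = Tm g v h w + Tm g v' h w'"
  using linear_add[OF linear_Tm[OF assms], of "(v, w)" "(v', w')"] by simp

text \<open>By linearity the pair splits as (a, T1(Ts a)) + (0, b - T1(Ts a)), and in each summand
  one factor is a unit of TG.\<close>

lemma Tm_units:
  assumes x: "x \<in> obj" and c: "Tt (gunit G x) b = Ts (gunit G x) a"
  shows "Tm (gunit G x) a (gunit G x) b = a + b - Tu x (Ts (gunit G x) a)"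
proof -
  note gs = groupoid_simps
  let ?u = "gunit G x"
  have u: "?u \<in> arr" using x by (rule gs)
  have cu: "gtgt G ?u = gsrc G ?u" using x by (simp add: gs)
  let ?z = "b - Tu x (Ts ?u a)"
  have z: "Tt ?u ?z = 0" using c x by (simp add: linear_diff[OF linear_Tt[OF u]] Tt_unit)
  have "Tm ?u a ?u (Tu x (Ts ?u a)) = a" using Tm_unit_right[OF u, of a] x by (simp add: gs)
  moreover have "Tm ?u 0 ?u ?z = ?z"
    using Tm_unit_left[OF u, of ?z] x linear_0[OF linear_Tu[OF x]] by (simp add: gs z)
  ultimately show ?thesis using Tm_add[OF u u cu, of a 0 "Tu x (Ts ?u a)" ?z] by simp
qed

text \<open>If the product vanishes, then \<open>w\<close> is the right translate of some algebroid
  element \<open>b\<close>, and \<open>v\<close> is minus the left translate of b - Tt b. The claim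
  thus compares \<open>cosrc\<close> and \<open>cotgt\<close> at the single vector \<open>b\<close>,
  which also explains the anchor correction in the cotangent source.\<close>

lemma Tm_kernel:
  assumes c: "tcomposable g v h w" and k: "Tm g v h w = 0" and \<xi>: "cosrc G g \<xi> = cotgt G h \<eta>"
  shows "blinfun_apply \<xi> v + blinfun_apply \<eta> w = 0"
proof -
  have p: "g \<in> arr" "h \<in> arr" "gtgt G h = gsrc G g" and vw: "Tt h w = Ts g v"
    using c by (auto simp: tcomposable_def)
  note gs = groupoid_simps and gm = groupoid_mul[OF p]
  let ?x = "gsrc G g"
  let ?u = "gunit G ?x"
  have x: "?x \<in> obj" and u: "?u \<in> arr" using p by (auto simp: gs)
  note lin0 = linear_0[OF linear_Ts] linear_0[OF linear_Tt]
  let ?gi = "ginv G g" and ?hi = "ginv G h"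
  have gi: "?gi \<in> arr" "?hi \<in> arr" using p by (auto simp: gs)
  have Tsw: "Ts h w = 0" using Ts_mul[OF c] k lin0(1)[OF gm(1)] by simp
  have Ttv: "Tt g v = 0" using Tt_mul[OF c] k lin0(2)[OF gm(1)] by simp
  \<comment> \<open>Zero vectors over the inverse arrows move \<open>w\<close> and \<open>v\<close>
    to the unit at \<open>?x\<close>. These products exist because a vanishing product of
    \<open>v\<close> and \<open>w\<close> forces Ts w = 0 and Tt v = 0.\<close>
  define b where "b = Tm h w ?hi 0"
  define a where "a = Tm ?gi 0 g v"
  have cb: "tcomposable h w ?hi 0" using p gi Tsw by (simp add: tcomposable_def gs lin0)
  have ca: "tcomposable ?gi 0 g v" using p gi Ttv by (simp add: tcomposable_def gs lin0)
  have ehh: "gmul G h ?hi = ?u" and egg: "gmul G ?gi g = ?u" using p by (auto simp: gs)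
  have Tsb: "Ts ?u b = 0" and Ttb: "Tt ?u b = Tt h w"
    using Ts_mul[OF cb] Tt_mul[OF cb] gi by (simp_all add: b_def ehh lin0)
  have Tta: "Tt ?u a = 0" and Tsa: "Ts ?u a = Ts g v"
    using Ts_mul[OF ca] Tt_mul[OF ca] gi by (simp_all add: a_def egg lin0)
  have chh: "tcomposable ?hi 0 h 0" using p gi by (simp add: tcomposable_def gs lin0)
  have cgg: "tcomposable g 0 ?gi 0" using p gi by (simp add: tcomposable_def gs lin0)
  have "Tm ?u b h 0 = Tm h w (gmul G ?hi h) (Tm ?hi 0 h 0)"
    using Tm_assoc[OF cb chh] by (simp add: b_def ehh)
  also have "\<dots> = w"
    using Tm_unit_right[OF p(2), of w] Tm_zero[OF gi(2) p(2)] p linear_0[OF linear_Tu] by (simp add: gs Tsw)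
  finally have bw: "Tm ?u b h 0 = w" .
  have "Tm g 0 ?u a = Tm (gmul G g ?gi) (Tm g 0 ?gi 0) g v"
    using Tm_assoc[OF cgg ca] by (simp add: a_def egg)
  also have "\<dots> = v"
    using Tm_unit_left[OF p(1), of v] Tm_zero[OF p(1) gi(1)] p linear_0[OF linear_Tu] by (simp add: gs Ttv)
  finally have av: "Tm g 0 ?u a = v" .
  \<comment> \<open>By associativity this product is the vanishing product of \<open>v\<close> and
    \<open>w\<close>, multiplied by zero vectors on both sides.\<close>
  have "Tm ?u a ?u b = 0"
  proof -
    have e1: "gmul G g ?u = g" "gmul G ?u h = h" using p gs(7)[OF p(2)] by (auto simp: gs)
    have c2: "tcomposable ?u a h w" using p u x vw Tsa by (simp add: tcomposable_def gs)
    have "Tm ?u a h w = Tm ?gi 0 (gmul G g h) (Tm g v h w)"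
      using Tm_assoc[OF ca c] by (simp add: a_def egg)
    then have z: "Tm ?u a h w = 0" using Tm_zero[OF gi(1) gm(1)] p gm(3) k by (simp add: gs)
    have "Tm ?u a ?u b = Tm (gmul G ?u h) (Tm ?u a h w) ?hi 0"
      using Tm_assoc[OF c2 cb] by (simp add: b_def ehh)
    also have "\<dots> = 0" using Tm_zero[OF p(2) gi(2)] p by (simp add: z e1 gs)
    finally show ?thesis .
  qed
  moreover have "Tt ?u b = Ts ?u a" using Ttb Tsa vw by simp
  \<comment> \<open>Since Ts a = Tt b, \<open>Tm_units\<close> reads the vanishing product as a + b
    - T1(Tt b) = 0.\<close>
  ultimately have "a = - minus_anchor G ?x b"
    using Tm_units[OF x, of b a] by (simp add: minus_anchor_eq[OF x] algebra_simps)
  then have "v = Tm g 0 ?u (- minus_anchor G ?x b)" using av by simp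
  also have "\<dots> = - Tm g 0 ?u (minus_anchor G ?x b)"
    using linear_neg[OF linear_Tm[OF p(1) u], of "(0, minus_anchor G ?x b)"] x by (simp add: gs)
  finally have v: "v = - tleft G g (minus_anchor G ?x b)"
    using tleft_eq[OF p(1) Tt_minus_anchor[OF x]] by simp
  have w: "w = tright G h b" using tright_eq[OF p(2)] bw Tsb p(3) by simp
  have "b \<in> algebroid_fibre G ?x" using Tsb by (simp add: algebroid_fibre_def)
  then have "blinfun_apply \<xi> (tleft G g (minus_anchor G ?x b)) = blinfun_apply \<eta> (tright G h b)"
    using fun_cong[OF \<xi>, of b] p(3) by (simp add: cosrc_def cotgt_def)
  then show ?thesis using v w by (metis add.left_inverse blinfun.minus_right)
qed

lemma tcomposable_iff:
  assumes "g \<in> arr" "h \<in> arr" "gtgt G h = gsrc G g"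
  shows "ttgt G (h, w) = tsrc G (g, v) \<longleftrightarrow> tcomposable g v h w"
  using assms tsrc_eq[of g v] ttgt_eq[of h w] unfolding tcomposable_def by (metis prod.inject)

text \<open>\<open>Tm_surj\<close> leaves at most one covector with the defining property, so
  exhibiting one evaluates the definite description.\<close>

lemma comul_eqI:
  assumes p: "g \<in> arr" "h \<in> arr" "gtgt G h = gsrc G g"
    and \<zeta>: "\<And>v w. tcomposable g v h w \<Longrightarrow> blinfun_apply \<zeta> (Tm g v h w) = blinfun_apply \<xi> v + blinfun_apply \<eta> w"
  shows "comul G (g, \<xi>) (h, \<eta>) = \<zeta>"
  unfolding comul_def prod.case tcomposable_iff[OF p]
proof (rule the_equality)
  show "\<forall>v w. tcomposable g v h w \<longrightarrow> blinfun_apply \<zeta> (Tm g v h w) = blinfun_apply \<xi> v + blinfun_apply \<eta> w"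
    using \<zeta> by blast
  fix \<zeta>' assume \<zeta>': "\<forall>v w. tcomposable g v h w \<longrightarrow> blinfun_apply \<zeta>' (Tm g v h w) = blinfun_apply \<xi> v + blinfun_apply \<eta> w"
  show "\<zeta>' = \<zeta>"
  proof (rule blinfun_eqI)
    fix z
    obtain v w where "tcomposable g v h w" "Tm g v h w = z" by (rule Tm_surj[OF p])
    then show "blinfun_apply \<zeta>' z = blinfun_apply \<zeta> z" using \<zeta> \<zeta>' by metis
  qed
qed

text \<open>By \<open>Tm_kernel\<close>, the sum of \<open>\<xi>\<close> and \<open>\<eta>\<close> descends along the surjection \<open>Tm\<close>; a linear right inverse of \<open>Tm\<close> yields the descended covector.\<close>

lemma comul_apply:
  assumes p: "g \<in> arr" "h \<in> arr" "gtgt G h = gsrc G g"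
    and \<xi>: "cosrc G g \<xi> = cotgt G h \<eta>" and c: "tcomposable g v h w"
  shows "blinfun_apply (comul G (g, \<xi>) (h, \<eta>)) (Tm g v h w) = blinfun_apply \<xi> v + blinfun_apply \<eta> w"
proof -
  define V where "V = {(v, w). tcomposable g v h w}"
  define m where "m = (\<lambda>(v, w). Tm g v h w)"
  have linm: "linear m" unfolding m_def by (rule linear_Tm[OF p])
  have V: "subspace V"
    using p by (auto simp: subspace_def V_def tcomposable_def zero_prod_def
        linear_0[OF linear_Ts] linear_add[OF linear_Ts] linear_scale[OF linear_Ts]
        linear_0[OF linear_Tt] linear_add[OF linear_Tt] linear_scale[OF linear_Tt])
  obtain r where r: "r ` UNIV \<subseteq> V" "linear r" "\<forall>z\<in>m ` V. m (r z) = z"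
    using linear_exists_right_inverse_on[OF linm V] by blast
  have mr: "m (r z) = z" for z
  proof -
    obtain v w where "tcomposable g v h w" "Tm g v h w = z" by (rule Tm_surj[OF p])
    then have "z \<in> m ` V" by (force simp: V_def m_def)
    then show ?thesis using r(3) by blast
  qed
  define f where "f z = blinfun_apply \<xi> (fst (r z)) + blinfun_apply \<eta> (snd (r z))" for z
  have "linear f"
    unfolding f_def by (rule linearI)
      (simp_all add: linear_add[OF r(2)] linear_scale[OF r(2)] blinfun.add_right blinfun.scaleR_right algebra_simps)
  then have blf: "bounded_linear f" by (rule linear_bounded_fin_dim[OF manifold_fin_dim[OF arrows_manifold]])
  have f: "f (Tm g v h w) = blinfun_apply \<xi> v + blinfun_apply \<eta> w" if c: "tcomposable g v h w" for v w
  proof -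
    obtain v' w' where r': "r (Tm g v h w) = (v', w')" by (cases "r (Tm g v h w)")
    have "r (Tm g v h w) \<in> V" using r(1) by blast
    then have V': "(v', w') \<in> V" "(v, w) \<in> V" using r' c by (auto simp: V_def)
    then have d: "(v - v', w - w') \<in> V" using subspace_diff[OF V V'(2,1)] by simp
    have "m (v', w') = Tm g v h w" using mr[of "Tm g v h w"] r' by simp
    then have "Tm g (v - v') h (w - w') = 0"
      using linear_diff[OF linm, of "(v, w)" "(v', w')"] by (simp add: m_def)
    from Tm_kernel[OF _ this \<xi>] d show ?thesis
      by (simp add: V_def f_def r' blinfun.diff_right)
  qed
  have "comul G (g, \<xi>) (h, \<eta>) = Blinfun f"
    by (rule comul_eqI[OF p]) (simp add: Blinfun_apply[OF blf] f)
  then show ?thesis by (simp add: Blinfun_apply[OF blf] f[OF c])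
qed

section \<open>Gauge transformations and the groupoid structure\<close>

context
  fixes B :: "'g \<Rightarrow> 'e \<Rightarrow>\<^sub>L 'e \<Rightarrow>\<^sub>L real"
  assumes mB: "multiplicative_form G B"
begin

abbreviation (input) "b g v w \<equiv> blinfun_apply (blinfun_apply (B g) v) w"

lemma form_mul:
  assumes "tcomposable g v h w" "tcomposable g v' h w'"
  shows "b (gmul G g h) (Tm g v h w) (Tm g v' h w') = b g v v' + b h w w'"
proof -
  have p: "g \<in> arr" "h \<in> arr" "gtgt G h = gsrc G g"
    using assms by (auto simp: tcomposable_def)
  then have "(g, h) \<in> composable G arr" by (simp add: composable_def)
  then show ?thesis using mB assms tcomposable_iff[OF p] unfolding multiplicative_form_def by blast
qed

text \<open>T1 X is its own square in TG, so multiplicativity says that the value equals twice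
  itself.\<close>

lemma form_units:
  assumes x: "x \<in> obj"
  shows "b (gunit G x) (Tu x X) (Tu x Y) = 0"
proof -
  note gs = groupoid_simps
  let ?u = "gunit G x"
  have u: "?u \<in> arr" using x by (rule gs)
  have c: "tcomposable ?u (Tu x X) ?u (Tu x X)" for X
    using u x by (simp add: tcomposable_def gs Ts_unit Tt_unit)
  have "Tm ?u (Tu x X) ?u (Tu x X) = Tu x X" for X
    using Tm_unit_left[OF u, of "Tu x X"] x by (simp add: gs Tt_unit)
  then show ?thesis using form_mul[OF c c, of X Y] gs(8)[OF u] x by (simp add: gs)
qed

lemma form_tleft:
  assumes g: "g \<in> arr"
  shows "b g v (tleft G g (minus_anchor G (gsrc G g) a)) = b (gunit G (gsrc G g)) (Tu (gsrc G g) (Ts g v)) a"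
proof -
  note gs = groupoid_simps
  let ?x = "gsrc G g"
  let ?u = "gunit G ?x" and ?a = "minus_anchor G ?x a"
  have x: "?x \<in> obj" and u: "?u \<in> arr" using g by (auto simp: gs)
  have c1: "tcomposable g v ?u (Tu ?x (Ts g v))" using g u x by (simp add: tcomposable_def gs Tt_unit)
  have c2: "tcomposable g 0 ?u ?a" using g u x by (simp add: tcomposable_def gs Tt_minus_anchor linear_0[OF linear_Ts])
  have "b g v (tleft G g ?a) = b (gmul G g ?u) (Tm g v ?u (Tu ?x (Ts g v))) (Tm g 0 ?u ?a)"
    using g by (simp add: gs Tm_unit_right tleft_eq[OF g Tt_minus_anchor[OF x]])
  also have "\<dots> = b ?u (Tu ?x (Ts g v)) ?a" using form_mul[OF c1 c2] by (simp add: blinfun.zero_right)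
  \<comment> \<open>\<open>minus_anchor\<close> changes \<open>a\<close> by a vector tangent to the
    units, whose pairing with T1(Ts v) vanishes.\<close>
  also have "\<dots> = b ?u (Tu ?x (Ts g v)) a"
    by (simp add: minus_anchor_eq blinfun.diff_right gs x form_units[OF x])
  finally show ?thesis .
qed

lemma form_tright:
  assumes g: "g \<in> arr" and a: "a \<in> algebroid_fibre G (gtgt G g)"
  shows "b g v (tright G g a) = b (gunit G (gtgt G g)) (Tu (gtgt G g) (Tt g v)) a"
proof -
  note gs = groupoid_simps
  let ?x = "gtgt G g"
  let ?u = "gunit G ?x"
  have x: "?x \<in> obj" and u: "?u \<in> arr" using g by (auto simp: gs)
  have a0: "Ts ?u a = 0" using a by (simp add: algebroid_fibre_def)
  have c1: "tcomposable ?u (Tu ?x (Tt g v)) g v" using g u x by (simp add: tcomposable_def gs Ts_unit)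
  have c2: "tcomposable ?u a g 0" using g u x a0 by (simp add: tcomposable_def gs linear_0[OF linear_Tt])
  have "b g v (tright G g a) = b (gmul G ?u g) (Tm ?u (Tu ?x (Tt g v)) g v) (Tm ?u a g 0)"
    using g by (simp add: gs Tm_unit_left tright_eq[OF g a0])
  also have "\<dots> = b ?u (Tu ?x (Tt g v)) a" using form_mul[OF c1 c2] by (simp add: blinfun.zero_right)
  finally show ?thesis .
qed

text \<open>The product of \<open>v\<close> with its inverse is a unit of TG, and B vanishes on two
  units. As \<open>w\<close> lives at the inverse arrow, it is written as the inverse of
  \<open>?w\<close>.\<close>

lemma form_inv:
  assumes g: "g \<in> arr"
  shows "b (ginv G g) (Ti g v) w = - b g v (Ti (ginv G g) w)"
proof -
  note gs = groupoid_simps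
  let ?i = "ginv G g" and ?w = "Ti (ginv G g) w"
  have i: "?i \<in> arr" using g by (rule gs)
  have w: "Ti g ?w = w" using Ti_inv[OF i] by (simp add: groupoid_inv_inv[OF g])
  have c: "tcomposable g v ?i (Ti g v)" for v using g i by (simp add: tcomposable_def gs Tt_inv)
  have "b g v ?w + b ?i (Ti g v) w = b (gmul G g ?i) (Tm g v ?i (Ti g v)) (Tm g ?w ?i (Ti g ?w))"
    using form_mul[OF c c, of v ?w] by (simp add: w)
  also have "\<dots> = 0" using g by (simp add: gs Tm_inv_right form_units)
  finally show ?thesis by simp
qed

text \<open>For the gauged pair it is enough to verify the defining equation of
  \<open>comul\<close>. Its value on the original pair comes from \<open>comul_apply\<close>, for
  which the cotangent composability of \<open>\<xi>\<close> and \<open>\<eta>\<close> is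
  assumed.\<close>

lemma comul_gauge:
  assumes c: "tcomposable g v h w" and \<xi>: "cosrc G g \<xi> = cotgt G h \<eta>"
  shows "comul G (g, \<xi> + blinfun_apply (B g) v) (h, \<eta> + blinfun_apply (B h) w) =
    comul G (g, \<xi>) (h, \<eta>) + blinfun_apply (B (gmul G g h)) (Tm g v h w)"
proof -
  have p: "g \<in> arr" "h \<in> arr" "gtgt G h = gsrc G g"
    using c by (auto simp: tcomposable_def)
  show ?thesis
    by (rule comul_eqI[OF p]) (simp add: blinfun.add_left comul_apply[OF p \<xi>] form_mul[OF c])
qed

end

end

section \<open>The induced transformation of the base bundle\<close>

type_synonym ('m, 'f, 'e, 'k) base_bundle =
  "('m \<times> 'f \<times> ('e \<Rightarrow> real), 'f \<times> 'f \<times> ('k \<Rightarrow>\<^sub>L real)) manifold"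

text \<open>The value 0 off the algebroid fibre follows the convention of \<open>dual_of\<close>, so
  that shifted functionals stay in that set and agree with \<open>cosrc\<close> and
  \<open>cotgt\<close> on the whole type.\<close>

definition base_form ::
    "('g, 'e::real_normed_vector, 'm, 'f::real_normed_vector) groupoid \<Rightarrow> ('g \<Rightarrow> 'e \<Rightarrow>\<^sub>L 'e \<Rightarrow>\<^sub>L real)
     \<Rightarrow> 'm \<Rightarrow> 'f \<Rightarrow> 'e \<Rightarrow> real" where
  "base_form G B x X a = (if a \<in> algebroid_fibre G x
     then blinfun_apply (blinfun_apply (B (gunit G x)) (snd (tunit G (x, X)))) a else 0)"

definition base_shift ::
    "('g, 'e::real_normed_vector, 'm, 'f::real_normed_vector) groupoid \<Rightarrow> ('g \<Rightarrow> 'e \<Rightarrow>\<^sub>L 'e \<Rightarrow>\<^sub>L real)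
     \<Rightarrow> 'm \<times> 'f \<times> ('e \<Rightarrow> real) \<Rightarrow> 'm \<times> 'f \<times> ('e \<Rightarrow> real)" where
  "base_shift G B = (\<lambda>(x, X, \<xi>). (x, X, \<lambda>a. \<xi> a + base_form G B x X a))"

definition bchart ::
    "('g, 'e::real_normed_vector, 'm, 'f::real_normed_vector) groupoid \<Rightarrow> ('m, 'f) chart \<Rightarrow> 'm set
     \<Rightarrow> ('m \<Rightarrow> 'k::real_normed_vector \<Rightarrow> 'e) \<Rightarrow> ('m \<times> 'f \<times> ('e \<Rightarrow> real), 'f \<times> 'f \<times> ('k \<Rightarrow>\<^sub>L real)) chart" where
  "bchart G c V \<Phi> = ({(x, X, \<xi>). x \<in> V \<and> \<xi> \<in> dual_of (algebroid_fibre G x)},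
     \<lambda>(x, X, \<xi>). (snd c x, dchart (objects G) c x X, Blinfun (\<lambda>k. \<xi> (\<Phi> x k))))"

lemma atlas_tm_dual:
  "atlas (tm_dual_algebroid G) = {bchart G c V \<Phi> | c V \<Phi>. c \<in> atlas (objects G) \<and>
     openin (mtop (objects G)) V \<and> V \<subseteq> fst c \<and> algebroid_frame G V \<Phi>}"
  by (simp add: tm_dual_algebroid_def bchart_def Let_def)

lemma chart_at_tm_dual:
  "chart_at (tm_dual_algebroid G) p = (SOME c. c \<in> atlas (tm_dual_algebroid G) \<and> p \<in> fst c)"
  by (simp add: tm_dual_algebroid_def Let_def)

lemma mem_bchart: "(x, X, \<xi>) \<in> fst (bchart G c V \<Phi>) \<longleftrightarrow> x \<in> V \<and> \<xi> \<in> dual_of (algebroid_fibre G x)"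
  by (simp add: bchart_def)

lemma snd_bchart:
  "snd (bchart G c V \<Phi>) (x, X, \<xi>) = (snd c x, dchart (objects G) c x X, Blinfun (\<lambda>k. \<xi> (\<Phi> x k)))"
  by (simp add: bchart_def)

lemma base_shift_inverse:
  "base_shift G (\<lambda>p. - B p) (base_shift G B p) = p" "base_shift G B (base_shift G (\<lambda>p. - B p) p) = p"
  by (cases p; auto simp: base_shift_def base_form_def blinfun.minus_left)+

lemma has_tangent_eventually_chart:
  assumes M: "charted M" and \<gamma>: "has_tangent M \<gamma> p v" and c: "compatible (chart_at M p) c" "p \<in> fst c"
  shows "\<forall>\<^sub>F t in nhds 0. \<gamma> t \<in> fst c"
proof -
  let ?c = "chart_at M p"
  have p: "p \<in> points M" and \<gamma>0: "\<gamma> 0 = p" and ev: "\<forall>\<^sub>F t in nhds 0. \<gamma> t \<in> fst ?c"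
    and d: "((\<lambda>t. snd ?c (\<gamma> t)) has_vector_derivative v) (at 0)" using \<gamma> by (auto simp: has_tangent_def)
  have ch: "is_chart ?c" using M p by (simp add: charted_def)
  have "isCont (\<lambda>t. snd ?c (\<gamma> t)) 0" using d by (rule has_vector_derivative_continuous)
  then have "((\<lambda>t. snd ?c (\<gamma> t)) \<longlongrightarrow> snd ?c p) (nhds 0)" by (simp add: continuous_at tendsto_nhds_iff \<gamma>0)
  then have "\<forall>\<^sub>F t in nhds 0. snd ?c (\<gamma> t) \<in> snd ?c ` (fst ?c \<inter> fst c)"
    by (rule topological_tendstoD) (use c chartedD[OF M p] in \<open>auto simp: compatible_def\<close>)
  then show ?thesis
    using ev
  proof eventually_elim
    case (elim t)
    then show ?case using ch unfolding is_chart_def by (auto dest: inj_onD)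
  qed
qed

text \<open>Elements of \<open>dual_of\<close> are linear on the fibre only. Composition with a
  frame gives a linear functional on the typical fibre, as the bundle charts need.\<close>

lemma dual_of_comp_linear:
  assumes "\<xi> \<in> dual_of V" "linear \<Phi>" "\<And>k. \<Phi> k \<in> V"
  shows "linear (\<lambda>k. \<xi> (\<Phi> k))"
  using assms by (intro linearI) (simp_all add: dual_of_def linear_add linear_scale)

context
  fixes G :: "('g, 'e::real_inner, 'm, 'f::real_inner) groupoid"
  assumes G: "lie_groupoid G" and k: "finite_dimensional TYPE('k::real_inner)"
begin

lemma subspace_algebroid_fibre:
  assumes "x \<in> points (objects G)"
  shows "subspace (algebroid_fibre G x)"
  using linear_subspace_kernel[OF linear_Ts[OF G groupoid_simps(3)[OF G assms]]]
  by (simp add: algebroid_fibre_def)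

lemma frame_fibre:
  fixes \<Phi> :: "'m \<Rightarrow> 'k \<Rightarrow> 'e"
  assumes "algebroid_frame G V \<Phi>" "x \<in> V"
  shows "linear (\<Phi> x)" "\<Phi> x k \<in> algebroid_fibre G x" "inj (\<Phi> x)" "range (\<Phi> x) = algebroid_fibre G x"
  using assms by (auto simp: algebroid_frame_def bij_betw_def)

lemma frame_bounded_linear:
  fixes \<Phi> :: "'m \<Rightarrow> 'k \<Rightarrow> 'e"
  assumes "algebroid_frame G V \<Phi>" "x \<in> V" "\<xi> \<in> dual_of (algebroid_fibre G x)"
  shows "bounded_linear (\<lambda>k. \<xi> (\<Phi> x k))"
  by (rule linear_bounded_fin_dim[OF fin_dim_real_inner[OF k]])
    (rule dual_of_comp_linear[OF assms(3) frame_fibre(1,2)[OF assms(1,2)]])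

lemma
  fixes \<Phi> :: "'m \<Rightarrow> 'k \<Rightarrow> 'e"
  assumes c: "c \<in> atlas (objects G)" and V: "openin (mtop (objects G)) V" "V \<subseteq> fst c" and \<Phi>: "algebroid_frame G V \<Phi>"
  shows open_bchart_base: "open (snd c ` V)"
    and bchart_image: "snd (bchart G c V \<Phi>) ` fst (bchart G c V \<Phi>) = (snd c ` V) \<times> UNIV"
    and is_chart_bchart: "is_chart (bchart G c V \<Phi>)"
proof -
  note O = objects_manifold[OF G] and chO = objects_charted[OF G]
  have "open (snd c ` (V \<inter> fst c))" using V(1) c chO by (simp add: openin_mtop)
  then show op: "open (snd c ` V)" using V(2) by (simp add: Int_absorb2)
  show img: "snd (bchart G c V \<Phi>) ` fst (bchart G c V \<Phi>) = (snd c ` V) \<times> UNIV"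
  proof (intro set_eqI iffI)
    fix y assume "y \<in> snd (bchart G c V \<Phi>) ` fst (bchart G c V \<Phi>)"
    then show "y \<in> (snd c ` V) \<times> UNIV" by (auto simp: bchart_def)
  next
    fix y :: "'f \<times> 'f \<times> ('k \<Rightarrow>\<^sub>L real)" assume "y \<in> (snd c ` V) \<times> UNIV"
    then obtain x Y \<eta> where y: "y = (snd c x, Y, \<eta>)" "x \<in> V" by (cases y) auto
    have xc: "x \<in> fst c" using y V by blast
    note fr = frame_fibre[OF \<Phi> y(2)]
    \<comment> \<open>The preimage of \<open>\<eta>\<close> is found by inverting the frame at
      \<open>x\<close>, with the dummy value that \<open>dual_of\<close> prescribes off the
      fibre.\<close>
    define \<xi> where "\<xi> a = (if a \<in> algebroid_fibre G x then blinfun_apply \<eta> (inv (\<Phi> x) a) else 0)" for a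
    have inv: "inv (\<Phi> x) (\<Phi> x l) = l" for l using fr(3) by simp
    have sub: "subspace (algebroid_fibre G x)" by (rule subspace_algebroid_fibre[OF atlas_points[OF c xc]])
    have "\<xi> \<in> dual_of (algebroid_fibre G x)"
      unfolding dual_of_def
    proof (intro CollectI conjI ballI allI impI)
      fix u w assume "u \<in> algebroid_fibre G x" "w \<in> algebroid_fibre G x"
      then obtain l j where "u = \<Phi> x l" "w = \<Phi> x j" using fr(4) by (metis imageE)
      then show "\<xi> (u + w) = \<xi> u + \<xi> w"
        using subspace_add[OF sub fr(2) fr(2)] fr(2)
        by (simp add: \<xi>_def inv blinfun.add_right flip: linear_add[OF fr(1)])
    next
      fix r u assume "u \<in> algebroid_fibre G x"
      then obtain l where "u = \<Phi> x l" using fr(4) by (metis imageE)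
      then show "\<xi> (r *\<^sub>R u) = r * \<xi> u"
        using fr(2) by (simp add: \<xi>_def inv blinfun.scaleR_right flip: linear_scale[OF fr(1)])
    qed (simp add: \<xi>_def)
    moreover have "Blinfun (\<lambda>l. \<xi> (\<Phi> x l)) = \<eta>"
      using fr(2) by (simp add: \<xi>_def inv blinfun_apply_inverse)
    ultimately show "y \<in> snd (bchart G c V \<Phi>) ` fst (bchart G c V \<Phi>)"
      using y(2) dchart_dchart_inv[OF O c xc, of Y]
      by (intro image_eqI[of _ _ "(x, dchart_inv (objects G) c x Y, \<xi>)"]) (simp_all add: y(1) mem_bchart snd_bchart)
  qed
  show "is_chart (bchart G c V \<Phi>)"
    unfolding is_chart_def img
  proof (intro conjI open_Times op open_UNIV inj_onI)
    fix p q assume pq: "p \<in> fst (bchart G c V \<Phi>)" "q \<in> fst (bchart G c V \<Phi>)"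
      "snd (bchart G c V \<Phi>) p = snd (bchart G c V \<Phi>) q"
    obtain x X \<xi> where p: "p = (x, X, \<xi>)" by (cases p)
    obtain y Y \<eta> where q: "q = (y, Y, \<eta>)" by (cases q)
    have xy: "x \<in> V" "y \<in> V" "\<xi> \<in> dual_of (algebroid_fibre G x)" "\<eta> \<in> dual_of (algebroid_fibre G y)"
      using pq by (auto simp: p q mem_bchart)
    have eq: "snd c x = snd c y" "dchart (objects G) c x X = dchart (objects G) c y Y"
      "Blinfun (\<lambda>k. \<xi> (\<Phi> x k)) = Blinfun (\<lambda>k. \<eta> (\<Phi> y k))"
      using pq(3) by (simp_all add: p q snd_bchart)
    have x: "x = y" using eq(1) xy V(2) is_chart_atlas[OF chO c] by (auto simp: is_chart_def dest: inj_onD)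
    have xc: "x \<in> fst c" using xy V by blast
    have X: "X = Y" using eq(2) x dchart_inv_dchart[OF O c xc] by metis
    \<comment> \<open>On the fibre the frame is onto, so the chart coordinates decide; off it both
      functionals take the dummy value 0.\<close>
    have "\<xi> a = \<eta> a" for a
    proof (cases "a \<in> algebroid_fibre G x")
      case True
      then obtain l where "a = \<Phi> x l" using frame_fibre(4)[OF \<Phi> xy(1)] by (metis imageE)
      then show ?thesis
        using eq(3) Blinfun_apply[OF frame_bounded_linear[OF \<Phi> xy(1,3)], of l]
          Blinfun_apply[OF frame_bounded_linear[OF \<Phi> xy(2,4)], of l] x by simp
    next
      case False
      then show ?thesis using xy x by (simp add: dual_of_def)
    qed
    then show "p = q" using x X by (auto simp: p q)
  qed
qed

lemma tm_dual_chart_at: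
  fixes p :: "'m \<times> 'f \<times> ('e \<Rightarrow> real)"
  defines "N \<equiv> tm_dual_algebroid G :: ('m, 'f, 'e, 'k) base_bundle"
  assumes "p \<in> points N"
  shows "chart_at N p \<in> atlas N \<and> p \<in> fst (chart_at N p)"
proof -
  have "\<exists>c. c \<in> atlas N \<and> p \<in> fst c" using assms(2) by (auto simp: points_def)
  from someI_ex[OF this] show ?thesis unfolding N_def chart_at_tm_dual by simp
qed

lemma charted_tm_dual:
  "charted (tm_dual_algebroid G :: ('m, 'f, 'e, 'k) base_bundle)"
  unfolding charted_def
proof (intro conjI ballI)
  fix d assume "d \<in> atlas (tm_dual_algebroid G :: ('m, 'f, 'e, 'k) base_bundle)"
  then show "is_chart d" using is_chart_bchart unfolding atlas_tm_dual by blast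
qed (use tm_dual_chart_at in blast)+

lemma points_tm_dual:
  assumes "(x, X, \<xi>) \<in> points (tm_dual_algebroid G :: ('m, 'f, 'e, 'k) base_bundle)"
  shows "x \<in> points (objects G)" "\<xi> \<in> dual_of (algebroid_fibre G x)"
proof -
  obtain c V and \<Phi> :: "'m \<Rightarrow> 'k \<Rightarrow> 'e" where c: "c \<in> atlas (objects G)" "V \<subseteq> fst c"
      "(x, X, \<xi>) \<in> fst (bchart G c V \<Phi>)"
    using assms unfolding points_def[of "tm_dual_algebroid G"] atlas_tm_dual by blast
  then have "x \<in> fst c" by (auto simp: mem_bchart)
  with c(1) show "x \<in> points (objects G)" by (rule atlas_points)
  show "\<xi> \<in> dual_of (algebroid_fibre G x)" using c(3) by (simp add: mem_bchart)
qed

section \<open>Smoothness of the shift on the base bundle\<close>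

lemma base_form_dual:
  assumes "x \<in> points (objects G)" "\<xi> \<in> dual_of (algebroid_fibre G x)"
  shows "(\<lambda>a. \<xi> a + base_form G B x X a) \<in> dual_of (algebroid_fibre G x)"
  using assms subspace_algebroid_fibre[OF assms(1)]
  by (auto simp: dual_of_def base_form_def subspace_add subspace_scale blinfun.add_right blinfun.scaleR_right algebra_simps)

lemma linear_base_form_left:
  assumes "x \<in> points (objects G)"
  shows "linear (\<lambda>X. base_form G B x X a)"
  by (rule linearI) (simp_all add: base_form_def linear_add[OF linear_Tu[OF G assms]] linear_scale[OF linear_Tu[OF G assms]]
      blinfun.add_right blinfun.scaleR_right blinfun.add_left blinfun.scaleR_left)

lemma linear_base_form_right:
  fixes \<Phi> :: "'m \<Rightarrow> 'k \<Rightarrow> 'e"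
  assumes "algebroid_frame G V \<Phi>" "x \<in> V"
  shows "linear (\<lambda>k. base_form G B x X (\<Phi> x k))"
proof -
  have "linear (\<lambda>k. blinfun_apply (blinfun_apply (B (gunit G x)) (snd (tunit G (x, X)))) (\<Phi> x k))"
    using linear_compose[OF frame_fibre(1)[OF assms] bounded_linear.linear[OF blinfun.bounded_linear_right]]
    by (simp add: o_def)
  then show ?thesis by (simp add: base_form_def frame_fibre(2)[OF assms])
qed

lemma atlas_tangent:
  "atlas (tangent M) = (\<lambda>c. ({(p, v). p \<in> fst c}, \<lambda>(p, v). (snd c p, dchart M c p v))) ` atlas M"
  by (simp add: tangent_def Let_def)

text \<open>Near a unit, an arrow chart turns the function into \<open>form2_rep\<close> with smooth
  arguments: the first is T1 X, a directional derivative of the coordinate unit map, and the second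
  is the frame.\<close>

lemma smooth_on_base_form:
  fixes \<Phi> :: "'m \<Rightarrow> 'k \<Rightarrow> 'e"
  assumes B: "two_form (arrows G) B" and c: "c \<in> atlas (objects G)" and V: "openin (mtop (objects G)) V" "V \<subseteq> fst c"
    and \<Phi>: "algebroid_frame G V \<Phi>"
  shows "smooth_on (snd c ` V) (\<lambda>y. base_form G B (cinv c y) (dchart_inv (objects G) c (cinv c y) Y) (\<Phi> (cinv c y) l))"
proof (rule smooth_on_local)
  note A = arrows_manifold[OF G] and O = objects_manifold[OF G]
  note chA = arrows_charted[OF G] and chO = objects_charted[OF G]
  have ch: "is_chart c" by (rule is_chart_atlas[OF chO c])
  fix y0 assume "y0 \<in> snd c ` V"
  then obtain x0 where x0: "x0 \<in> V" "y0 = snd c x0" by blast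
  have x0O: "x0 \<in> points (objects G)" using x0 V c by (auto intro: atlas_points)
  have u0: "gunit G x0 \<in> points (arrows G)" by (rule groupoid_simps(3)[OF G x0O])
  define d where "d = chart_at (arrows G) (gunit G x0)"
  have d: "d \<in> atlas (arrows G)" "gunit G x0 \<in> fst d" using chartedD[OF chA u0] by (simp_all add: d_def)
  \<comment> \<open>Units over \<open>V\<close> may leave the domain of \<open>d\<close>, so the
    argument runs on this smaller neighbourhood of \<open>x0\<close>.\<close>
  let ?W = "V \<inter> {x. gunit G x \<in> fst d}"
  define D where "D = ({(p, v :: 'e). p \<in> fst d}, \<lambda>(p, v). (snd d p, dchart (arrows G) d p v))"
  have D: "D \<in> atlas (tangent (arrows G))" using d by (simp add: D_def atlas_tangent)
  have frame: "open (snd c ` ?W) \<and> smooth_on (snd c ` ?W)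
      (\<lambda>y. (snd d (gunit G (cinv c y)), dchart (arrows G) d (gunit G (cinv c y)) (\<Phi> (cinv c y) l)))" for l
  proof -
    have "smooth_open (objects G) V (tangent (arrows G)) (\<lambda>x. (gunit G x, \<Phi> x l))"
      using \<Phi> by (simp add: algebroid_frame_def)
    then have "open (snd c ` (V \<inter> fst c \<inter> (\<lambda>x. (gunit G x, \<Phi> x l)) -` fst D)) \<and>
        smooth_on (snd c ` (V \<inter> fst c \<inter> (\<lambda>x. (gunit G x, \<Phi> x l)) -` fst D)) (snd D \<circ> (\<lambda>x. (gunit G x, \<Phi> x l)) \<circ> cinv c)"
      using c D unfolding smooth_open_def Let_def by blast
    moreover have "V \<inter> fst c \<inter> (\<lambda>x. (gunit G x, \<Phi> x l)) -` fst D = ?W" using V(2) by (auto simp: D_def)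
    ultimately show ?thesis by (simp add: D_def o_def)
  qed
  have W: "open (snd c ` ?W)" using frame by blast
  \<comment> \<open>The unit map in coordinates; its smoothness is contained in that of the frame,
    as the base component.\<close>
  define F where "F y = snd d (gunit G (cinv c y))" for y
  have F: "smooth_on (snd c ` ?W) F"
    using smooth_on_fst[OF W conjunct2[OF frame]] by (simp add: F_def[abs_def])
  have H: "smooth_on (snd c ` ?W) (\<lambda>y. dchart (arrows G) d (gunit G (cinv c y)) (\<Phi> (cinv c y) l))"
    using smooth_on_snd[OF W conjunct2[OF frame]] by simp
  have inW: "cinv c y \<in> V \<and> cinv c y \<in> fst c \<and> cinv c y \<in> points (objects G) \<and> gunit G (cinv c y) \<in> fst d \<and> snd c (cinv c y) = y"
    if y: "y \<in> snd c ` ?W" for y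
  proof -
    obtain x where x: "x \<in> ?W" "y = snd c x" using y by blast
    then have "cinv c y = x" using V(2) by (auto simp: cinv_chart[OF ch])
    then show ?thesis using x V(2) c by (auto intro: atlas_points)
  qed
  have eq: "form2_rep (arrows G) d B (F y) (frechet_derivative F (at y) Y)
      (dchart (arrows G) d (gunit G (cinv c y)) (\<Phi> (cinv c y) l)) =
    base_form G B (cinv c y) (dchart_inv (objects G) c (cinv c y) Y) (\<Phi> (cinv c y) l)"
    if y: "y \<in> snd c ` ?W" for y
  proof -
    define x where "x = cinv c y"
    define X where "X = dchart_inv (objects G) c x Y"
    have x: "x \<in> V" "x \<in> fst c" "x \<in> points (objects G)" "gunit G x \<in> fst d" "snd c x = y"
      using inW[OF y] by (auto simp: x_def)
    have XY: "dchart (objects G) c x X = Y" using dchart_dchart_inv[OF O c x(2)] by (simp add: X_def)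
    \<comment> \<open>Differentiating the units along this curve both through \<open>F\<close> and
      through the tangent map identifies the derivative of \<open>F\<close> along \<open>Y\<close>
      with T1 X in the chart \<open>d\<close>.\<close>
    obtain \<gamma> where \<gamma>: "has_tangent (objects G) \<gamma> x X" using has_tangent_exists[OF chO x(3)] by blast
    note cx = chartedD(1)[OF chO x(3)] and du = chartedD(1)[OF chA groupoid_simps(3)[OF G x(3)]]
    have 1: "((\<lambda>t. snd c (\<gamma> t)) has_vector_derivative Y) (at 0)"
      using has_tangent_chart[OF chO \<gamma> manifold_compatible[OF O cx c] x(2)] by (simp add: XY)
    have 2: "((\<lambda>t. snd d (gunit G (\<gamma> t))) has_vector_derivative dchart (arrows G) d (gunit G x) (snd (tunit G (x, X)))) (at 0)"
      by (rule has_tangent_chart[OF chA has_tangent_unit[OF G \<gamma>] manifold_compatible[OF A du d(1)] x(4)])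
    have \<gamma>0: "\<gamma> 0 = x" using \<gamma> by (simp add: has_tangent_def)
    have "(F has_derivative frechet_derivative F (at y)) (at (snd c (\<gamma> 0)))"
      using smooth_on_has_derivative[OF F y] by (simp add: \<gamma>0 x)
    then have 3: "((\<lambda>t. F (snd c (\<gamma> t))) has_vector_derivative frechet_derivative F (at y) Y) (at 0)"
      by (rule vector_derivative_compose_within[OF 1, where A = UNIV, rotated]) simp
    have "\<forall>\<^sub>F t in nhds 0. \<gamma> t \<in> fst c"
      by (rule has_tangent_eventually_chart[OF chO \<gamma> manifold_compatible[OF O cx c] x(2)])
    then have "\<forall>\<^sub>F t in nhds 0. F (snd c (\<gamma> t)) = snd d (gunit G (\<gamma> t))"
      by eventually_elim (simp add: F_def cinv_chart[OF ch])
    from has_vector_derivative_cong_nhds[OF 3 this] 2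
    have "frechet_derivative F (at y) Y = dchart (arrows G) d (gunit G x) (snd (tunit G (x, X)))"
      by (rule vector_derivative_unique_at)
    moreover have "F y = snd d (gunit G x)" by (simp add: F_def x_def)
    ultimately show ?thesis
      unfolding x_def[symmetric] X_def[symmetric] base_form_def
      using frame_fibre(2)[OF \<Phi> x(1), of l] form2_rep_eq[OF A d(1) x(4)] dchart_inv_dchart[OF A d(1) x(4)] by simp
  qed
  have "smooth_on (snd c ` ?W) (\<lambda>y. form2_rep (arrows G) d B (F y) (frechet_derivative F (at y) Y)
      (dchart (arrows G) d (gunit G (cinv c y)) (\<Phi> (cinv c y) l)))"
    by (rule smooth_on_form_insert[OF A B d(1) W F _ smooth_on_derivative[OF F] H]) (use inW in \<open>auto simp: F_def\<close>)
  then have "smooth_on (snd c ` ?W) (\<lambda>y. base_form G B (cinv c y) (dchart_inv (objects G) c (cinv c y) Y) (\<Phi> (cinv c y) l))"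
    by (rule smooth_on_cong[OF W, rotated]) (rule eq)
  moreover have "y0 \<in> snd c ` ?W" using x0 d by auto
  ultimately show "\<exists>T. open T \<and> y0 \<in> T \<and>
      smooth_on T (\<lambda>y. base_form G B (cinv c y) (dchart_inv (objects G) c (cinv c y) Y) (\<Phi> (cinv c y) l))"
    using W by blast
qed

text \<open>In a chart the shift adds a covector depending on base point and vector. Smoothness is
  known for fixed \<open>Y\<close> and \<open>l\<close>; linearity in \<open>Y\<close> admits a
  moving vector, and linearity in \<open>l\<close> collects the values to a smooth covector.\<close>

lemma base_shift_chart_rep:
  assumes B: "two_form (arrows G) B"
    and d: "d \<in> atlas (tm_dual_algebroid G :: ('m, 'f, 'e, 'k) base_bundle)"
  shows "\<exists>R. smooth_on (snd d ` fst d) R \<and> (\<forall>p\<in>fst d. snd d (base_shift G B p) = R (snd d p))"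
proof -
  obtain c V and \<Phi> :: "'m \<Rightarrow> 'k \<Rightarrow> 'e" where c: "c \<in> atlas (objects G)" and V: "openin (mtop (objects G)) V" "V \<subseteq> fst c"
    and \<Phi>: "algebroid_frame G V \<Phi>" and d: "d = bchart G c V \<Phi>"
    using d unfolding atlas_tm_dual by blast
  note O = objects_manifold[OF G] and chO = objects_charted[OF G]
  have ch: "is_chart c" by (rule is_chart_atlas[OF chO c])
  let ?S = "(snd c ` V) \<times> (UNIV :: ('f \<times> ('k \<Rightarrow>\<^sub>L real)) set)"
  define Q where "Q y Y l = base_form G B (cinv c y) (dchart_inv (objects G) c (cinv c y) Y) (\<Phi> (cinv c y) l)" for y Y l
  define R where "R z = (fst z, fst (snd z), snd (snd z) + Blinfun (Q (fst z) (fst (snd z))))"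
    for z :: "'f \<times> 'f \<times> ('k \<Rightarrow>\<^sub>L real)"
  have S: "open ?S" by (intro open_Times open_bchart_base[OF c V \<Phi>] open_UNIV)
  have cV: "cinv c y \<in> V \<and> cinv c y \<in> fst c \<and> cinv c y \<in> points (objects G)" if y: "y \<in> snd c ` V" for y
  proof -
    obtain x where x: "x \<in> V" "y = snd c x" using y by blast
    then have "cinv c y = x" using V(2) by (auto simp: cinv_chart[OF ch])
    then show ?thesis using x V(2) c by (auto intro: atlas_points)
  qed
  have fd: "fin_dim TYPE('f)" "fin_dim TYPE('k)" by (rule manifold_fin_dim[OF O], rule fin_dim_real_inner[OF k])
  have linl: "linear (\<lambda>Y. Q y Y l)" if "y \<in> snd c ` V" for y l
    unfolding Q_def
    using linear_compose[OF linear_dchart_inv[OF O c, of "cinv c y"] linear_base_form_left[of "cinv c y"]] cV[OF that]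
    by (simp add: o_def)
  have linr: "linear (Q y Y)" if "y \<in> snd c ` V" for y Y
    unfolding Q_def using linear_base_form_right[OF \<Phi>] cV[OF that] by blast
  have Q1: "smooth_on ?S (\<lambda>z. Q (fst z) Y l)" for Y l
    unfolding Q_def
    by (rule smooth_on_compose[OF fd(1) S smooth_on_fst[OF S smooth_on_ident[OF S]] smooth_on_base_form[OF B c V \<Phi>]]) auto
  have Q2: "smooth_on ?S (\<lambda>z. Q (fst z) (fst (snd z)) l)" for l
  proof (rule smooth_on_linear_apply[OF fd(1) S, where A = "\<lambda>z Y. Q (fst z) Y l"])
    show "linear (\<lambda>Y. Q (fst z) Y l)" if "z \<in> ?S" for z using that by (intro linl) auto
    show "smooth_on ?S (\<lambda>z. fst (snd z))" by (rule smooth_on_fst[OF S smooth_on_snd[OF S smooth_on_ident[OF S]]])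
  qed (rule Q1)
  have "smooth_on ?S (\<lambda>z. Blinfun (Q (fst z) (fst (snd z))))"
    by (rule smooth_on_Blinfun[OF fd(2) S linr Q2]) auto
  then have "smooth_on ?S R"
    unfolding R_def by (intro smooth_on_Pair smooth_on_add S smooth_on_fst smooth_on_snd smooth_on_ident)
  moreover have "snd d (base_shift G B p) = R (snd d p)" if p: "p \<in> fst d" for p
  proof -
    obtain x X \<xi> where p': "p = (x, X, \<xi>)" by (cases p)
    have x: "x \<in> V" "\<xi> \<in> dual_of (algebroid_fibre G x)" using p by (auto simp: p' d mem_bchart)
    have xc: "x \<in> fst c" "cinv c (snd c x) = x" using x V(2) by (auto simp: cinv_chart[OF ch])
    have Q: "Q (snd c x) (dchart (objects G) c x X) = (\<lambda>l. base_form G B x X (\<Phi> x l))"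
      by (simp add: Q_def xc dchart_inv_dchart[OF O c] fun_eq_iff)
    have bl: "bounded_linear (\<lambda>l. base_form G B x X (\<Phi> x l))"
      by (rule linear_bounded_fin_dim[OF fd(2) linear_base_form_right[OF \<Phi> x(1)]])
    have "Blinfun (\<lambda>l. \<xi> (\<Phi> x l) + base_form G B x X (\<Phi> x l)) =
        Blinfun (\<lambda>l. \<xi> (\<Phi> x l)) + Blinfun (\<lambda>l. base_form G B x X (\<Phi> x l))"
      by (rule blinfun_eqI) (simp add: Blinfun_apply bounded_linear_add bl frame_bounded_linear[OF \<Phi> x] blinfun.add_left)
    then show ?thesis by (simp add: p' d base_shift_def snd_bchart R_def Q)
  qed
  ultimately show ?thesis unfolding d bchart_image[OF c V \<Phi>] by blast
qed

lemma chartwise_diffeo_base_shift: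
  assumes B: "two_form (arrows G) B"
  shows "chartwise_diffeo (tm_dual_algebroid G :: ('m, 'f, 'e, 'k) base_bundle)
    (base_shift G B) (base_shift G (\<lambda>p. - B p))"
    (is "chartwise_diffeo ?N _ _")
proof -
  have mem: "base_shift G B p \<in> fst d" if d: "d \<in> atlas ?N" and p: "p \<in> fst d" for B d p
  proof -
    obtain c V and \<Phi> :: "'m \<Rightarrow> 'k \<Rightarrow> 'e" where c: "c \<in> atlas (objects G)" "V \<subseteq> fst c" "d = bchart G c V \<Phi>"
      using d unfolding atlas_tm_dual by blast
    obtain x X \<xi> where p': "p = (x, X, \<xi>)" by (cases p)
    have x: "x \<in> V" "\<xi> \<in> dual_of (algebroid_fibre G x)" using p by (auto simp: p' c mem_bchart)
    then have "x \<in> points (objects G)" using c by (auto intro: atlas_points)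
    then show ?thesis using base_form_dual x by (simp add: p' c(3) base_shift_def mem_bchart)
  qed
  have iff: "base_shift G B p \<in> fst d \<longleftrightarrow> p \<in> fst d" if "d \<in> atlas ?N" for B d p
    using mem[OF that, of p B] mem[OF that, of "base_shift G B p" "\<lambda>p. - B p"] base_shift_inverse(1)[of G B p] by auto
  \<comment> \<open>The preferred chart is picked by \<open>SOME\<close>. A point and its shift lie
    in the same chart domains, so both choices are made from the same predicate and
    coincide.\<close>
  have "chart_at ?N (base_shift G B p) = chart_at ?N p" for p
    unfolding chart_at_tm_dual by (rule arg_cong[where f = Eps]) (use iff in blast)
  then show ?thesis
    unfolding chartwise_diffeo_def
    using base_shift_chart_rep[OF B] base_shift_chart_rep[OF two_form_uminus[OF arrows_manifold[OF G] B]]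
    by (simp add: mem base_shift_inverse)
qed

end

section \<open>Multiplicativity of the gauge-transformed structure\<close>

context
  fixes G :: "('g, 'e::real_inner, 'm, 'f::real_inner) groupoid" and B :: "'g \<Rightarrow> 'e \<Rightarrow>\<^sub>L 'e \<Rightarrow>\<^sub>L real"
  assumes G: "lie_groupoid G" and mB: "multiplicative_form G B"
begin

lemma cosrc_gauge:
  assumes "g \<in> points (arrows G)"
  shows "cosrc G g (\<xi> + blinfun_apply (B g) v) = (\<lambda>a. cosrc G g \<xi> a + base_form G B (gsrc G g) (snd (tsrc G (g, v))) a)"
  using form_tleft[OF G mB assms] by (auto simp: fun_eq_iff cosrc_def base_form_def blinfun.add_left)

lemma cotgt_gauge:
  assumes "g \<in> points (arrows G)"
  shows "cotgt G g (\<xi> + blinfun_apply (B g) v) = (\<lambda>a. cotgt G g \<xi> a + base_form G B (gtgt G g) (snd (ttgt G (g, v))) a)"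
  using form_tright[OF G mB assms] by (auto simp: fun_eq_iff cotgt_def base_form_def blinfun.add_left)

text \<open>The minus sign in \<open>coinv\<close> cancels against the one in
  \<open>form_inv\<close>.\<close>

lemma coinv_gauge:
  assumes g: "g \<in> points (arrows G)"
  shows "coinv G g (\<xi> + blinfun_apply (B g) v) = coinv G g \<xi> + blinfun_apply (B (ginv G g)) (snd (tinv G (g, v)))"
proof -
  have i: "ginv G g \<in> points (arrows G)" using g by (rule groupoid_simps[OF G])
  have bl: "bounded_linear (\<lambda>w. - blinfun_apply \<zeta> (snd (tinv G (ginv G g, w))))" for \<zeta>
    by (intro bounded_linear_minus bounded_linear_compose[OF blinfun.bounded_linear_right]
        linear_bounded_fin_dim[OF manifold_fin_dim[OF arrows_manifold[OF G]] linear_Ti[OF G i]])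
  then have c: "blinfun_apply (coinv G g \<zeta>) w = - blinfun_apply \<zeta> (snd (tinv G (ginv G g, w)))" for \<zeta> w
    unfolding coinv_def by (rule Blinfun_apply)
  show ?thesis
    by (rule blinfun_eqI) (simp add: c blinfun.add_left form_inv[OF G mB g])
qed

text \<open>\<open>Q\<close> projects onto the algebroid fibre along the units. B(T1 X, .) vanishes
  on vectors tangent to the units, so composing it with \<open>Q\<close> changes nothing.\<close>

lemma counit_gauge:
  assumes x: "x \<in> points (objects G)" and \<xi>: "\<xi> \<in> dual_of (algebroid_fibre G x)"
  shows "counit G x (\<lambda>a. \<xi> a + base_form G B x X a) = counit G x \<xi> + blinfun_apply (B (gunit G x)) (snd (tunit G (x, X)))"
proof -
  let ?u = "gunit G x"
  have u: "?u \<in> points (arrows G)" using x by (rule groupoid_simps[OF G])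
  have fd: "fin_dim TYPE('e)" by (rule manifold_fin_dim[OF arrows_manifold[OF G]])
  define Q where "Q v = v - snd (tunit G (tsrc G (?u, v)))" for v
  have Q: "Q v = v - snd (tunit G (x, snd (tsrc G (?u, v))))" for v
    unfolding Q_def by (subst tsrc_eq[OF G]) (simp add: groupoid_simps[OF G] x)
  have linQ: "linear Q"
    unfolding Q using linear_compose_sub[OF linear_ident linear_compose[OF linear_Ts[OF G u] linear_Tu[OF G x]]] by (simp add: o_def)
  have QA: "Q v \<in> algebroid_fibre G x" for v
    using linear_diff[OF linear_Ts[OF G u]] Ts_unit[OF G x] by (simp add: algebroid_fibre_def Q)
  have bl: "bounded_linear (\<lambda>v. \<zeta> (Q v))" if "\<zeta> \<in> dual_of (algebroid_fibre G x)" for \<zeta>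
    using that QA linQ by (intro linear_bounded_fin_dim[OF fd] linearI) (auto simp: dual_of_def linear_add linear_scale)
  have bq: "base_form G B x X (Q v) = blinfun_apply (blinfun_apply (B ?u) (snd (tunit G (x, X)))) v" for v
    using QA[of v] form_units[OF G mB x] by (simp add: base_form_def Q blinfun.diff_right)
  show ?thesis
    unfolding counit_def Q_def[symmetric]
    by (rule blinfun_eqI) (simp add: Blinfun_apply[OF bl[OF \<xi>]] blinfun.add_left bq
        Blinfun_apply[OF bounded_linear_add[OF bl[OF \<xi>] blinfun.bounded_linear_right]])
qed

lemma lie_subgroupoid_tau:
  assumes k: "finite_dimensional TYPE('k::real_inner)" and B: "two_form (arrows G) B"
    and L: "lie_subgroupoid (courant_groupoid G ::
      ('g \<times> 'e gvec, 'e \<times> 'e gvec, 'm \<times> 'f \<times> ('e \<Rightarrow> real), 'f \<times> 'f \<times> ('k \<Rightarrow>\<^sub>L real)) groupoid) L"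
  shows "lie_subgroupoid (courant_groupoid G ::
      ('g \<times> 'e gvec, 'e \<times> 'e gvec, 'm \<times> 'f \<times> ('e \<Rightarrow> real), 'f \<times> 'f \<times> ('k \<Rightarrow>\<^sub>L real)) groupoid) (tau B ` L)"
    (is "lie_subgroupoid ?K _")
proof -
  obtain N where N: "lie_groupoid_on ?K L N" using L unfolding lie_subgroupoid_def by blast
  note A = arrows_manifold[OF G] and O = objects_manifold[OF G]
  have K: "arrows ?K = gtangent (arrows G)" "objects ?K = tm_dual_algebroid G"
    by (simp_all add: courant_groupoid_def)
  have LA: "g \<in> points (arrows G)" if "(g, e) \<in> L" for g e
  proof -
    have "L \<subseteq> points (gtangent (arrows G))"
      using N by (simp add: lie_groupoid_on_def embedded_submanifold_def K)
    then show ?thesis using that by (auto simp: points_gtangent)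
  qed
  have NO: "p \<in> points (objects ?K)" if "p \<in> N" for p
  proof -
    have "N \<subseteq> points (objects ?K)" using N by (simp add: lie_groupoid_on_def embedded_submanifold_def)
    then show ?thesis using that by blast
  qed
  \<comment> \<open>The objects move along with the arrows: the new object set is the shifted one,
    since gauging adds to the cotangent source and target.\<close>
  have "lie_groupoid_on ?K (tau B ` L) (base_shift G B ` N)"
  proof (rule lie_groupoid_on_transport[OF _ _ _ _ _ _ N])
    show "fin_dim TYPE('e \<times> 'e gvec)" by (intro fin_dim_prod manifold_fin_dim[OF A] fin_dim_gvec[OF A])
    show "fin_dim TYPE('f \<times> 'f \<times> ('k \<Rightarrow>\<^sub>L real))"
      by (intro fin_dim_prod fin_dim_dual manifold_fin_dim[OF O] fin_dim_real_inner[OF k])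
    show "charted (arrows ?K)" unfolding K by (rule charted_gtangent[OF A])
    show "charted (objects ?K)" unfolding K by (rule charted_tm_dual[OF G k])
    show "chartwise_diffeo (arrows ?K) (tau B) (tau (\<lambda>p. - B p))" unfolding K by (rule chartwise_diffeo_tau[OF A B])
    show "chartwise_diffeo (objects ?K) (base_shift G B) (base_shift G (\<lambda>p. - B p))"
      unfolding K by (rule chartwise_diffeo_base_shift[OF G k B])
  next
    fix p assume p: "p \<in> L"
    obtain g v \<xi> where p': "p = (g, v, \<xi>)" by (cases p)
    have g: "g \<in> points (arrows G)" using LA p p' by blast
    show "gsrc ?K (tau B p) = base_shift G B (gsrc ?K p)"
      by (simp add: courant_groupoid_def tau_def base_shift_def p' cosrc_gauge[OF g])
    show "gtgt ?K (tau B p) = base_shift G B (gtgt ?K p)"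
      by (simp add: courant_groupoid_def tau_def base_shift_def p' cotgt_gauge[OF g])
    show "ginv ?K (tau B p) = tau B (ginv ?K p)"
      by (simp add: courant_groupoid_def tau_def p' coinv_gauge[OF g])
  next
    fix p q assume p: "p \<in> L" and q: "q \<in> L" and c: "gtgt ?K q = gsrc ?K p"
    obtain g v \<xi> where p': "p = (g, v, \<xi>)" by (cases p)
    obtain h w \<eta> where q': "q = (h, w, \<eta>)" by (cases q)
    \<comment> \<open>Equality of target and source in the direct sum splits into composability in
      TG and equality of the cotangent components, the two inputs of
      \<open>comul_gauge\<close>.\<close>
    have "tcomposable G g v h w" "cosrc G g \<xi> = cotgt G h \<eta>"
      using LA p q c by (auto simp: courant_groupoid_def tcomposable_def[OF G] p' q')
    from comul_gauge[OF G mB this] show "gmul ?K (tau B p) (tau B q) = tau B (gmul ?K p q)"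
      by (simp add: courant_groupoid_def tau_def p' q')
  next
    fix y assume y: "y \<in> N"
    obtain x X \<xi> where y': "y = (x, X, \<xi>)" by (cases y)
    have "(x, X, \<xi>) \<in> points (tm_dual_algebroid G :: ('m, 'f, 'e, 'k) base_bundle)"
      using NO[OF y] by (simp add: K y')
    from counit_gauge[OF points_tm_dual[OF G k this]]
    show "gunit ?K (base_shift G B y) = tau B (gunit ?K y)"
      by (simp add: courant_groupoid_def tau_def base_shift_def y')
  qed
  then show ?thesis unfolding lie_subgroupoid_def by blast
qed

end

theorem corollary5p9:
  fixes G :: "('g, 'e::real_inner, 'm, 'f::real_inner) groupoid"
    and L :: "('g \<times> 'e gvec) set"
    and B :: "'g \<Rightarrow> 'e \<Rightarrow>\<^sub>L 'e \<Rightarrow>\<^sub>L real"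
  assumes "lie_groupoid G"
    and "finite_dimensional TYPE('k::real_inner)"
    and "dim (UNIV :: 'e set) = dim (UNIV :: 'f set) + dim (UNIV :: 'k set)"
    and "multiplicative_dirac TYPE('k) G L"
    and "two_form (arrows G) B"
    and "closed_form (arrows G) B"
    and "multiplicative_form G B"
  shows "multiplicative_dirac TYPE('k) G (tau B ` L)"
  using dirac_structure_tau[OF arrows_manifold[OF assms(1)] assms(5,6)]
    lie_subgroupoid_tau[OF assms(1,7,2,5)] assms(4)
  unfolding multiplicative_dirac_def by blast

end
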